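(* Let $A$ be a Noetherian integral domain of characteristic zero, and let $I_2=(2,\ a^2-a \text{ for all } a\in A)\subseteq A$. Then the following $A$-modules are isomorphic: \begin{itemize} \item the sections $H^0_{fl}(\mathcal{M}_{fmA}^{2\text{-}buds}; \omega^{\otimes 2})$ of the second tensor power $\omega^{\otimes 2}$ of the bundle of invariant differentials on $\mathcal{M}_{fmA}^{2\text{-}buds}$; \item the André–Quillen homology group $H_2(A, A/I_2; A/I_2)$ of $A/I_2$ regarded as an $A$-algebra, with coefficients in $A/I_2$. \end{itemize}
   Context: Formal $A$-module 2-buds: for a commutative ring $A$ and commutative $A$-algebra $R$, a formal $A$-module $2$-bud over $R$ is an element $F\in R[[X,Y]]/(X,Y)^3$ satisfying the commutative formal group law axioms modulo $(X,Y)^3$, with a ring homomorphism $\rho:A\to\mathrm{End}(F)\subseteq R[[X]]/(X^3)$ (addition $F(f,g)$, multiplication composition) with $\rho(a)\equiv aX \bmod X^2$. Strict isomorphisms are isomorphisms $f\equiv X \bmod X^2$. The groupoid of these is corepresented by the graded Hopf algebroid $(L^A_{2\text{-}buds},L^A_{2\text{-}buds}B)$ described as follows. Let $\mathrm{Dr}^A$ be the $A$-module generated by symbols $\gamma$ and $c_a$ ($a\in A$), in degree $2$, subject to $(a^2-a)\gamma=2c_a$, $c_{a+b}-c_a-c_b=ab\gamma$, $ac_b+b^2c_a=c_{ab}$ for all $a,b\in A$. Then $L^A_{2\text{-}buds}=\mathrm{Sym}_A(\mathrm{Dr}^A)$, $L^A_{2\text{-}buds}B=L^A_{2\text{-}buds}[t]$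 with $|t|=2$, $\eta_L(x)=x$, $\eta_R(\gamma)=\gamma+2t$, $\eta_R(c_a)=c_a+(a^2-a)t$, $\Delta(t)=t\otimes1+1\otimes t$, $\epsilon(t)=0$. $\mathcal{M}_{fmA}^{2\text{-}buds}$ is the Artin stack obtained by stackifying the groupoid scheme $(\mathrm{Spec}\,L^A_{2\text{-}buds},\mathrm{Spec}\,L^A_{2\text{-}buds}B)$, $\omega$ is its line bundle of invariant differentials (corresponding to the graded comodule $\Sigma^2L^A_{2\text{-}buds}$), and its flat cohomology is $H^s_{fl}(\mathcal{M}_{fmA}^{2\text{-}buds};\omega^{\otimes n})=\mathrm{Cotor}^{s,2n}_{L^A_{2\text{-}buds}B}(L^A_{2\text{-}buds},L^A_{2\text{-}buds})$, the cohomology of the cobar complex in cohomological degree $s$ and internal degree $2n$. In particular $H^0_{fl}(\mathcal{M}_{fmA}^{2\text{-}buds};\omega^{\otimes n})$ is the degree $2n$ part of $\ker(\eta_R-\eta_L)$. *)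

theory Defs
  imports
    "HOL-Library.Poly_Mapping"
    "HOL-Algebra.Algebraic_Closure_Type"
begin

abbreviation (input) "lookup \<equiv> Poly_Mapping.lookup"
abbreviation (input) "keys \<equiv> Poly_Mapping.keys"


section \<open>Modules\<close>

definition isomorphic_modules ::
    "('r, 'k) ring_scheme \<Rightarrow> ('r, 'm, 'c) module_scheme \<Rightarrow> ('r, 'n, 'd) module_scheme \<Rightarrow> bool"
  where "isomorphic_modules R M N \<longleftrightarrow> (\<exists>f. bij_betw f (carrier M) (carrier N) \<and>
    (\<forall>x\<in>carrier M. \<forall>y\<in>carrier M. f (x \<oplus>\<^bsub>M\<^esub> y) = f x \<oplus>\<^bsub>N\<^esub> f y) \<and>
    (\<forall>r\<in>carrier R. \<forall>x\<in>carrier M. f (r \<odot>\<^bsub>M\<^esub> x) = r \<odot>\<^bsub>N\<^esub> f x))"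

text \<open>The module of cosets \<open>Z / N\<close> for submodules \<open>N\<close> and \<open>Z\<close> of a module with underlying
  additive group \<open>'v\<close> and scalar multiplication \<open>scl\<close>. The fields \<open>mult\<close> and \<open>one\<close>
  of the record type play no role for modules.\<close>

definition quotient_module ::
    "('r \<Rightarrow> 'v \<Rightarrow> 'v) \<Rightarrow> 'v set \<Rightarrow> 'v set \<Rightarrow> ('r, 'v::ab_group_add set) module"
  where "quotient_module scl Z N =
    \<lparr> carrier = (\<lambda>z. (+) z ` N) ` Z,
      monoid.mult = undefined,
      one = undefined,
      ring.zero = N,
      add = (\<lambda>U V. {u + v | u v. u \<in> U \<and> v \<in> V}),
      module.smult = (\<lambda>r U. {scl r u + n | u n. u \<in> U \<and> n \<in> N}) \<rparr>"

text \<open>The free module on \<open>'x\<close> with coefficients in \<open>'w\<close> is \<open>'x \<Rightarrow>\<^sub>0 'w\<close>;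
  \<open>push f\<close> is the map of free modules induced by a map \<open>f\<close> of generators, and
  \<open>coeffwise h\<close> applies an additive map \<open>h\<close> to all coefficients.\<close>

definition push :: "('x \<Rightarrow> 'y) \<Rightarrow> ('x \<Rightarrow>\<^sub>0 'w::comm_monoid_add) \<Rightarrow> ('y \<Rightarrow>\<^sub>0 'w)"
  where "push f v = (\<Sum>x\<in>keys v. Poly_Mapping.single (f x) (lookup v x))"

definition coeffwise :: "('w \<Rightarrow> 'w) \<Rightarrow> ('x \<Rightarrow>\<^sub>0 'w::comm_monoid_add) \<Rightarrow> ('x \<Rightarrow>\<^sub>0 'w)"
  where "coeffwise h v = (\<Sum>x\<in>keys v. Poly_Mapping.single x (h (lookup v x)))"


section \<open>Polynomial rings on arbitrary sets of variables\<close>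

type_synonym ('x, 'a) mpol = "('x \<Rightarrow>\<^sub>0 nat) \<Rightarrow>\<^sub>0 'a"

definition Const :: "'a::comm_ring_1 \<Rightarrow> ('x, 'a) mpol"
  where "Const a = Poly_Mapping.single 0 a"

definition Var :: "'x \<Rightarrow> ('x, 'a::comm_ring_1) mpol"
  where "Var x = Poly_Mapping.single (Poly_Mapping.single x 1) 1"

text \<open>The target of an evaluation is allowed to be the zero ring, which is not an instance of
  \<open>comm_ring_1\<close>; hence the sort of \<open>'b\<close>.\<close>

definition mon_eval :: "('x \<Rightarrow> 'b) \<Rightarrow> ('x \<Rightarrow>\<^sub>0 nat) \<Rightarrow> 'b::{comm_ring, comm_monoid_mult}"
  where "mon_eval f m = (\<Prod>x\<in>keys m. f x ^ lookup m x)"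

definition mpol_eval ::
    "('a::comm_ring_1 \<Rightarrow> 'b) \<Rightarrow> ('x \<Rightarrow> 'b) \<Rightarrow> ('x, 'a) mpol \<Rightarrow> 'b::{comm_ring, comm_monoid_mult}"
  where "mpol_eval \<phi> f p = (\<Sum>m\<in>keys p. \<phi> (lookup p m) * mon_eval f m)"

locale unital_ring_hom =
  fixes \<phi> :: "'a::comm_ring_1 \<Rightarrow> 'b::{comm_ring, comm_monoid_mult}"
  assumes hom_add: "\<phi> (x + y) = \<phi> x + \<phi> y"
    and hom_mult: "\<phi> (x * y) = \<phi> x * \<phi> y"
    and hom_one: "\<phi> 1 = 1"
begin

lemma hom_zero: "\<phi> 0 = 0"
  using hom_add[of 0 0] by simp

lemma hom_minus: "\<phi> (x - y) = \<phi> x - \<phi> y"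
  using hom_add[of "x - y" y] by (simp add: algebra_simps)

lemma hom_uminus: "\<phi> (- x) = - \<phi> x"
  using hom_minus[of 0 x] by (simp add: hom_zero)

end

lemma poly_mapping_additive_induct [case_names zero single add]:
  fixes v :: "'x \<Rightarrow>\<^sub>0 'w::comm_monoid_add"
  assumes "P 0" "\<And>x a. P (Poly_Mapping.single x a)" "\<And>u v. P u \<Longrightarrow> P v \<Longrightarrow> P (u + v)"
  shows "P v"
proof -
  have "P (\<Sum>x\<in>S. Poly_Mapping.single x (lookup v x))" if "finite S" for S
    using that by induction (simp_all add: assms)
  moreover have "v = (\<Sum>x\<in>keys v. Poly_Mapping.single x (lookup v x))"
    by (rule poly_mapping_eqI) (auto simp: lookup_sum lookup_single when_def in_keys_iff)
  ultimately show ?thesis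
    by (metis finite_keys)
qed

lemma mon_eval_superset:
  assumes "finite S" "keys m \<subseteq> S"
  shows "mon_eval f m = (\<Prod>x\<in>S. f x ^ lookup m x)"
  unfolding mon_eval_def
  by (rule prod.mono_neutral_left) (use assms in \<open>auto simp: in_keys_iff\<close>)

lemma mon_eval_add: "mon_eval f (m + n) = mon_eval f m * mon_eval f n"
proof -
  let ?S = "keys m \<union> keys n"
  have "keys (m + n) \<subseteq> ?S"
    by (rule keys_add)
  then have "mon_eval f (m + n) = (\<Prod>x\<in>?S. f x ^ lookup (m + n) x)"
    by (intro mon_eval_superset) auto
  also have "\<dots> = (\<Prod>x\<in>?S. f x ^ lookup m x) * (\<Prod>x\<in>?S. f x ^ lookup n x)"
    by (simp add: lookup_add power_add prod.distrib)
  also have "\<dots> = mon_eval f m * mon_eval f n"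
    by (simp add: mon_eval_superset[of ?S])
  finally show ?thesis .
qed

lemma mon_eval_zero [simp]: "mon_eval f 0 = 1"
  by (simp add: mon_eval_def)

lemma mon_eval_single [simp]: "mon_eval f (Poly_Mapping.single x 1) = f x"
  by (simp add: mon_eval_def)

context unital_ring_hom
begin

lemma mpol_eval_superset:
  assumes "finite S" "keys p \<subseteq> S"
  shows "mpol_eval \<phi> f p = (\<Sum>m\<in>S. \<phi> (lookup p m) * mon_eval f m)"
  unfolding mpol_eval_def
  by (rule sum.mono_neutral_left) (use assms in \<open>auto simp: in_keys_iff hom_zero\<close>)

lemma mpol_eval_add: "mpol_eval \<phi> f (p + q) = mpol_eval \<phi> f p + mpol_eval \<phi> f q"
proof -
  let ?S = "keys p \<union> keys q"
  have "mpol_eval \<phi> f (p + q) = (\<Sum>m\<in>?S. \<phi> (lookup (p + q) m) * mon_eval f m)"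
    by (intro mpol_eval_superset) (auto dest: keys_add[THEN subsetD])
  also have "\<dots> = (\<Sum>m\<in>?S. \<phi> (lookup p m) * mon_eval f m) + (\<Sum>m\<in>?S. \<phi> (lookup q m) * mon_eval f m)"
    by (simp add: lookup_add hom_add distrib_right sum.distrib)
  also have "\<dots> = mpol_eval \<phi> f p + mpol_eval \<phi> f q"
    by (simp add: mpol_eval_superset[of ?S])
  finally show ?thesis .
qed

lemma mpol_eval_single: "mpol_eval \<phi> f (Poly_Mapping.single m a) = \<phi> a * mon_eval f m"
  by (simp add: mpol_eval_superset[of "{m}"])

lemma mpol_eval_zero: "mpol_eval \<phi> f 0 = 0"
  by (simp add: mpol_eval_def)

lemma mpol_eval_Const [simp]: "mpol_eval \<phi> f (Const a) = \<phi> a"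
  by (simp add: Const_def mpol_eval_single)

lemma mpol_eval_Var [simp]: "mpol_eval \<phi> f (Var x) = f x"
  by (simp add: Var_def mpol_eval_single hom_one del: One_nat_def)

lemma mpol_eval_single_mult:
  "mpol_eval \<phi> f (Poly_Mapping.single m a * q) = mpol_eval \<phi> f (Poly_Mapping.single m a) * mpol_eval \<phi> f q"
proof (induction q rule: poly_mapping_additive_induct)
  case zero
  show ?case
    by (simp add: mpol_eval_zero)
next
  case (single n b)
  show ?case
    by (simp add: mult_single mpol_eval_single hom_mult mon_eval_add mult_ac)
next
  case (add p q)
  then show ?case
    by (simp add: distrib_left mpol_eval_add)
qed

lemma mpol_eval_mult: "mpol_eval \<phi> f (p * q) = mpol_eval \<phi> f p * mpol_eval \<phi> f q"
proof (induction p rule: poly_mapping_additive_induct)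
  case zero
  show ?case
    by (simp add: mpol_eval_zero)
next
  case (single n b)
  show ?case
    by (rule mpol_eval_single_mult)
next
  case (add p q')
  then show ?case
    by (simp add: distrib_right mpol_eval_add)
qed

lemma unital_ring_hom_mpol_eval: "unital_ring_hom (mpol_eval \<phi> f)"
proof
  have "(1 :: ('x, 'a) mpol) = Const 1"
    by (simp add: Const_def)
  then show "mpol_eval \<phi> f 1 = 1"
    by (metis hom_one mpol_eval_Const)
qed (rule mpol_eval_add mpol_eval_mult)+

end


section \<open>The ring \<open>A / I\<^sub>2\<close>\<close>

lemma module_times: "Modules.module ((*) :: 'a::comm_ring_1 \<Rightarrow> 'a \<Rightarrow> 'a)"
  by unfold_locales (simp_all add: algebra_simps)

abbreviation ideal_span :: "'a::comm_ring_1 set \<Rightarrow> 'a set"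
  where "ideal_span \<equiv> Modules.module.span (*)"

definition I2 :: "'a::comm_ring_1 set"
  where "I2 = ideal_span (insert 2 {a\<^sup>2 - a | a. True})"

lemma ideal_span_0: "0 \<in> ideal_span S"
  by (rule module.span_zero[OF module_times])

lemma ideal_span_base: "x \<in> S \<Longrightarrow> x \<in> ideal_span S"
  by (rule module.span_base[OF module_times])

lemma ideal_span_add: "x \<in> ideal_span S \<Longrightarrow> y \<in> ideal_span S \<Longrightarrow> x + y \<in> ideal_span S"
  by (rule module.span_add[OF module_times])

lemma ideal_span_diff: "x \<in> ideal_span S \<Longrightarrow> y \<in> ideal_span S \<Longrightarrow> x - y \<in> ideal_span S"
  by (rule module.span_diff[OF module_times])

lemma ideal_span_mult: "x \<in> ideal_span S \<Longrightarrow> r * x \<in> ideal_span S"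
  by (rule module.span_scale[OF module_times])

lemma ideal_span_cong_mult:
  assumes "x - x' \<in> ideal_span S" "y - y' \<in> ideal_span S"
  shows "x * y - x' * y' \<in> ideal_span S"
proof -
  have "x * y - x' * y' = y * (x - x') + x' * (y - y')"
    by (simp add: algebra_simps)
  then show ?thesis
    using assms by (auto intro!: ideal_span_add ideal_span_mult)
qed

lemma ideal_span_cong_add:
  assumes "x - x' \<in> ideal_span S" "y - y' \<in> ideal_span S"
  shows "x + y - (x' + y') \<in> ideal_span S"
  using ideal_span_add[OF assms] by (simp add: algebra_simps)

lemma ideal_span_cong_diff:
  assumes "x - x' \<in> ideal_span S" "y - y' \<in> ideal_span S"
  shows "x - y - (x' - y') \<in> ideal_span S"
  using ideal_span_diff[OF assms] by (simp add: algebra_simps)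

lemma equivp_ideal_span: "equivp (\<lambda>x y. x - y \<in> ideal_span S)"
proof (rule equivpI)
  show "reflp (\<lambda>x y. x - y \<in> ideal_span S)"
    by (rule reflpI) (simp add: ideal_span_0)
  show "symp (\<lambda>x y. x - y \<in> ideal_span S)"
    by (rule sympI) (use ideal_span_diff[OF ideal_span_0] in fastforce)
  show "transp (\<lambda>x y. x - y \<in> ideal_span S)"
    by (rule transpI) (use ideal_span_add in fastforce)
qed

definition I2_equiv :: "'a::comm_ring_1 \<Rightarrow> 'a \<Rightarrow> bool"
  where "I2_equiv x y \<longleftrightarrow> x - y \<in> I2"

lemma I2_equivI: "x = y \<Longrightarrow> I2_equiv x y"
  by (simp add: I2_equiv_def I2_def ideal_span_0)

quotient_type (overloaded) 'a mod_I2 = "'a::comm_ring_1" / I2_equiv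
  morphisms rep_mod_I2 to_mod_I2
  unfolding I2_equiv_def I2_def by (rule equivp_ideal_span)

text \<open>Only \<open>{comm_ring, comm_monoid_mult}\<close>, since \<open>A / I\<^sub>2\<close> may be the zero ring.\<close>

instantiation mod_I2 :: (comm_ring_1) "{comm_ring, comm_monoid_mult}"
begin

lift_definition zero_mod_I2 :: "'a mod_I2" is 0 .
lift_definition one_mod_I2 :: "'a mod_I2" is 1 .
lift_definition plus_mod_I2 :: "'a mod_I2 \<Rightarrow> 'a mod_I2 \<Rightarrow> 'a mod_I2" is "(+)"
  unfolding I2_equiv_def I2_def by (rule ideal_span_cong_add)
lift_definition minus_mod_I2 :: "'a mod_I2 \<Rightarrow> 'a mod_I2 \<Rightarrow> 'a mod_I2" is "(-)"
  unfolding I2_equiv_def I2_def by (rule ideal_span_cong_diff)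
lift_definition uminus_mod_I2 :: "'a mod_I2 \<Rightarrow> 'a mod_I2" is uminus
  unfolding I2_equiv_def I2_def
  using ideal_span_diff[OF ideal_span_0] by fastforce
lift_definition times_mod_I2 :: "'a mod_I2 \<Rightarrow> 'a mod_I2 \<Rightarrow> 'a mod_I2" is "(*)"
  unfolding I2_equiv_def I2_def by (rule ideal_span_cong_mult)

instance
proof
  fix a b c :: "'a mod_I2"
  show "a + b + c = a + (b + c)" "a + b = b + a" "0 + a = a" "- a + a = 0" "a - b = a + - b"
    "a * b * c = a * (b * c)" "a * b = b * a" "1 * a = a" "(a + b) * c = a * c + b * c"
    by (transfer, rule I2_equivI, simp add: algebra_simps)+
qed

end

lemma unital_ring_hom_to_mod_I2: "unital_ring_hom to_mod_I2"
  by standard (simp_all add: plus_mod_I2.abs_eq times_mod_I2.abs_eq one_mod_I2_def)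

lemma to_mod_I2_eq_0_iff: "to_mod_I2 a = 0 \<longleftrightarrow> a \<in> I2"
  by (simp add: zero_mod_I2_def mod_I2.abs_eq_iff I2_equiv_def)

lemma surj_to_mod_I2: "surj to_mod_I2"
  by (rule surjI[of _ rep_mod_I2]) (rule Quotient3_abs_rep[OF Quotient3_mod_I2])


section \<open>The Hopf algebroid of formal module 2-buds\<close>

datatype 'a dr_gen = Gamma | C 'a

definition dr_scale :: "'a::comm_ring_1 \<Rightarrow> ('a dr_gen \<Rightarrow>\<^sub>0 'a) \<Rightarrow> ('a dr_gen \<Rightarrow>\<^sub>0 'a)"
  where "dr_scale a = coeffwise ((*) a)"

lemma lookup_coeffwise: "h 0 = 0 \<Longrightarrow> lookup (coeffwise h v) x = h (lookup v x)"
  unfolding coeffwise_def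
  by (simp add: lookup_sum lookup_single when_def in_keys_iff)

lemma lookup_dr_scale [simp]: "lookup (dr_scale a v) x = a * lookup v x"
  by (simp add: dr_scale_def lookup_coeffwise)

lemma module_dr_scale: "Modules.module dr_scale"
  by unfold_locales (auto intro!: poly_mapping_eqI simp: lookup_add algebra_simps)

definition dr_relators :: "('a::comm_ring_1 dr_gen \<Rightarrow>\<^sub>0 'a) set"
  where "dr_relators = (let g = Poly_Mapping.single Gamma; c = (\<lambda>a r. Poly_Mapping.single (C a) r) in
    {g (a\<^sup>2 - a) - c a 2 | a. True} \<union>
    {c (a + b) 1 - c a 1 - c b 1 - g (a * b) | a b. True} \<union>
    {c b a + c a (b\<^sup>2) - c (a * b) 1 | a b. True})"

definition dr_equiv :: "('a::comm_ring_1 dr_gen \<Rightarrow>\<^sub>0 'a) \<Rightarrow> ('a dr_gen \<Rightarrow>\<^sub>0 'a) \<Rightarrow> bool"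
  where "dr_equiv x y \<longleftrightarrow> x - y \<in> Modules.module.span dr_scale dr_relators"

lemma equivp_dr_equiv: "equivp dr_equiv"
proof (rule equivpI)
  interpret Modules.module dr_scale by (rule module_dr_scale)
  show "reflp dr_equiv"
    by (rule reflpI) (simp add: dr_equiv_def span_zero)
  show "symp dr_equiv"
    by (rule sympI) (use span_neg in \<open>fastforce simp: dr_equiv_def\<close>)
  show "transp dr_equiv"
    by (rule transpI) (use span_add in \<open>fastforce simp: dr_equiv_def\<close>)
qed

lemma dr_equivI: "x = y \<Longrightarrow> dr_equiv x y"
  by (simp add: dr_equiv_def module.span_zero[OF module_dr_scale])

quotient_type (overloaded) 'a Dr = "'a::comm_ring_1 dr_gen \<Rightarrow>\<^sub>0 'a" / dr_equiv
  by (rule equivp_dr_equiv)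

instantiation Dr :: (comm_ring_1) ab_group_add
begin

interpretation Modules.module dr_scale by (rule module_dr_scale)

lift_definition zero_Dr :: "'a Dr" is 0 .
lift_definition plus_Dr :: "'a Dr \<Rightarrow> 'a Dr \<Rightarrow> 'a Dr" is "(+)"
  unfolding dr_equiv_def by (metis add_diff_add span_add)
lift_definition minus_Dr :: "'a Dr \<Rightarrow> 'a Dr \<Rightarrow> 'a Dr" is "(-)"
proof -
  fix a b c d :: "'a dr_gen \<Rightarrow>\<^sub>0 'a"
  assume "dr_equiv a b" "dr_equiv c d"
  then have "(a - b) - (c - d) \<in> Modules.module.span dr_scale dr_relators"
    unfolding dr_equiv_def by (rule span_diff)
  then show "dr_equiv (a - c) (b - d)"
    by (simp add: dr_equiv_def algebra_simps)
qed
lift_definition uminus_Dr :: "'a Dr \<Rightarrow> 'a Dr" is uminus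
  unfolding dr_equiv_def using span_neg by fastforce

instance
proof
  fix a b c :: "'a Dr"
  show "a + b + c = a + (b + c)" "a + b = b + a" "0 + a = a" "- a + a = 0" "a - b = a + - b"
    by (transfer, rule dr_equivI, simp add: algebra_simps)+
qed

end

lift_definition Dr_scale :: "'a::comm_ring_1 \<Rightarrow> 'a Dr \<Rightarrow> 'a Dr" is dr_scale
  unfolding dr_equiv_def
  by (metis module.scale_right_diff_distrib module.span_scale module_dr_scale)

lift_definition Dr_gamma :: "'a::comm_ring_1 Dr" is "Poly_Mapping.single Gamma 1" .

lift_definition Dr_c :: "'a::comm_ring_1 \<Rightarrow> 'a Dr" is "\<lambda>a. Poly_Mapping.single (C a) 1" .

text \<open>The linear form \<open>\<gamma> \<mapsto> 2\<close>, \<open>c\<^sub>a \<mapsto> a\<^sup>2 - a\<close>, which gives the coefficients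
  of \<open>t\<close> in \<open>\<eta>\<^sub>R\<close>.\<close>

primrec dr_form_gen :: "'a::comm_ring_1 dr_gen \<Rightarrow> 'a"
  where "dr_form_gen Gamma = 2" | "dr_form_gen (C a) = a\<^sup>2 - a"

definition dr_form :: "('a::comm_ring_1 dr_gen \<Rightarrow>\<^sub>0 'a) \<Rightarrow> 'a"
  where "dr_form v = (\<Sum>g\<in>keys v. lookup v g * dr_form_gen g)"

lemma dr_form_superset:
  "finite S \<Longrightarrow> keys v \<subseteq> S \<Longrightarrow> dr_form v = (\<Sum>g\<in>S. lookup v g * dr_form_gen g)"
  unfolding dr_form_def by (rule sum.mono_neutral_left) (auto simp: in_keys_iff)

lemma dr_form_add: "dr_form (u + v) = dr_form u + dr_form v"
proof -
  let ?S = "keys u \<union> keys v"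
  have "dr_form (u + v) = (\<Sum>g\<in>?S. lookup (u + v) g * dr_form_gen g)"
    by (intro dr_form_superset) (auto dest: keys_add[THEN subsetD])
  then show ?thesis
    by (simp add: dr_form_superset[of ?S] lookup_add distrib_right sum.distrib)
qed

lemma dr_form_scale: "dr_form (dr_scale a v) = a * dr_form v"
proof -
  have "dr_form (dr_scale a v) = (\<Sum>g\<in>keys v. lookup (dr_scale a v) g * dr_form_gen g)"
    by (intro dr_form_superset) (auto simp: in_keys_iff)
  then show ?thesis
    by (simp add: dr_form_def sum_distrib_left mult_ac)
qed

lemma dr_form_single [simp]: "dr_form (Poly_Mapping.single g a) = a * dr_form_gen g"
  by (simp add: dr_form_superset[of "{g}"])

lemma dr_form_diff: "dr_form (u - v) = dr_form u - dr_form v"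
  using dr_form_add[of "u - v" v] by simp

lemma dr_form_relators: "v \<in> Modules.module.span dr_scale dr_relators \<Longrightarrow> dr_form v = 0"
proof (induction v rule: module.span_induct_alt[OF module_dr_scale, consumes 1, case_names zero step])
  case zero
  show ?case by (simp add: dr_form_def)
next
  case (step a u v)
  have "dr_form u = 0"
    using step.hyps(1) unfolding dr_relators_def Let_def
    by (elim UnE CollectE exE conjE; simp only: dr_form_diff dr_form_add dr_form_single dr_form_gen.simps;
      simp add: power2_eq_square algebra_simps)
  with step show ?case
    by (simp add: dr_form_add dr_form_scale)
qed

lift_definition Dr_form :: "'a::comm_ring_1 Dr \<Rightarrow> 'a" is dr_form
  unfolding dr_equiv_def by (metis dr_form_diff dr_form_relators eq_iff_diff_eq_0)

lemma Dr_form_gamma [simp]: "Dr_form Dr_gamma = 2"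
  by transfer simp

lemma Dr_form_c [simp]: "Dr_form (Dr_c a) = a\<^sup>2 - a"
  by transfer simp

lemma Dr_form_add: "Dr_form (x + y) = Dr_form x + Dr_form y"
  by transfer (rule dr_form_add)

lemma Dr_form_scale: "Dr_form (Dr_scale a x) = a * Dr_form x"
  by transfer (rule dr_form_scale)

text \<open>\<open>L2buds\<close> is the symmetric algebra of \<open>Dr\<close>: the polynomial ring on the set \<open>Dr\<close> modulo
  the linear relations that hold in \<open>Dr\<close>.\<close>

definition sym_relators :: "('a Dr, 'a::comm_ring_1) mpol set"
  where "sym_relators =
    {Var (x + y) - Var x - Var y | x y. True} \<union> {Var (Dr_scale a x) - Const a * Var x | a x. True}"

definition sym_equiv :: "('a Dr, 'a::comm_ring_1) mpol \<Rightarrow> ('a Dr, 'a) mpol \<Rightarrow> bool"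
  where "sym_equiv p q \<longleftrightarrow> p - q \<in> ideal_span sym_relators"

lemma sym_equivI: "p = q \<Longrightarrow> sym_equiv p q"
  by (simp add: sym_equiv_def ideal_span_0)

quotient_type (overloaded) 'a L2buds = "('a Dr, 'a::comm_ring_1) mpol" / sym_equiv
  unfolding sym_equiv_def by (rule equivp_ideal_span)

lemma eval_ideal_span_eq_0:
  assumes "unital_ring_hom h" "\<And>s. s \<in> S \<Longrightarrow> h s = 0" "p \<in> ideal_span S"
  shows "h p = 0"
proof -
  interpret unital_ring_hom h by fact
  from assms(3) show ?thesis
    by (induction p rule: module.span_induct_alt[OF module_times, consumes 1, case_names zero step])
      (simp_all add: hom_zero hom_add hom_mult assms(2))
qed

instantiation L2buds :: (comm_ring_1) comm_ring_1
begin

lift_definition zero_L2buds :: "'a L2buds" is 0 .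
lift_definition one_L2buds :: "'a L2buds" is 1 .
lift_definition plus_L2buds :: "'a L2buds \<Rightarrow> 'a L2buds \<Rightarrow> 'a L2buds" is "(+)"
  unfolding sym_equiv_def by (rule ideal_span_cong_add)
lift_definition minus_L2buds :: "'a L2buds \<Rightarrow> 'a L2buds \<Rightarrow> 'a L2buds" is "(-)"
  unfolding sym_equiv_def by (rule ideal_span_cong_diff)
lift_definition uminus_L2buds :: "'a L2buds \<Rightarrow> 'a L2buds" is uminus
  unfolding sym_equiv_def using ideal_span_diff[OF ideal_span_0] by fastforce
lift_definition times_L2buds :: "'a L2buds \<Rightarrow> 'a L2buds \<Rightarrow> 'a L2buds" is "(*)"
  unfolding sym_equiv_def by (rule ideal_span_cong_mult)

lemma zero_neq_one_L2buds: "(0 :: 'a L2buds) \<noteq> 1"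
proof transfer
  interpret id: unital_ring_hom "\<lambda>x::'a. x"
    by standard simp_all
  let ?h = "mpol_eval (\<lambda>x::'a. x) (\<lambda>_ :: 'a Dr. 0)"
  interpret h: unital_ring_hom ?h
    by (rule id.unital_ring_hom_mpol_eval)
  have "?h s = 0" if "s \<in> sym_relators" for s
    using that by (auto simp: sym_relators_def h.hom_minus h.hom_mult)
  then have "?h p = 0" if "p \<in> ideal_span sym_relators" for p
    using eval_ideal_span_eq_0[OF h.unital_ring_hom_axioms _ that] by blast
  then show "\<not> sym_equiv (0 :: ('a Dr, 'a) mpol) 1"
    unfolding sym_equiv_def using h.hom_minus[of 0 1] by (auto simp: h.hom_one h.hom_zero)
qed

instance
proof
  show "(0 :: 'a L2buds) \<noteq> 1"
    by (rule zero_neq_one_L2buds)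
  fix a b c :: "'a L2buds"
  show "a + b + c = a + (b + c)" "a + b = b + a" "0 + a = a" "- a + a = 0" "a - b = a + - b"
    "a * b * c = a * (b * c)" "a * b = b * a" "1 * a = a" "(a + b) * c = a * c + b * c"
    by (transfer, rule sym_equivI, simp add: algebra_simps)+
qed

end

definition L_const :: "'a::comm_ring_1 \<Rightarrow> 'a L2buds"
  where "L_const a = abs_L2buds (Const a)"

definition L_incl :: "'a::comm_ring_1 Dr \<Rightarrow> 'a L2buds"
  where "L_incl x = abs_L2buds (Var x)"

lemma unital_ring_hom_L_const: "unital_ring_hom L_const"
  by standard
    (simp_all add: L_const_def plus_L2buds.abs_eq times_L2buds.abs_eq one_L2buds_def
      Const_def single_add mult_single)

lemma L_incl_add: "L_incl (x + y) = L_incl x + L_incl y"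
proof -
  have "Var (x + y) - Var x - Var y \<in> ideal_span (sym_relators :: ('a Dr, 'a) mpol set)"
    by (rule ideal_span_base) (auto simp: sym_relators_def)
  then show ?thesis
    by (simp add: L_incl_def plus_L2buds.abs_eq L2buds.abs_eq_iff sym_equiv_def diff_diff_eq)
qed

lemma L_incl_scale: "L_incl (Dr_scale a x) = L_const a * L_incl x"
proof -
  have "Var (Dr_scale a x) - Const a * Var x \<in> ideal_span (sym_relators :: ('a Dr, 'a) mpol set)"
    by (rule ideal_span_base) (auto simp: sym_relators_def)
  then show ?thesis
    by (simp add: L_incl_def L_const_def times_L2buds.abs_eq L2buds.abs_eq_iff sym_equiv_def)
qed

text \<open>The internal degree \<open>d\<close> part: \<open>Dr\<close> sits in degree \<open>2\<close>, so it is spanned by the products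
  of \<open>k\<close> elements of \<open>Dr\<close> with \<open>2 * k = d\<close>.\<close>

definition L_degree :: "nat \<Rightarrow> 'a::comm_ring_1 L2buds set"
  where "L_degree d = abs_L2buds ` {p. \<forall>m\<in>keys p. 2 * (\<Sum>x\<in>keys m. lookup m x) = d}"

text \<open>The ring \<open>L2buds[t]\<close> of strict isomorphisms is the type \<open>'a L2buds poly\<close>, with \<open>t = [:0, 1:]\<close>.\<close>

definition eta_L :: "'a::comm_ring_1 L2buds \<Rightarrow> 'a L2buds poly"
  where "eta_L x = [:x:]"

definition eta_R_pre :: "('a Dr, 'a::comm_ring_1) mpol \<Rightarrow> 'a L2buds poly"
  where "eta_R_pre = mpol_eval (\<lambda>a. [:L_const a:]) (\<lambda>x. [:L_incl x:] + [:L_const (Dr_form x):] * [:0, 1:])"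

lemma unital_ring_hom_L_const_poly: "unital_ring_hom (\<lambda>a. [:L_const a:])"
proof -
  interpret c: unital_ring_hom L_const
    by (rule unital_ring_hom_L_const)
  show ?thesis
    by standard (simp_all add: c.hom_add c.hom_mult c.hom_one)
qed

lemma unital_ring_hom_eta_R_pre: "unital_ring_hom eta_R_pre"
  unfolding eta_R_pre_def
  by (rule unital_ring_hom.unital_ring_hom_mpol_eval[OF unital_ring_hom_L_const_poly])

lemma eta_R_pre_Const: "eta_R_pre (Const a) = [:L_const a:]"
  unfolding eta_R_pre_def
  by (rule unital_ring_hom.mpol_eval_Const[OF unital_ring_hom_L_const_poly])

lemma eta_R_pre_Var: "eta_R_pre (Var x) = [:L_incl x:] + [:L_const (Dr_form x):] * [:0, 1:]"
  unfolding eta_R_pre_def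
  by (rule unital_ring_hom.mpol_eval_Var[OF unital_ring_hom_L_const_poly])

lift_definition eta_R :: "'a::comm_ring_1 L2buds \<Rightarrow> 'a L2buds poly" is eta_R_pre
proof -
  fix p q :: "('a Dr, 'a) mpol"
  interpret c: unital_ring_hom L_const
    by (rule unital_ring_hom_L_const)
  interpret unital_ring_hom eta_R_pre
    by (rule unital_ring_hom_eta_R_pre)
  have *: "eta_R_pre s = 0" if "s \<in> sym_relators" for s :: "('a Dr, 'a) mpol"
    using that
    by (auto simp: sym_relators_def hom_minus hom_mult eta_R_pre_Const eta_R_pre_Var
      L_incl_add L_incl_scale Dr_form_add Dr_form_scale c.hom_add c.hom_mult)
  assume "sym_equiv p q"
  then have "p - q \<in> ideal_span sym_relators"
    by (simp add: sym_equiv_def)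
  with * have "eta_R_pre (p - q) = 0"
    by (rule eval_ideal_span_eq_0[OF unital_ring_hom_eta_R_pre])
  then show "eta_R_pre p = eta_R_pre q"
    by (simp add: hom_minus)
qed

lemma unital_ring_hom_eta_R: "unital_ring_hom (eta_R :: 'a::comm_ring_1 L2buds \<Rightarrow> _)"
proof -
  interpret unital_ring_hom "eta_R_pre :: ('a Dr, 'a) mpol \<Rightarrow> _"
    by (rule unital_ring_hom_eta_R_pre)
  show ?thesis
  proof
    fix x y :: "'a L2buds"
    show "eta_R (x + y) = eta_R x + eta_R y"
      by transfer (rule hom_add)
    show "eta_R (x * y) = eta_R x * eta_R y"
      by transfer (rule hom_mult)
    show "eta_R (1 :: 'a L2buds) = 1"
      by transfer (rule hom_one)
  qed
qed

lemma eta_R_const: "eta_R (L_const a) = [:L_const a:]"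
  using eta_R.abs_eq[of "Const a"] eta_R_pre_Const[of a] by (simp only: L_const_def)

lemma eta_R_incl: "eta_R (L_incl x) = [:L_incl x:] + [:L_const (Dr_form x):] * [:0, 1:]"
  using eta_R.abs_eq[of "Var x"] eta_R_pre_Var[of x] by (simp only: L_incl_def)

lemma eta_R_gamma:
  "eta_R (L_incl Dr_gamma :: 'a::comm_ring_1 L2buds) = [:L_incl Dr_gamma:] + 2 * [:0, 1:]"
proof -
  interpret c: unital_ring_hom L_const
    by (rule unital_ring_hom_L_const)
  have "L_const (2 :: 'a) = 2"
    using c.hom_add[of 1 1] by (simp add: c.hom_one)
  moreover have "[:2 :: 'a L2buds:] = 2"
    by (rule numeral_poly[symmetric])
  ultimately show ?thesis
    by (simp only: eta_R_incl Dr_form_gamma)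
qed

lemma eta_R_c: "eta_R (L_incl (Dr_c a)) = [:L_incl (Dr_c a):] + [:L_const (a\<^sup>2 - a):] * [:0, 1:]"
  by (simp only: eta_R_incl Dr_form_c)

text \<open>The sections of \<open>\<omega>\<^bsup>\<otimes>n\<^esup>\<close>: the cohomology of the cobar complex in cohomological degree \<open>0\<close>
  and internal degree \<open>2 * n\<close>.\<close>

definition H0_omega :: "nat \<Rightarrow> ('a::comm_ring_1, 'a L2buds) module"
  where "H0_omega n =
    \<lparr> carrier = {x \<in> L_degree (2 * n). eta_R x - eta_L x = 0},
      monoid.mult = undefined,
      one = undefined,
      ring.zero = 0,
      add = (+),
      module.smult = (\<lambda>a x. L_const a * x) \<rparr>"


section \<open>Andre-Quillen homology\<close>

text \<open>For a map of rings \<open>\<phi> : A \<rightarrow> B\<close>, the standard simplicial resolution of \<open>B\<close> by polynomial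
  \<open>A\<close>-algebras has \<open>P\<^sub>0 = A[B]\<close> and \<open>P\<^sub>n\<^sub>+\<^sub>1 = A[P\<^sub>n]\<close>, where \<open>A[X]\<close> is the polynomial ring on the
  underlying set of \<open>X\<close>. The face maps \<open>P\<^sub>n \<rightarrow> P\<^sub>n\<^sub>-\<^sub>1\<close>, in the order \<open>d\<^sub>0, \<dots>, d\<^sub>n\<close>, are given
  as a list: \<open>d\<^sub>0\<close> is the counit, and \<open>d\<^sub>i\<^sub>+\<^sub>1\<close> is obtained by applying the functor \<open>A[-]\<close> to the
  map \<open>d\<^sub>i\<close> one level below. The degeneracies do not enter the unnormalised chain complex.\<close>

type_synonym ('b, 'a) P0 = "('b, 'a) mpol"
type_synonym ('b, 'a) P1 = "(('b, 'a) P0, 'a) mpol"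
type_synonym ('b, 'a) P2 = "(('b, 'a) P1, 'a) mpol"
type_synonym ('b, 'a) P3 = "(('b, 'a) P2, 'a) mpol"

definition counit :: "('a::comm_ring_1 \<Rightarrow> 'b) \<Rightarrow> ('b::{comm_ring, comm_monoid_mult}, 'a) mpol \<Rightarrow> 'b"
  where "counit \<phi> = mpol_eval \<phi> (\<lambda>b. b)"

definition mpol_map :: "('x \<Rightarrow> 'y) \<Rightarrow> ('x, 'a::comm_ring_1) mpol \<Rightarrow> ('y, 'a) mpol"
  where "mpol_map g = mpol_eval Const (\<lambda>x. Var (g x))"

definition next_faces ::
    "(('x, 'a::comm_ring_1) mpol \<Rightarrow> 'x) list \<Rightarrow> ((('x, 'a) mpol, 'a) mpol \<Rightarrow> ('x, 'a) mpol) list"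
  where "next_faces ds = counit Const # map mpol_map ds"

context
  fixes \<phi> :: "'a::comm_ring_1 \<Rightarrow> 'b::{comm_ring, comm_monoid_mult}"
begin

definition faces0 :: "(('b, 'a) P0 \<Rightarrow> 'b) list"
  where "faces0 = [counit \<phi>]"

definition faces1 :: "(('b, 'a) P1 \<Rightarrow> ('b, 'a) P0) list"
  where "faces1 = next_faces faces0"

definition faces2 :: "(('b, 'a) P2 \<Rightarrow> ('b, 'a) P1) list"
  where "faces2 = next_faces faces1"

definition faces3 :: "(('b, 'a) P3 \<Rightarrow> ('b, 'a) P2) list"
  where "faces3 = next_faces faces2"

definition augmentation1 :: "('b, 'a) P1 \<Rightarrow> 'b"
  where "augmentation1 p = counit \<phi> (counit Const p)"

definition augmentation2 :: "('b, 'a) P2 \<Rightarrow> 'b"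
  where "augmentation2 p = augmentation1 (counit Const p)"

text \<open>For an \<open>A\<close>-algebra \<open>i : A \<rightarrow> P\<close> with an augmentation \<open>\<epsilon> : P \<rightarrow> B\<close> of \<open>A\<close>-algebras and a
  \<open>B\<close>-module \<open>W\<close> with scalar multiplication \<open>s\<close>, the module \<open>\<Omega>\<^bsub>P/A\<^esub> \<otimes>\<^sub>P W\<close> is the free module
  \<open>P \<Rightarrow>\<^sub>0 W\<close> modulo the following submodule, where \<open>Poly_Mapping.single p w\<close> represents \<open>dp \<otimes> w\<close>:
  this is the result of applying \<open>- \<otimes>\<^sub>P W\<close> to the presentation of \<open>\<Omega>\<^bsub>P/A\<^esub>\<close> by the generators
  \<open>dp\<close>, additivity, the Leibniz rule, and \<open>da = 0\<close> for \<open>a\<close> in \<open>A\<close>. The set of relators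
  is closed under scalar multiplication by \<open>B\<close>, so that its \<open>A\<close>-span is a \<open>B\<close>-submodule.\<close>

definition kaehler_scale :: "('b \<Rightarrow> 'w \<Rightarrow> 'w) \<Rightarrow> 'a \<Rightarrow> ('p \<Rightarrow>\<^sub>0 'w::ab_group_add) \<Rightarrow> ('p \<Rightarrow>\<^sub>0 'w)"
  where "kaehler_scale s a = coeffwise (s (\<phi> a))"

definition kaehler_relations ::
    "('b \<Rightarrow> 'w \<Rightarrow> 'w) \<Rightarrow> ('a \<Rightarrow> 'p) \<Rightarrow> ('p \<Rightarrow> 'b) \<Rightarrow> ('p::comm_ring_1 \<Rightarrow>\<^sub>0 'w::ab_group_add) set"
  where "kaehler_relations s i \<epsilon> = (let d = (\<lambda>p w. Poly_Mapping.single p w) in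
    Modules.module.span (kaehler_scale s)
      ({d (p + q) w - d p w - d q w | p q w. True} \<union>
       {d (p * q) w - d q (s (\<epsilon> p) w) - d p (s (\<epsilon> q) w) | p q w. True} \<union>
       {d (i a) w | a w. True}))"

definition boundary :: "('p \<Rightarrow> 'q) list \<Rightarrow> ('p \<Rightarrow>\<^sub>0 'w::ab_group_add) \<Rightarrow> ('q \<Rightarrow>\<^sub>0 'w)"
  where "boundary ds v =
    (\<Sum>i<length ds. if even i then push (ds ! i) v else - push (ds ! i) v)"

text \<open>\<open>H\<^sub>2(A, B; W)\<close> with its \<open>A\<close>-module structure: the second homology of the chain complex
  with terms \<open>\<Omega>\<^bsub>P\<^sub>n/A\<^esub> \<otimes> W\<close>. Writing these as \<open>F\<^sub>n / N\<^sub>n\<close> with \<open>F\<^sub>n\<close> free on \<open>P\<^sub>n\<close>, the cycles are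
  represented by the elements of \<open>F\<^sub>2\<close> with boundary in \<open>N\<^sub>1\<close>, and the submodule of boundaries
  has the preimage \<open>N\<^sub>2 + \<partial> F\<^sub>3\<close> in \<open>F\<^sub>2\<close>.\<close>

definition AQ_cycles2 :: "('b \<Rightarrow> 'w \<Rightarrow> 'w) \<Rightarrow> (('b, 'a) P2 \<Rightarrow>\<^sub>0 'w::ab_group_add) set"
  where "AQ_cycles2 s = {z. boundary faces2 z \<in> kaehler_relations s Const augmentation1}"

definition AQ_boundaries2 :: "('b \<Rightarrow> 'w \<Rightarrow> 'w) \<Rightarrow> (('b, 'a) P2 \<Rightarrow>\<^sub>0 'w::ab_group_add) set"
  where "AQ_boundaries2 s =
    {n + boundary faces3 y | n y. n \<in> kaehler_relations s Const augmentation2}"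

definition AQ_H2 :: "('b \<Rightarrow> 'w \<Rightarrow> 'w) \<Rightarrow> ('a, (('b, 'a) P2 \<Rightarrow>\<^sub>0 'w::ab_group_add) set) module"
  where "AQ_H2 s = quotient_module (kaehler_scale s) (AQ_cycles2 s) (AQ_boundaries2 s)"

end

end

theory Submission
  imports Defs
begin

text \<open>
  Both modules are identified with the kernel of \<open>Sym\<^sup>2(I\<^sub>2) \<rightarrow> I\<^sub>2\<close>.

  The linear form \<open>\<gamma> \<mapsto> 2\<close>, \<open>c\<^sub>a \<mapsto> a\<^sup>2 - a\<close> maps \<open>Dr\<close> isomorphically onto \<open>I\<^sub>2\<close>: one has
  \<open>form x \<cdot> y = form y \<cdot> x\<close>, and \<open>c (form y) = (form y - 1) \<cdot> y\<close> modulo \<open>\<gamma>\<close>, so that the kernel consists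
  of multiples of \<open>\<gamma>\<close>, on which the form is injective. For \<open>x\<close> in \<open>Sym\<^sup>2(Dr)\<close> the coefficients of \<open>t\<close> and
  \<open>t\<^sup>2\<close> in \<open>\<eta>\<^sub>R x\<close> are then both determined by the image of \<open>x\<close> under the product map, which gives the
  sections of \<open>\<omega>\<^bsup>\<otimes>2\<^esup>\<close>.

  For the homology, let \<open>\<pi>\<^sub>1, \<pi>\<^sub>0 : A[Dr] \<rightarrow> A\<close> send a variable \<open>d\<close> to \<open>form d\<close> and to \<open>0\<close>, and let
  \<open>W = ker \<pi>\<^sub>1 \<inter> ker \<pi>\<^sub>0\<close>. This is a small model of the resolution in low degrees. The ring map
  \<open>d \<mapsto> [form d] - [0]\<close> to \<open>P\<^sub>1\<close> induces a map from \<open>W / (I\<^sub>2 W + ker \<pi>\<^sub>1 \<cdot> ker \<pi>\<^sub>0)\<close> to 2-chains modulo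
  boundaries. An explicit homotopy shows that every cycle comes from an element of \<open>W\<close> whose linear
  coefficients lie in \<open>I\<^sub>2\<close>, and such an element is equivalent to a quadratic form. In the other
  direction, a set-theoretic section of \<open>A \<rightarrow> A / I\<^sub>2\<close> gives a retraction.
\<close>

section \<open>Polynomial rings\<close>

text \<open>Identities between ring homomorphisms on a polynomial ring need checking on constants
  and variables only; most statements below about faces and augmentations are proved this
  way.\<close>

lemma mpol_induct [case_names Const Var add mult]:
  fixes p :: "('x, 'a::comm_ring_1) mpol"
  assumes Const: "\<And>a. P (Const a)" and Var: "\<And>x. P (Var x)"
    and add: "\<And>p q. P p \<Longrightarrow> P q \<Longrightarrow> P (p + q)" and mult: "\<And>p q. P p \<Longrightarrow> P q \<Longrightarrow> P (p * q)"
  shows "P p"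
proof (induction p rule: poly_mapping_additive_induct)
  case zero
  show ?case
    using Const[of 0] by (simp add: Const_def)
next
  case (single m a)
  have "P (Poly_Mapping.single m 1)"
  proof (induction m rule: poly_mapping_additive_induct)
    case zero
    show ?case
      using Const[of 1] by (simp add: Const_def)
  next
    case (single x n)
    show ?case
    proof (induction n)
      case 0
      show ?case
        using Const[of 1] by (simp add: Const_def)
    next
      case (Suc n)
      have "Poly_Mapping.single (Poly_Mapping.single x (Suc n)) 1 =
          Var x * (Poly_Mapping.single (Poly_Mapping.single x n) 1 :: ('x, 'a) mpol)"
        by (simp add: Var_def mult_single flip: single_add)
      with mult[OF Var Suc] show ?case
        by simp
    qed
  next
    case (add m n)
    have "Poly_Mapping.single (m + n) 1 =
        Poly_Mapping.single m 1 * (Poly_Mapping.single n 1 :: ('x, 'a) mpol)"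
      by (simp add: mult_single)
    with mult[OF add] show ?case
      by simp
  qed
  from mult[OF Const[of a] this] show ?case
    by (simp add: Const_def mult_single)
next
  case (add p q)
  then show ?case
    by (rule assms(3))
qed

lemma unital_ring_hom_Const: "unital_ring_hom (Const :: 'a \<Rightarrow> ('x, 'a::comm_ring_1) mpol)"
  by standard (simp_all add: Const_def single_add mult_single)

lemmas Const_simps = unital_ring_hom.hom_add[OF unital_ring_hom_Const]
  unital_ring_hom.hom_mult[OF unital_ring_hom_Const] unital_ring_hom.hom_one[OF unital_ring_hom_Const]
  unital_ring_hom.hom_zero[OF unital_ring_hom_Const] unital_ring_hom.hom_minus[OF unital_ring_hom_Const]
  unital_ring_hom.hom_uminus[OF unital_ring_hom_Const]

section \<open>The linear form on \<open>Dr\<close>\<close>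

lemma module_Dr_scale: "Modules.module (Dr_scale :: 'a::comm_ring_1 \<Rightarrow> 'a Dr \<Rightarrow> 'a Dr)"
proof -
  interpret Modules.module "dr_scale :: 'a \<Rightarrow> _" by (rule module_dr_scale)
  show ?thesis
    by unfold_locales
      (transfer, rule dr_equivI, simp add: scale_right_distrib scale_left_distrib)+
qed

lemma Dr_form_zero [simp]: "Dr_form 0 = 0"
  using Dr_form_add[of 0 0] by simp

lemma Dr_form_diff: "Dr_form (x - y) = Dr_form x - Dr_form y"
  using Dr_form_add[of "x - y" y] by simp

context
begin

interpretation Dr: Modules.module Dr_scale by (rule module_Dr_scale)

lemma dr_single_eq_scale: "Poly_Mapping.single g r = dr_scale r (Poly_Mapping.single g 1)"
  by (rule poly_mapping_eqI) (simp add: lookup_single when_def)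

lemma Dr_induct [case_names gamma c add]:
  assumes gamma: "\<And>r. P (Dr_scale r Dr_gamma)" and c: "\<And>r a. P (Dr_scale r (Dr_c a))"
    and add: "\<And>x y. P x \<Longrightarrow> P y \<Longrightarrow> P (x + y)"
  shows "P x"
proof -
  have "P (abs_Dr v)" for v
  proof (induction v rule: poly_mapping_additive_induct)
    case zero
    show ?case
      using gamma[of 0] by (simp add: zero_Dr_def)
  next
    case (single g r)
    have "abs_Dr (Poly_Mapping.single g r) = Dr_scale r (abs_Dr (Poly_Mapping.single g 1))"
      by (subst dr_single_eq_scale) (simp add: Dr_scale.abs_eq)
    then show ?case
      using gamma[of r] c[of r] by (cases g) (simp_all add: Dr_gamma_def Dr_c_def)
  next
    case (add u v)
    then show ?case
      using assms(3) by (simp add: plus_Dr.abs_eq[symmetric])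
  qed
  then show ?thesis
    by (metis Dr.abs_induct)
qed

lemma Dr_c_gamma: "Dr_scale (a\<^sup>2 - a) Dr_gamma = Dr_scale 2 (Dr_c a)"
  and Dr_c_add: "Dr_c (a + b) = Dr_c a + Dr_c b + Dr_scale (a * b) Dr_gamma"
  and Dr_c_mult: "Dr_c (a * b) = Dr_scale a (Dr_c b) + Dr_scale (b\<^sup>2) (Dr_c a)"
proof -
  interpret dr: Modules.module "dr_scale :: 'a \<Rightarrow> _" by (rule module_dr_scale)
  let ?g = "Poly_Mapping.single Gamma :: 'a \<Rightarrow> _"
  let ?c = "\<lambda>a :: 'a. Poly_Mapping.single (C a)"
  have *: "abs_Dr u = abs_Dr v" if "u - v \<in> dr_relators" for u v :: "'a dr_gen \<Rightarrow>\<^sub>0 'a"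
    using that by (simp add: Dr.abs_eq_iff dr_equiv_def dr.span_base)
  have "abs_Dr (?g (a\<^sup>2 - a)) = abs_Dr (?c a 2)"
    by (rule *) (auto simp: dr_relators_def Let_def)
  then show "Dr_scale (a\<^sup>2 - a) Dr_gamma = Dr_scale 2 (Dr_c a)"
    by (simp add: Dr_gamma_def Dr_c_def Dr_scale.abs_eq flip: dr_single_eq_scale)
  have "abs_Dr (?c (a + b) 1) = abs_Dr (?c a 1 + ?c b 1 + ?g (a * b))"
    by (rule *) (auto simp: dr_relators_def Let_def diff_diff_eq)
  then show "Dr_c (a + b) = Dr_c a + Dr_c b + Dr_scale (a * b) Dr_gamma"
    by (simp add: Dr_gamma_def Dr_c_def Dr_scale.abs_eq plus_Dr.abs_eq flip: dr_single_eq_scale)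
  have "abs_Dr (?c b a + ?c a (b\<^sup>2)) = abs_Dr (?c (a * b) 1)"
    by (rule *) (auto simp: dr_relators_def Let_def)
  then show "Dr_c (a * b) = Dr_scale a (Dr_c b) + Dr_scale (b\<^sup>2) (Dr_c a)"
    by (simp add: Dr_gamma_def Dr_c_def Dr_scale.abs_eq plus_Dr.abs_eq flip: dr_single_eq_scale)
qed

text \<open>Both sides are bilinear, so generators suffice. For \<gamma> and \<open>c_a\<close> this
  is the first relation of \<open>Dr\<close>; for \<open>c_a\<close> and \<open>c_b\<close> it
  follows by expanding \<open>c\<close> at \<open>a * b = b * a\<close> in two ways with the third
  relation.\<close>

lemma Dr_form_swap: "Dr_scale (Dr_form x) y = Dr_scale (Dr_form y) x"
proof -
  have gc: "Dr_scale 2 (Dr_c a) = Dr_scale (a\<^sup>2 - a) Dr_gamma" for a :: 'a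
    by (simp add: Dr_c_gamma)
  have cc: "Dr_scale (a\<^sup>2 - a) (Dr_c b) = Dr_scale (b\<^sup>2 - b) (Dr_c a)" for a b :: 'a
    using Dr_c_mult[of a b] Dr_c_mult[of b a]
    by (simp add: mult.commute Dr.scale_left_diff_distrib algebra_simps)
  show ?thesis
  proof (induction x rule: Dr_induct)
    case (gamma r)
    show ?case
    proof (induction y rule: Dr_induct)
      case (c q a)
      show ?case
        using arg_cong[OF gc[of a], of "Dr_scale (r * q)"]
        by (simp add: Dr_form_scale mult_ac)
    qed (simp_all add: Dr_form_scale Dr_form_add Dr.scale_right_distrib Dr.scale_left_distrib
        distrib_left mult_ac)
  next
    case (c r a)
    show ?case
    proof (induction y rule: Dr_induct)
      case (gamma q)
      show ?case
        using arg_cong[OF gc[of a], of "Dr_scale (r * q)"]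
        by (simp add: Dr_form_scale mult_ac)
    next
      case (c q b)
      show ?case
        using arg_cong[OF cc[of a b], of "Dr_scale (r * q)"]
        by (simp add: Dr_form_scale mult_ac)
    qed (simp_all add: Dr_form_scale Dr_form_add Dr.scale_right_distrib Dr.scale_left_distrib
        distrib_left distrib_right mult_ac)
  qed (simp_all add: Dr_form_add Dr.scale_right_distrib Dr.scale_left_distrib)
qed

section \<open>The kernel of the linear form\<close>

lemma Dr_c_zero: "Dr_c 0 = 0"
  using Dr_c_add[of 0 0] by simp

definition gamma_multiples :: "'a::comm_ring_1 Dr set"
  where "gamma_multiples = range (\<lambda>r. Dr_scale r Dr_gamma)"

lemma gamma_multiples_base: "Dr_scale r Dr_gamma \<in> gamma_multiples"
  by (simp add: gamma_multiples_def)

lemma gamma_multiples_add: "x \<in> gamma_multiples \<Longrightarrow> y \<in> gamma_multiples \<Longrightarrow> x + y \<in> gamma_multiples"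
  by (auto simp: gamma_multiples_def simp flip: Dr.scale_left_distrib)

lemma gamma_multiples_scale: "x \<in> gamma_multiples \<Longrightarrow> Dr_scale r x \<in> gamma_multiples"
  by (auto simp: gamma_multiples_def)

lemma gamma_multiples_diff: "x \<in> gamma_multiples \<Longrightarrow> y \<in> gamma_multiples \<Longrightarrow> x - y \<in> gamma_multiples"
  by (auto simp: gamma_multiples_def simp flip: Dr.scale_left_diff_distrib)

text \<open>As \<open>2 c_a\<close> is a multiple of \<gamma>, the quotient of \<open>Dr\<close> by
  \<gamma> is killed by 2. This disposes of the error terms in \<open>Dr_c_form\<close>.\<close>

lemma double_in_gamma_multiples: "Dr_scale 2 x \<in> gamma_multiples"
proof (induction x rule: Dr_induct)
  case (c r a)
  have "Dr_scale 2 (Dr_scale r (Dr_c a)) = Dr_scale (r * (a\<^sup>2 - a)) Dr_gamma"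
    using arg_cong[OF Dr_c_gamma[of a], of "Dr_scale r"] by (simp add: mult_ac)
  then show ?case
    by (simp add: gamma_multiples_def)
qed (auto simp: gamma_multiples_def Dr.scale_right_distrib simp flip: Dr.scale_left_distrib)

text \<open>Modulo \<open>\<gamma>\<close>, the map \<open>y \<mapsto> c (form y)\<close> is additive. The cross terms \<open>form x y + form y x\<close>
  on the other side are twice \<open>form x y\<close>, hence vanish modulo \<open>\<gamma>\<close> as well, so that it is enough
  to compare both sides on generators.\<close>

lemma Dr_c_form: "Dr_c (Dr_form y) - (Dr_scale (Dr_form y) y - y) \<in> gamma_multiples"
proof (induction y rule: Dr_induct)
  case (gamma r)
  have "Dr_c (r + r) = Dr_scale 2 (Dr_c r) + Dr_scale (r * r) Dr_gamma"
    by (simp only: Dr_c_add one_add_one[symmetric] Dr.scale_left_distrib Dr.scale_one)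
  then have "Dr_c (r + r) \<in> gamma_multiples"
    by (simp add: double_in_gamma_multiples gamma_multiples_add gamma_multiples_base)
  moreover have "Dr_form (Dr_scale r Dr_gamma) = r + r"
    by (simp add: Dr_form_scale)
  moreover have "Dr_scale s (Dr_scale r Dr_gamma) - Dr_scale r Dr_gamma \<in> gamma_multiples" for s
    by (intro gamma_multiples_diff gamma_multiples_scale gamma_multiples_base)
  ultimately show ?case
    by (simp add: gamma_multiples_diff)
next
  case (c r a)
  let ?y = "Dr_scale r (Dr_c a)"
  let ?z = "Dr_form ?y"
  have z: "?z = r * (a\<^sup>2 - a)"
    by (simp add: Dr_form_scale)
  \<comment> \<open>\<open>c\<close> at \<open>r * a\<^sup>2\<close> is computed twice: here from
    the sum \<open>?z + r * a\<close>, and in \<open>sq\<close> from the product.\<close>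
  have split: "Dr_c (r * a\<^sup>2) = Dr_c ?z + Dr_c (r * a) + Dr_scale (?z * (r * a)) Dr_gamma"
    using Dr_c_add[of ?z "r * a"] by (simp add: z algebra_simps)
  have sq: "Dr_c (r * a\<^sup>2) = Dr_scale (r * (a + a\<^sup>2)) (Dr_c a) + Dr_scale (a ^ 4) (Dr_c r)"
    unfolding Dr_c_mult[of r "a\<^sup>2"] unfolding power2_eq_square[of a] Dr_c_mult[of a a]
    by (simp add: Dr.scale_left_distrib Dr.scale_right_distrib algebra_simps
      power2_eq_square power4_eq_xxxx)
  \<comment> \<open>The swap identity turns the part of \<open>a ^ 4\<close> divisible by
    \<open>a\<^sup>2 - a\<close> into a multiple of \<open>c_a\<close>; the remaining
    \<open>a\<^sup>2\<close> times \<open>c_r\<close> cancels against the same term of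
    \<open>c\<close> at \<open>r * a\<close>.\<close>
  have "Dr_scale ((a\<^sup>2 + a) * (a\<^sup>2 - a)) (Dr_c r) = Dr_scale ((a\<^sup>2 + a) * (r\<^sup>2 - r)) (Dr_c a)"
    using arg_cong[OF Dr_form_swap[of "Dr_c a" "Dr_c r"], of "Dr_scale (a\<^sup>2 + a)"] by simp
  moreover have "a ^ 4 = (a\<^sup>2 + a) * (a\<^sup>2 - a) + a\<^sup>2"
    by (simp add: algebra_simps power2_eq_square power4_eq_xxxx)
  ultimately have "Dr_scale (a ^ 4) (Dr_c r) =
      Dr_scale ((a\<^sup>2 + a) * (r\<^sup>2 - r)) (Dr_c a) + Dr_scale (a\<^sup>2) (Dr_c r)"
    by (simp add: Dr.scale_left_distrib)
  moreover have "Dr_c ?z = Dr_c (r * a\<^sup>2) - Dr_c (r * a) - Dr_scale (?z * (r * a)) Dr_gamma"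
    by (simp add: split)
  ultimately have "Dr_c ?z = Dr_scale (r * (a + a\<^sup>2)) (Dr_c a) +
      Dr_scale ((a\<^sup>2 + a) * (r\<^sup>2 - r)) (Dr_c a) - Dr_scale r (Dr_c a)
      - Dr_scale (?z * (r * a)) Dr_gamma"
    by (simp only: sq Dr_c_mult[of r a]) simp
  \<comment> \<open>The surplus over the coefficient \<open>?z * r - r\<close> wanted in the
    congruence is twice something, hence harmless modulo \<gamma>.\<close>
  also have "\<dots> = Dr_scale (?z * r - r + 2 * (r\<^sup>2 * a)) (Dr_c a) - Dr_scale (?z * (r * a)) Dr_gamma"
    by (simp add: z algebra_simps power2_eq_square
        flip: Dr.scale_left_distrib Dr.scale_left_diff_distrib)
  finally have "Dr_c ?z - (Dr_scale ?z ?y - ?y) =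
      Dr_scale 2 (Dr_scale (r\<^sup>2 * a) (Dr_c a)) - Dr_scale (?z * (r * a)) Dr_gamma"
    by (simp add: Dr.scale_left_distrib Dr.scale_left_diff_distrib)
  then show ?case
    by (simp only: double_in_gamma_multiples gamma_multiples_diff gamma_multiples_base)
next
  case (add x y)
  let ?d = "\<lambda>y. Dr_c (Dr_form y) - (Dr_scale (Dr_form y) y - y)"
  have "Dr_scale (Dr_form (x + y)) (x + y) =
      Dr_scale (Dr_form x) x + Dr_scale (Dr_form y) y + Dr_scale 2 (Dr_scale (Dr_form x) y)"
    by (simp only: one_add_one[symmetric] Dr_form_add Dr.scale_left_distrib Dr.scale_right_distrib
      Dr.scale_one Dr_form_swap[of y x]) (simp add: algebra_simps)
  then have "?d (x + y) = (?d x + ?d y) + Dr_scale (Dr_form x * Dr_form y) Dr_gamma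
      - Dr_scale 2 (Dr_scale (Dr_form x) y)"
    by (simp add: Dr_form_add Dr_c_add algebra_simps)
  then show ?case
    by (simp only: gamma_multiples_add gamma_multiples_diff add double_in_gamma_multiples
      gamma_multiples_base)
qed

end

lemma inj_Dr_form: "inj (Dr_form :: 'a::{idom, ring_char_0} Dr \<Rightarrow> 'a)"
proof (rule injI)
  fix x y :: "'a Dr"
  interpret Dr: Modules.module "Dr_scale :: 'a \<Rightarrow> _" by (rule module_Dr_scale)
  assume "Dr_form x = Dr_form y"
  then have "Dr_form (x - y) = 0"
    by (simp add: Dr_form_diff)
  \<comment> \<open>On a kernel element \<open>y\<close> both \<open>Dr_c (Dr_form y)\<close> and
    \<open>Dr_scale (Dr_form y) y\<close> vanish, so the congruence leaves \<open>y\<close> itself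
    as a multiple of \<gamma>.\<close>
  with Dr_c_form[of "x - y"] obtain r where "x - y = Dr_scale r Dr_gamma"
    by (auto simp: Dr_c_zero gamma_multiples_def)
  with \<open>Dr_form (x - y) = 0\<close> show "x = y"
    by (simp add: Dr_form_scale)
qed

lemma range_Dr_form: "range Dr_form = (I2 :: 'a::comm_ring_1 set)"
proof
  interpret Dr: Modules.module "Dr_scale :: 'a \<Rightarrow> _" by (rule module_Dr_scale)
  have "Dr_form x \<in> I2" for x :: "'a Dr"
    unfolding I2_def
    by (induction x rule: Dr_induct)
      (simp_all add: Dr_form_add Dr_form_scale ideal_span_add,
        (rule ideal_span_mult, rule ideal_span_base, blast)+)
  then show "range Dr_form \<subseteq> (I2 :: 'a set)"
    by blast
  have "\<exists>x. a = Dr_form x" if "a \<in> I2" for a :: 'a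
    using that unfolding I2_def
  proof (induction a rule: module.span_induct_alt[OF module_times, consumes 1, case_names zero step])
    case zero
    show ?case
      by (metis Dr_form_zero)
  next
    case (step r s a)
    then obtain x where "a = Dr_form x"
      by blast
    moreover obtain y where "s = Dr_form y"
      using step.hyps(1) by (auto intro: Dr_form_c[symmetric] Dr_form_gamma[symmetric])
    ultimately show ?case
      by (metis Dr_form_add Dr_form_scale)
  qed
  then show "(I2 :: 'a set) \<subseteq> range Dr_form"
    by blast
qed

section \<open>Monomials and quadratic polynomials\<close>

text \<open>In contrast to \<open>poly_mapping_additive_induct\<close>, only monomials of the given
  \<open>p\<close> with their own coefficients occur, so hypotheses on the support or the
  coefficients of \<open>p\<close> remain available.\<close>

lemma mpol_sum_induct [consumes 0, case_names zero add monomial]: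
  fixes p :: "'x \<Rightarrow>\<^sub>0 'w::comm_monoid_add"
  assumes "P 0" and "\<And>p q. P p \<Longrightarrow> P q \<Longrightarrow> P (p + q)"
    and "\<And>m. m \<in> keys p \<Longrightarrow> P (Poly_Mapping.single m (lookup p m))"
  shows "P p"
proof -
  have "P (\<Sum>m\<in>S. Poly_Mapping.single m (lookup p m))" if "finite S" "S \<subseteq> keys p" for S
    using that by induction (simp_all add: assms)
  moreover have "p = (\<Sum>m\<in>keys p. Poly_Mapping.single m (lookup p m))"
    by (rule poly_mapping_eqI) (auto simp: lookup_sum lookup_single when_def in_keys_iff)
  ultimately show ?thesis
    by (metis finite_keys order_refl)
qed

abbreviation unit_mon :: "'x \<Rightarrow> ('x \<Rightarrow>\<^sub>0 nat)"
  where "unit_mon x \<equiv> Poly_Mapping.single x 1"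

lemma monomial_split:
  assumes "x \<in> keys m"
  obtains n where "m = unit_mon x + n"
proof
  show "m = unit_mon x + (m - unit_mon x)"
    using assms
    by (auto intro!: poly_mapping_eqI simp: lookup_add lookup_minus lookup_single when_def in_keys_iff)
qed

text \<open>The cases are degree zero, one and at least two. In the last one the variables split off
  are not unique, which is why \<open>collapse_mon\<close> needs a well-definedness proof.\<close>

lemma monomial_cases [case_names zero unit more]:
  obtains "m = 0" | d where "m = unit_mon d" | d e n where "m = unit_mon d + unit_mon e + n"
proof (cases "m = 0")
  case False
  then obtain d where "d \<in> keys m"
    using keys_eq_empty[of m] by blast
  then obtain n where n: "m = unit_mon d + n"
    by (rule monomial_split)
  show thesis
  proof (cases "n = 0")
    case False
    then obtain e where "e \<in> keys n"
      using keys_eq_empty[of n] by blast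
    then obtain k where "n = unit_mon e + k"
      by (rule monomial_split)
    with n show thesis
      using that(3)[of d e k] by (simp only: add.assoc)
  qed (use n that(2)[of d] in simp)
qed (use that in blast)

lemma monomial_exchange:
  assumes "unit_mon d + m = unit_mon e + n"
  shows "d = e \<and> m = n \<or> (\<exists>k. m = unit_mon e + k \<and> n = unit_mon d + k)"
proof (cases "d = e")
  case True
  with assms have "m = n"
    by (simp only: add_left_cancel)
  with True show ?thesis
    by (intro disjI1 conjI)
next
  case False
  have "lookup (unit_mon d + m) e = lookup (unit_mon e + n) e"
    by (simp only: assms)
  with False have "e \<in> keys m"
    by (simp add: lookup_add lookup_single in_keys_iff)
  then obtain k where k: "m = unit_mon e + k"
    by (rule monomial_split)
  with assms have "unit_mon e + (unit_mon d + k) = unit_mon e + n"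
    by (simp only: add_ac)
  then have "n = unit_mon d + k"
    by (simp only: add_left_cancel)
  with k show ?thesis
    by (intro disjI2 exI conjI)
qed

definition mon_degree :: "('x \<Rightarrow>\<^sub>0 nat) \<Rightarrow> nat"
  where "mon_degree m = (\<Sum>x\<in>keys m. lookup m x)"

lemma mon_degree_superset: "finite S \<Longrightarrow> keys m \<subseteq> S \<Longrightarrow> mon_degree m = (\<Sum>x\<in>S. lookup m x)"
  unfolding mon_degree_def by (rule sum.mono_neutral_left) (auto simp: in_keys_iff)

lemma mon_degree_add: "mon_degree (m + n) = mon_degree m + mon_degree n"
proof -
  let ?S = "keys m \<union> keys n"
  have "mon_degree (m + n) = (\<Sum>x\<in>?S. lookup (m + n) x)"
    by (intro mon_degree_superset) (auto dest: keys_add[THEN subsetD])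
  then show ?thesis
    by (simp add: mon_degree_superset[of ?S] lookup_add sum.distrib)
qed

lemma mon_degree_unit: "mon_degree (unit_mon x) = 1"
  by (simp add: mon_degree_def)

lemma mon_degree_0_iff: "mon_degree m = 0 \<longleftrightarrow> m = 0"
  by (auto simp: mon_degree_def in_keys_iff intro: poly_mapping_eqI)

lemma mon_degree_1D:
  assumes "mon_degree m = 1"
  obtains d where "m = unit_mon d"
proof (cases m rule: monomial_cases)
  case (more d e n)
  then have "mon_degree m \<noteq> 1"
    by (simp add: mon_degree_add mon_degree_unit del: One_nat_def)
  with assms show thesis
    by simp
qed (use assms that mon_degree_0_iff[of m] in auto)

lemma mon_degree_2D:
  assumes "mon_degree m = 2"
  obtains d e where "m = unit_mon d + unit_mon e"
proof (cases m rule: monomial_cases)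
  case (more d e n)
  with assms have "n = 0"
    by (simp add: mon_degree_add mon_degree_unit mon_degree_0_iff del: One_nat_def)
  with more that show thesis
    by simp
next
  case (unit d)
  with assms mon_degree_unit[of d] show thesis
    by simp
qed (use assms mon_degree_0_iff[of m] in auto)

lemma Var_mult_single: "Var d * Poly_Mapping.single m c = Poly_Mapping.single (unit_mon d + m) c"
  by (simp add: Var_def mult_single)

lemma Const_mult_single: "Const a * Poly_Mapping.single m c = Poly_Mapping.single m (a * c)"
  by (simp add: Const_def mult_single)

lemma Const_mult_Var: "Const a * Var d = Poly_Mapping.single (unit_mon d) a"
  by (simp add: Var_def Const_def mult_single)

lemma Const_mult_Var_Var:
  "Const a * (Var d * Var e) = Poly_Mapping.single (unit_mon d + unit_mon e) a"
  by (simp add: Var_def Const_def mult_single)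

lemma lookup_Const_mult: "lookup (Const a * p) m = a * lookup p m"
  by (induction p rule: poly_mapping_additive_induct)
    (simp_all add: Const_mult_single lookup_single when_def distrib_left lookup_add)

definition quadratic :: "('x, 'a::comm_ring_1) mpol set"
  where "quadratic = {p. \<forall>m\<in>keys p. mon_degree m = 2}"

lemma quadratic_monomial: "Const c * (Var d * Var e) \<in> quadratic"
  by (auto simp: quadratic_def Const_mult_Var_Var mon_degree_add mon_degree_unit simp del: One_nat_def)

lemma quadratic_zero: "0 \<in> quadratic"
  by (simp add: quadratic_def)

lemma quadratic_add: "p \<in> quadratic \<Longrightarrow> q \<in> quadratic \<Longrightarrow> p + q \<in> quadratic"
  by (auto simp: quadratic_def dest: keys_add[THEN subsetD])

lemma quadratic_diff: "p \<in> quadratic \<Longrightarrow> q \<in> quadratic \<Longrightarrow> p - q \<in> quadratic"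
  by (auto simp: quadratic_def dest: keys_diff[THEN subsetD])

lemma quadratic_Const_mult: "p \<in> quadratic \<Longrightarrow> Const a * p \<in> quadratic"
  by (auto simp: quadratic_def in_keys_iff lookup_Const_mult)

lemma quadratic_induct [consumes 1, case_names zero monomial add]:
  assumes "p \<in> quadratic" and "P 0" and "\<And>c d e. P (Const c * (Var d * Var e))"
    and "\<And>p q. P p \<Longrightarrow> P q \<Longrightarrow> P (p + q)"
  shows "P p"
proof (induction rule: mpol_sum_induct[of P p])
  case (monomial m)
  then have "mon_degree m = 2"
    using assms(1) by (simp add: quadratic_def)
  then obtain d e where "m = unit_mon d + unit_mon e"
    by (rule mon_degree_2D)
  with assms(3) show ?case
    by (simp only: Const_mult_Var_Var)
qed (use assms in auto)


section \<open>The two augmentations of the polynomial ring on \<open>Dr\<close>\<close>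

text \<open>Over any ring this is a right inverse of the form on \<open>I2\<close>; additivity and
  linearity follow only once the form is injective.\<close>

definition Dr_of :: "'a::comm_ring_1 \<Rightarrow> 'a Dr"
  where "Dr_of = inv_into UNIV Dr_form"

lemma Dr_form_Dr_of: "a \<in> I2 \<Longrightarrow> Dr_form (Dr_of a) = a"
  unfolding Dr_of_def by (rule f_inv_into_f) (simp add: range_Dr_form)

lemma Dr_form_in_I2: "Dr_form x \<in> I2"
  using range_Dr_form by blast

lemma I2_zero: "0 \<in> I2"
  and I2_add: "a \<in> I2 \<Longrightarrow> b \<in> I2 \<Longrightarrow> a + b \<in> I2"
  and I2_diff: "a \<in> I2 \<Longrightarrow> b \<in> I2 \<Longrightarrow> a - b \<in> I2"
  and I2_mult: "a \<in> I2 \<Longrightarrow> r * a \<in> I2"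
  by (simp_all add: I2_def ideal_span_0 ideal_span_add ideal_span_diff ideal_span_mult)

lemma Dr_of_eqI: "Dr_form x = a \<Longrightarrow> Dr_of a = x" for a :: "'a::{idom, ring_char_0}"
  unfolding Dr_of_def by (metis inj_Dr_form inv_f_f)

lemma Dr_of_zero: "Dr_of (0 :: 'a::{idom, ring_char_0}) = 0"
  by (rule Dr_of_eqI) simp

lemma Dr_of_add: "a \<in> I2 \<Longrightarrow> b \<in> I2 \<Longrightarrow> Dr_of (a + b) = Dr_of a + Dr_of b" for a :: "'a::{idom, ring_char_0}"
  by (rule Dr_of_eqI) (simp add: Dr_form_add Dr_form_Dr_of)

lemma Dr_of_mult: "b \<in> I2 \<Longrightarrow> Dr_of (a * b) = Dr_scale a (Dr_of b)" for a :: "'a::{idom, ring_char_0}"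
  by (rule Dr_of_eqI) (simp add: Dr_form_scale Dr_form_Dr_of)

definition at_form :: "('a Dr, 'a) mpol \<Rightarrow> 'a::comm_ring_1"
  where "at_form = mpol_eval (\<lambda>a. a) Dr_form"

definition at_zero :: "('a Dr, 'a) mpol \<Rightarrow> 'a::comm_ring_1"
  where "at_zero = mpol_eval (\<lambda>a. a) (\<lambda>_. 0)"

lemma unital_ring_hom_id: "unital_ring_hom (\<lambda>a. a)"
  by standard simp_all

lemma unital_ring_hom_at_form: "unital_ring_hom at_form"
  unfolding at_form_def by (rule unital_ring_hom.unital_ring_hom_mpol_eval[OF unital_ring_hom_id])

lemma unital_ring_hom_at_zero: "unital_ring_hom at_zero"
  unfolding at_zero_def by (rule unital_ring_hom.unital_ring_hom_mpol_eval[OF unital_ring_hom_id])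

lemma at_form_Const: "at_form (Const a) = a" and at_form_Var: "at_form (Var d) = Dr_form d"
  by (simp_all add: at_form_def unital_ring_hom.mpol_eval_Const unital_ring_hom.mpol_eval_Var unital_ring_hom_id)

lemma at_zero_Const: "at_zero (Const a) = a" and at_zero_Var: "at_zero (Var d) = 0"
  by (simp_all add: at_zero_def unital_ring_hom.mpol_eval_Const unital_ring_hom.mpol_eval_Var unital_ring_hom_id)

lemmas at_simps = at_form_Const at_form_Var at_zero_Const at_zero_Var
  unital_ring_hom.hom_add[OF unital_ring_hom_at_form] unital_ring_hom.hom_mult[OF unital_ring_hom_at_form]
  unital_ring_hom.hom_zero[OF unital_ring_hom_at_form] unital_ring_hom.hom_one[OF unital_ring_hom_at_form]
  unital_ring_hom.hom_minus[OF unital_ring_hom_at_form] unital_ring_hom.hom_uminus[OF unital_ring_hom_at_form]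
  unital_ring_hom.hom_add[OF unital_ring_hom_at_zero] unital_ring_hom.hom_mult[OF unital_ring_hom_at_zero]
  unital_ring_hom.hom_zero[OF unital_ring_hom_at_zero] unital_ring_hom.hom_one[OF unital_ring_hom_at_zero]
  unital_ring_hom.hom_minus[OF unital_ring_hom_at_zero] unital_ring_hom.hom_uminus[OF unital_ring_hom_at_zero]

lemma at_form_single: "at_form (Poly_Mapping.single m c) = c * mon_eval Dr_form m"
  by (simp add: at_form_def unital_ring_hom.mpol_eval_single unital_ring_hom_id)

lemma at_zero_eq_lookup: "at_zero p = lookup p 0"
proof (induction p rule: poly_mapping_additive_induct)
  case (single m a)
  show ?case
  proof (cases m rule: monomial_cases)
    case zero
    then show ?thesis
      using at_zero_Const[of a] by (simp add: Const_def)
  next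
    case (unit d)
    then have "at_zero (Poly_Mapping.single m a) = 0"
      by (simp only: at_simps flip: Const_mult_Var) simp
    moreover have "m \<noteq> 0"
      using unit mon_degree_0_iff[of m] mon_degree_unit[of d] by simp
    ultimately show ?thesis
      by (simp add: lookup_single)
  next
    case (more d e n)
    then have "Poly_Mapping.single m a = Var d * Poly_Mapping.single (unit_mon e + n) a"
      by (simp only: Var_mult_single add.assoc)
    then have "at_zero (Poly_Mapping.single m a) = 0"
      by (simp only: at_simps) simp
    moreover have "m \<noteq> 0"
      using more mon_degree_0_iff[of m] by (simp add: mon_degree_add mon_degree_unit del: One_nat_def)
    ultimately show ?thesis
      by (simp add: lookup_single)
  qed
qed (simp_all add: at_simps lookup_add)

text \<open>The two augmentations agree on constants and send every variable into \<open>I2\<close>,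
  so as ring homomorphisms they agree modulo \<open>I2\<close>.\<close>

lemma at_form_minus_at_zero_in_I2: "at_form p - at_zero p \<in> I2"
proof (induction p rule: mpol_induct)
  case (add p q)
  show ?case
    using I2_add[OF add] by (simp add: at_simps algebra_simps)
next
  case (mult p q)
  have "at_form (p * q) - at_zero (p * q) =
      at_form p * (at_form q - at_zero q) + at_zero q * (at_form p - at_zero p)"
    by (simp add: at_simps algebra_simps)
  then show ?case
    using mult by (simp add: I2_add I2_mult)
qed (simp_all add: at_simps I2_zero Dr_form_in_I2)

section \<open>Loops and the loops that become boundaries\<close>

definition loops :: "('a Dr, 'a::comm_ring_1) mpol set"
  where "loops = {w. at_form w = 0 \<and> at_zero w = 0}"

lemma loops_iff: "w \<in> loops \<longleftrightarrow> at_form w = 0 \<and> at_zero w = 0"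
  by (simp add: loops_def)

lemma loops_add: "v \<in> loops \<Longrightarrow> w \<in> loops \<Longrightarrow> v + w \<in> loops"
  and loops_diff: "v \<in> loops \<Longrightarrow> w \<in> loops \<Longrightarrow> v - w \<in> loops"
  and loops_mult: "w \<in> loops \<Longrightarrow> r * w \<in> loops"
  and loops_zero: "0 \<in> loops"
  by (simp_all add: loops_def at_simps)

text \<open>The ideal by which W is divided in the overview: its two families of generators are
  \<open>I2\<close> times W and the products of the two augmentation ideals.\<close>

definition small_loops :: "('a Dr, 'a::comm_ring_1) mpol set"
  where "small_loops = ideal_span ({Const a * w | a w. a \<in> I2 \<and> w \<in> loops} \<union>
    {u * v | u v. at_form u = 0 \<and> at_zero v = 0})"

lemma small_loops_zero: "0 \<in> small_loops"
  and small_loops_add: "p \<in> small_loops \<Longrightarrow> q \<in> small_loops \<Longrightarrow> p + q \<in> small_loops"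
  and small_loops_diff: "p \<in> small_loops \<Longrightarrow> q \<in> small_loops \<Longrightarrow> p - q \<in> small_loops"
  and small_loops_mult: "p \<in> small_loops \<Longrightarrow> r * p \<in> small_loops"
  by (simp_all add: small_loops_def ideal_span_0 ideal_span_add ideal_span_diff ideal_span_mult)

lemma small_loops_Const_mult: "a \<in> I2 \<Longrightarrow> w \<in> loops \<Longrightarrow> Const a * w \<in> small_loops"
  unfolding small_loops_def by (rule ideal_span_base) blast

lemma small_loops_times: "at_form u = 0 \<Longrightarrow> at_zero v = 0 \<Longrightarrow> u * v \<in> small_loops"
  unfolding small_loops_def by (rule ideal_span_base) blast

text \<open>Both families of generators are closed under multiplication by polynomials, so the ideal
  is already their additive span and no multiplier appears in the cases.\<close>

lemma small_loops_induct [consumes 1, case_names zero Const_mult times add]: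
  assumes "p \<in> small_loops" and "P 0"
    and "\<And>a w. a \<in> I2 \<Longrightarrow> w \<in> loops \<Longrightarrow> P (Const a * w)"
    and "\<And>u v. at_form u = 0 \<Longrightarrow> at_zero v = 0 \<Longrightarrow> P (u * v)"
    and "\<And>p q. p \<in> small_loops \<Longrightarrow> q \<in> small_loops \<Longrightarrow> P p \<Longrightarrow> P q \<Longrightarrow> P (p + q)"
  shows "P p"
proof -
  have "p \<in> small_loops \<and> P p"
    using assms(1) unfolding small_loops_def
  proof (induction p rule: module.span_induct_alt[OF module_times, consumes 1, case_names zero step])
    case zero
    show ?case
      using assms(2) small_loops_zero by (simp add: small_loops_def)
  next
    case (step r s q)
    have "P (r * s)"
      using step.hyps(1)
    proof (elim UnE CollectE exE conjE)
      fix a w assume "s = Const a * w" "a \<in> I2" "w \<in> loops"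
      then show ?thesis
        using assms(3)[of a "r * w"] by (simp add: loops_mult mult.left_commute)
    next
      fix u v assume "s = u * v" "at_form u = 0" "at_zero v = 0"
      then show ?thesis
        using assms(4)[of "r * u" v] by (simp add: at_simps mult.assoc)
    qed
    moreover have "r * s \<in> small_loops"
      unfolding small_loops_def by (intro ideal_span_mult ideal_span_base) (rule step.hyps)
    ultimately show ?case
      using step assms(5)[of "r * s" q] small_loops_add[of "r * s" q] by (simp add: small_loops_def)
  qed
  then show ?thesis ..
qed

lemma small_loops_subset_loops: "p \<in> small_loops \<Longrightarrow> p \<in> loops"
  by (induction p rule: small_loops_induct) (auto simp: loops_iff at_simps)

text \<open>\<open>r - Const (at_form r)\<close> lies in the kernel of \<open>at_form\<close> and
  \<open>w\<close> in that of \<open>at_zero\<close>. Hence polynomials act on loops modulo small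
  loops through \<open>at_form\<close> and the ring A / I_2.\<close>

lemma mult_loop_cong:
  assumes "w \<in> loops" "at_form r - a \<in> I2"
  shows "r * w - Const a * w \<in> small_loops"
proof -
  have "(r - Const (at_form r)) * w + Const (at_form r - a) * w \<in> small_loops"
    using assms by (intro small_loops_add small_loops_times small_loops_Const_mult)
      (simp_all add: at_simps loops_iff)
  then show ?thesis
    by (simp add: Const_simps algebra_simps)
qed

lemma mult_loop_small:
  assumes "w \<in> loops" "at_form r \<in> I2"
  shows "r * w \<in> small_loops"
  using mult_loop_cong[of w r 0] assms by (simp add: Const_simps)

section \<open>Quadratic relations in the symmetric algebra\<close>

lemma abs_L2buds_eq_0_iff: "abs_L2buds p = 0 \<longleftrightarrow> p \<in> ideal_span sym_relators"
  by (simp add: zero_L2buds_def L2buds.abs_eq_iff sym_equiv_def)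

lemma abs_L2buds_add: "abs_L2buds (p + q) = abs_L2buds p + abs_L2buds q"
  and abs_L2buds_mult: "abs_L2buds (p * q) = abs_L2buds p * abs_L2buds q"
  and abs_L2buds_diff: "abs_L2buds (p - q) = abs_L2buds p - abs_L2buds q"
  by (simp_all add: plus_L2buds.abs_eq times_L2buds.abs_eq minus_L2buds.abs_eq)

interpretation L_const: unital_ring_hom "L_const :: 'a::comm_ring_1 \<Rightarrow> 'a L2buds"
  by (rule unital_ring_hom_L_const)

lemma abs_L2buds_monomial:
  "abs_L2buds (Const c * (Var d * Var e)) = L_const c * (L_incl d * L_incl e)"
  by (simp add: abs_L2buds_mult L_const_def L_incl_def)

lemma sym_relator_in_loops: "s \<in> sym_relators \<Longrightarrow> s \<in> loops"
  by (auto simp: sym_relators_def loops_iff at_simps Dr_form_add Dr_form_scale)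

lemma mon_degree_sym_relator: "s \<in> sym_relators \<Longrightarrow> m \<in> keys s \<Longrightarrow> mon_degree m = 1"
  by (auto simp: sym_relators_def Var_def mon_degree_unit in_keys_iff lookup_minus lookup_Const_mult
      lookup_single when_def simp del: One_nat_def split: if_splits)

text \<open>Relators are homogeneous of degree one, so the quadratic part of a combination only
  involves products of a relator with a constant and a single variable, and these are small since
  relators are loops.\<close>

lemma quadratic_part_of_sym_relation:
  assumes "p \<in> ideal_span sym_relators"
  shows "\<exists>q\<in>small_loops. \<forall>m. lookup q m = (if mon_degree m = 2 then lookup p m else 0)"
    (is "?Q p")
proof -
  have Q_add: "?Q (p + q)" if p: "?Q p" and q: "?Q q" for p q
  proof -
    obtain p' where "p' \<in> small_loops" "\<forall>m. lookup p' m = (if mon_degree m = 2 then lookup p m else 0)"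
      using p by blast
    moreover obtain q' where "q' \<in> small_loops" "\<forall>m. lookup q' m = (if mon_degree m = 2 then lookup q m else 0)"
      using q by blast
    ultimately show ?thesis
      by (intro bexI[of _ "p' + q'"]) (auto simp: lookup_add small_loops_add)
  qed
  have Q_mult: "?Q (r * s)" if s: "s \<in> sym_relators" for r s
  proof (induction r rule: poly_mapping_additive_induct)
    case (single m c)
    let ?r = "Poly_Mapping.single m c * s"
    have deg: "mon_degree k = mon_degree m + 1" if "k \<in> keys ?r" for k
    proof -
      from that keys_mult[of "Poly_Mapping.single m c" s]
      obtain n where "k = m + n" "n \<in> keys s"
        by (auto split: if_splits)
      then show ?thesis
        using mon_degree_sym_relator[OF s] by (simp add: mon_degree_add)
    qed
    show ?case
    proof (cases "mon_degree m = 1")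
      case True
      then obtain e where e: "m = unit_mon e"
        by (rule mon_degree_1D)
      \<comment> \<open>The first summand is a product of elements of the two augmentation ideals,
        the second an element of \<open>I2\<close> times a loop.\<close>
      have "Const c * ((Var e - Const (Dr_form e)) * s + Const (Dr_form e) * s) \<in> small_loops"
        using sym_relator_in_loops[OF s]
        by (intro small_loops_mult small_loops_add small_loops_times small_loops_Const_mult)
          (simp_all add: at_simps loops_iff Dr_form_in_I2)
      then have "?r \<in> small_loops"
        by (simp add: e algebra_simps flip: Const_mult_Var del: One_nat_def)
      moreover have "lookup ?r k = 0" if "mon_degree k \<noteq> 2" for k
        using deg[of k] that True by (auto simp: in_keys_iff)
      ultimately show ?thesis
        by auto
    next
      case False
      then have "lookup ?r k = 0" if "mon_degree k = 2" for k
        using deg[of k] that by (auto simp: in_keys_iff)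
      then show ?thesis
        by (intro bexI[of _ 0]) (auto simp: small_loops_zero)
    qed
  next
    case zero
    show ?case
      by (intro bexI[of _ 0]) (auto simp: small_loops_zero)
  next
    case (add p q)
    then show ?case
      using Q_add[of "p * s" "q * s"] by (simp only: distrib_right)
  qed
  from assms show ?thesis
  proof (induction p rule: module.span_induct_alt[OF module_times, consumes 1, case_names zero step])
    case zero
    show ?case
      by (intro bexI[of _ 0]) (auto simp: small_loops_zero)
  next
    case (step r s p)
    then show ?case
      using Q_add[OF Q_mult] by blast
  qed
qed

text \<open>Modulo small loops a quadratic polynomial is therefore determined by its image in the
  symmetric algebra, which makes the later choice of representatives harmless.\<close>

lemma quadratic_sym_relation_small:
  assumes "p \<in> quadratic" "abs_L2buds p = 0"
  shows "p \<in> small_loops"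
proof -
  obtain q where q: "q \<in> small_loops" "\<forall>m. lookup q m = (if mon_degree m = 2 then lookup p m else 0)"
    using quadratic_part_of_sym_relation assms(2) by (metis abs_L2buds_eq_0_iff)
  have "q = p"
    by (rule poly_mapping_eqI) (use assms(1) q in \<open>auto simp: quadratic_def in_keys_iff\<close>)
  with q show ?thesis
    by simp
qed

section \<open>A left inverse: from loops to the symmetric square\<close>

definition collapse_mon :: "'a::comm_ring_1 Dr \<Rightarrow> 'a Dr \<Rightarrow> ('a Dr \<Rightarrow>\<^sub>0 nat) \<Rightarrow> 'a L2buds"
  where "collapse_mon d e n = L_const (mon_eval Dr_form n) * (L_incl d * L_incl e)"

lemma collapse_mon_commute: "collapse_mon d e n = collapse_mon e d n"
  by (simp add: collapse_mon_def mult_ac)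

text \<open>\<open>Dr_form_swap\<close> exchanges a variable that is kept for one that is evaluated
  at its form.\<close>

lemma collapse_mon_exchange: "collapse_mon d e (unit_mon f + n) = collapse_mon f e (unit_mon d + n)"
proof -
  have "L_const (Dr_form f) * L_incl d = L_const (Dr_form d) * L_incl f"
    using Dr_form_swap[of f d] by (simp flip: L_incl_scale)
  from arg_cong[OF this, of "\<lambda>z. L_const (mon_eval Dr_form n) * L_incl e * z"] show ?thesis
    by (simp add: collapse_mon_def mon_eval_add L_const.hom_mult mult_ac del: One_nat_def)
qed

text \<open>Any variable \<open>d'\<close> dividing the monomial can be made the first one kept: it
  is \<open>d\<close>, or \<open>e\<close>, or a factor of \<open>n\<close> that is exchanged for
  \<open>d\<close>. Applied to both kept variables this yields well-definedness.\<close>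

lemma collapse_mon_extract:
  assumes "unit_mon d + unit_mon e + n = unit_mon d' + k"
  shows "\<exists>f l. k = unit_mon f + l \<and> collapse_mon d e n = collapse_mon d' f l"
proof -
  have "unit_mon d + (unit_mon e + n) = unit_mon d' + k"
    using assms by (simp only: add.assoc)
  from monomial_exchange[OF this] consider "d = d'" "unit_mon e + n = k"
    | j where "unit_mon e + n = unit_mon d' + j" "k = unit_mon d + j"
    by blast
  then show ?thesis
  proof cases
    case 1
    then show ?thesis
      by (intro exI[of _ e] exI[of _ n]) simp
  next
    case (2 j)
    from monomial_exchange[OF 2(1)] consider "e = d'" "n = j"
      | i where "n = unit_mon d' + i" "j = unit_mon e + i"
      by blast
    then show ?thesis
    proof cases
      case 1
      with 2 show ?thesis
        by (intro exI[of _ d] exI[of _ n]) (simp add: collapse_mon_commute)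
    next
      case (2 i)
      with \<open>k = unit_mon d + j\<close> show ?thesis
        by (intro exI[of _ e] exI[of _ "unit_mon d + i"])
          (simp only: collapse_mon_exchange add.left_commute simp_thms)
    qed
  qed
qed

lemma collapse_mon_well_defined:
  assumes "unit_mon d + unit_mon e + n = unit_mon d' + unit_mon e' + n'"
  shows "collapse_mon d e n = collapse_mon d' e' n'"
proof -
  obtain f l where f: "unit_mon e' + n' = unit_mon f + l" "collapse_mon d e n = collapse_mon d' f l"
    using collapse_mon_extract[of d e n d' "unit_mon e' + n'"] assms by (metis add.assoc)
  from monomial_exchange[OF f(1)] consider "e' = f" "n' = l"
    | j where "n' = unit_mon f + j" "l = unit_mon e' + j"
    by blast
  then show ?thesis
  proof cases
    case (2 j)
    then show ?thesis
      using f(2) by (metis collapse_mon_commute collapse_mon_exchange)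
  qed (use f in simp)
qed

text \<open>This map is meaningful (and additive) only on polynomials without constant term whose linear
  coefficients lie in \<open>I\<^sub>2\<close>, since \<open>Dr_of\<close> is arbitrary outside \<open>I\<^sub>2\<close>. It recovers a quadratic
  element of the symmetric algebra from its class modulo small loops.\<close>

definition collapse_term :: "('a Dr \<Rightarrow>\<^sub>0 nat) \<Rightarrow> 'a \<Rightarrow> 'a::{idom, ring_char_0} L2buds"
  where "collapse_term m c =
    (if \<exists>d. m = unit_mon d then L_incl (Dr_of c) * L_incl (SOME d. m = unit_mon d)
     else if \<exists>d e n. m = unit_mon d + unit_mon e + n
       then L_const c * (SOME y. \<exists>d e n. m = unit_mon d + unit_mon e + n \<and> y = collapse_mon d e n)
     else 0)"

lemma unit_mon_neq: "unit_mon d + unit_mon e + n \<noteq> unit_mon f"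
proof
  assume "unit_mon d + unit_mon e + n = unit_mon f"
  from arg_cong[OF this, of mon_degree] show False
    by (simp add: mon_degree_add mon_degree_unit del: One_nat_def)
qed

lemma unit_mon_inject: "unit_mon d = unit_mon e \<longleftrightarrow> d = e"
  using monomial_exchange[of d 0 e 0] by (metis keys_single insertCI keys_zero empty_iff zero_neq_one singletonD)

lemma collapse_term_0: "collapse_term 0 c = 0"
proof -
  have "(0 :: 'a Dr \<Rightarrow>\<^sub>0 nat) \<noteq> unit_mon d" "(0 :: 'a Dr \<Rightarrow>\<^sub>0 nat) \<noteq> unit_mon d + unit_mon e + n" for d e n
    using mon_degree_0_iff[of "unit_mon d"] mon_degree_0_iff[of "unit_mon d + unit_mon e + n"]
    by (auto simp: mon_degree_add mon_degree_unit simp del: One_nat_def)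
  then show ?thesis
    by (simp only: collapse_term_def simp_thms if_False ex_simps)
qed

lemma collapse_term_unit: "collapse_term (unit_mon d) c = L_incl (Dr_of c) * L_incl d"
  unfolding collapse_term_def unit_mon_inject by auto

lemma collapse_term_more:
  "collapse_term (unit_mon d + unit_mon e + n) c = L_const c * collapse_mon d e n"
proof -
  have "(SOME y. \<exists>d' e' n'. unit_mon d + unit_mon e + n = unit_mon d' + unit_mon e' + n' \<and>
      y = collapse_mon d' e' n') = collapse_mon d e n"
    by (rule some_equality) (blast intro: collapse_mon_well_defined[symmetric])+
  moreover have "\<exists>d' e' n'. unit_mon d + unit_mon e + n = unit_mon d' + unit_mon e' + n'"
    by blast
  ultimately show ?thesis
    unfolding collapse_term_def using unit_mon_neq[of d e n] by (simp only: if_True if_False simp_thms)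
qed

definition collapse :: "('a Dr, 'a) mpol \<Rightarrow> 'a::{idom, ring_char_0} L2buds"
  where "collapse p = (\<Sum>m\<in>keys p. collapse_term m (lookup p m))"

definition linear_in_I2 :: "('a Dr, 'a::comm_ring_1) mpol set"
  where "linear_in_I2 = {p. \<forall>d. lookup p (unit_mon d) \<in> I2}"

lemma linear_in_I2_add: "p \<in> linear_in_I2 \<Longrightarrow> q \<in> linear_in_I2 \<Longrightarrow> p + q \<in> linear_in_I2"
  by (simp add: linear_in_I2_def lookup_add I2_add)

lemma linear_in_I2_zero: "0 \<in> linear_in_I2"
  by (simp add: linear_in_I2_def I2_zero)

lemma L_incl_zero: "L_incl (0 :: 'a::comm_ring_1 Dr) = 0"
  using L_incl_add[of 0 "0 :: 'a Dr"] by simp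

lemma collapse_term_zero_coeff: "collapse_term m (0 :: 'a::{idom, ring_char_0}) = 0"
  by (cases m rule: monomial_cases)
    (simp_all add: collapse_term_0 collapse_term_unit collapse_term_more Dr_of_zero L_incl_zero L_const.hom_zero
      del: One_nat_def)

lemma collapse_single: "collapse (Poly_Mapping.single m (c :: 'a::{idom, ring_char_0})) = collapse_term m c"
  by (simp add: collapse_def collapse_term_zero_coeff)

lemma collapse_zero: "collapse (0 :: ('a::{idom, ring_char_0} Dr, 'a) mpol) = 0"
  by (simp add: collapse_def)

text \<open>The restriction to \<open>linear_in_I2\<close> is needed because linear coefficients
  enter through \<open>Dr_of\<close>, which is additive on \<open>I2\<close>.\<close>

lemma collapse_add:
  fixes p q :: "('a::{idom, ring_char_0} Dr, 'a) mpol"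
  assumes "p \<in> linear_in_I2" "q \<in> linear_in_I2"
  shows "collapse (p + q) = collapse p + collapse q"
proof -
  have superset: "collapse r = (\<Sum>m\<in>S. collapse_term m (lookup r m))"
    if "finite S" "keys r \<subseteq> S" for r :: "('a Dr, 'a) mpol" and S
    unfolding collapse_def
    by (rule sum.mono_neutral_left) (use that in \<open>auto simp: in_keys_iff collapse_term_zero_coeff\<close>)
  let ?S = "keys p \<union> keys q"
  have "collapse_term m (lookup (p + q) m) = collapse_term m (lookup p m) + collapse_term m (lookup q m)" for m
  proof (cases m rule: monomial_cases)
    case (unit d)
    then have "lookup p m \<in> I2" "lookup q m \<in> I2"
      using assms by (auto simp: linear_in_I2_def)
    then show ?thesis
      unfolding unit collapse_term_unit by (simp add: lookup_add Dr_of_add L_incl_add distrib_right)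
  qed (simp_all add: collapse_term_0 collapse_term_more lookup_add L_const.hom_add distrib_right del: One_nat_def)
  then show ?thesis
    by (subst (1 2 3) superset[of ?S]) (auto dest: keys_add[THEN subsetD] simp: sum.distrib)
qed

lemma linear_in_I2_Const_mult: "a \<in> I2 \<Longrightarrow> Const a * p \<in> linear_in_I2"
  using I2_mult[of a] by (simp add: linear_in_I2_def lookup_Const_mult mult.commute[of a])

lemma L_incl_Dr_of_mult: "b \<in> I2 \<Longrightarrow> L_incl (Dr_of (a * b)) = L_const a * L_incl (Dr_of (b :: 'a::{idom, ring_char_0}))"
  by (simp add: Dr_of_mult L_incl_scale)

lemma L_incl_Dr_of_form: "L_incl (Dr_of (Dr_form d)) = (L_incl d :: 'a::{idom, ring_char_0} L2buds)"
  by (simp add: Dr_of_eqI)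

lemma L_const_form_mult: "a \<in> I2 \<Longrightarrow> L_const a * L_incl d = L_const (Dr_form d) * L_incl (Dr_of (a :: 'a::{idom, ring_char_0}))"
  using Dr_form_swap[of "Dr_of a" d] by (simp add: Dr_form_Dr_of flip: L_incl_scale)

text \<open>On linear monomials the scalar \<open>a\<close> becomes the factor
  \<open>Dr_of a\<close> by construction, on higher ones by the swap identity. For a loop
  \<open>w\<close> the second factor is zero, which handles one family of generators of
  \<open>small_loops\<close>.\<close>

lemma collapse_Const_mult:
  fixes a :: "'a::{idom, ring_char_0}"
  assumes a: "a \<in> I2"
  shows "collapse (Const a * w) = L_incl (Dr_of a) * L_incl (Dr_of (at_form w - at_zero w))"
proof (induction w rule: poly_mapping_additive_induct)
  case (single m b)
  show ?case
  proof (cases m rule: monomial_cases)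
    case zero
    then show ?thesis
      by (simp add: Const_mult_single collapse_single collapse_term_0 at_form_single at_zero_eq_lookup
          Dr_of_zero L_incl_zero)
  next
    case (unit d)
    have "collapse (Const a * Poly_Mapping.single m b) = L_const b * L_incl (Dr_of a) * L_incl d"
      unfolding unit Const_mult_single collapse_single collapse_term_unit
      using L_incl_Dr_of_mult[OF a, of b] by (simp add: mult.commute)
    moreover have "at_form (Poly_Mapping.single m b) - at_zero (Poly_Mapping.single m b) = b * Dr_form d"
      unfolding unit Const_mult_Var[symmetric] by (simp add: at_simps)
    ultimately show ?thesis
      by (simp add: L_incl_Dr_of_mult Dr_form_in_I2 L_incl_Dr_of_form mult_ac)
  next
    case (more d e n)
    have "collapse (Const a * Poly_Mapping.single m b) =
        L_const b * L_const (mon_eval Dr_form n) * L_incl e * (L_const a * L_incl d)"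
      unfolding more Const_mult_single collapse_single collapse_term_more collapse_mon_def
      by (simp add: L_const.hom_mult mult_ac)
    \<comment> \<open>The scalar \<open>a\<close> on \<open>d\<close> is traded for the scalar
      \<open>Dr_form d\<close> on \<open>Dr_of a\<close>, after which only \<open>e\<close> and
      \<open>Dr_of a\<close> remain as factors.\<close>
    also have "\<dots> = L_const (b * mon_eval Dr_form n * Dr_form d) * L_incl e * L_incl (Dr_of a)"
      unfolding L_const_form_mult[OF a] by (simp add: L_const.hom_mult mult_ac)
    finally have *: "collapse (Const a * Poly_Mapping.single m b) = \<dots>" .
    have "Poly_Mapping.single m b = Var d * Poly_Mapping.single (unit_mon e + n) b"
      by (simp only: more Var_mult_single add.assoc)
    then have "at_zero (Poly_Mapping.single m b) = 0"
      by (simp only: at_simps) simp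
    then have "at_form (Poly_Mapping.single m b) - at_zero (Poly_Mapping.single m b) =
        (b * mon_eval Dr_form n * Dr_form d) * Dr_form e"
      unfolding more by (simp add: at_form_single mon_eval_add mult_ac del: One_nat_def)
    then show ?thesis
      by (simp only: * L_incl_Dr_of_mult[OF Dr_form_in_I2] L_incl_Dr_of_form) (simp add: mult_ac)
  qed
next
  case (add v w)
  have "at_form (v + w) - at_zero (v + w) = (at_form v - at_zero v) + (at_form w - at_zero w)"
    by (simp add: at_simps)
  then show ?case
    using add by (simp add: distrib_left collapse_add linear_in_I2_Const_mult[OF a] Dr_of_add
      at_form_minus_at_zero_in_I2 L_incl_add)
qed (simp add: collapse_zero at_simps Dr_of_zero L_incl_zero)

lemma lookup_Var_mult_unit: "lookup (Var d * p) (unit_mon e) = (if d = e then lookup p 0 else (0 :: 'a::{idom, ring_char_0}))"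
proof (induction p rule: poly_mapping_additive_induct)
  case (single m c)
  have "unit_mon d + m = unit_mon e \<longleftrightarrow> d = e \<and> m = 0"
  proof
    assume eq: "unit_mon d + m = unit_mon e"
    have "mon_degree (unit_mon d + m) = 1"
      unfolding eq by (rule mon_degree_unit)
    then have "m = 0"
      unfolding mon_degree_add mon_degree_unit by (simp add: mon_degree_0_iff)
    with eq unit_mon_inject[of d e] show "d = e \<and> m = 0"
      by simp
  qed simp
  then show ?case
    by (simp add: Var_mult_single lookup_single when_def del: One_nat_def)
qed (simp_all add: distrib_left lookup_add)

lemma linear_in_I2_Var_mult: "lookup u 0 \<in> I2 \<Longrightarrow> Var d * (u :: ('a::{idom, ring_char_0} Dr, 'a) mpol) \<in> linear_in_I2"
  by (simp add: linear_in_I2_def lookup_Var_mult_unit I2_zero del: One_nat_def)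

text \<open>One variable is kept and the rest is evaluated, so the result depends on
  \<open>u\<close> only through \<open>at_form u\<close>; this handles the products among the
  generators of \<open>small_loops\<close>.\<close>

lemma collapse_Var_mult:
  fixes u :: "('a::{idom, ring_char_0} Dr, 'a) mpol"
  assumes "lookup u 0 \<in> I2"
  shows "collapse (Var d * u) = L_incl d * L_incl (Dr_of (at_form u))"
proof -
  \<comment> \<open>The memberships are carried along in the induction, since additivity of
    \<open>collapse\<close> and of \<open>Dr_of\<close> requires them for each summand.\<close>
  have "lookup u 0 \<in> I2 \<and> at_form u \<in> I2 \<and> collapse (Var d * u) = L_incl d * L_incl (Dr_of (at_form u))"
  proof (induction rule: mpol_sum_induct[of _ u])
    case (add p q)
    then show ?case
      by (simp add: distrib_left at_simps lookup_add collapse_add I2_add linear_in_I2_Var_mult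
        Dr_of_add L_incl_add)
  next
    case (monomial m)
    let ?c = "lookup u m"
    let ?p = "Poly_Mapping.single m ?c"
    have "lookup ?p 0 \<in> I2"
      using assms by (auto simp: lookup_single when_def I2_zero)
    moreover from this have "at_form ?p \<in> I2"
      using I2_add[OF at_form_minus_at_zero_in_I2[of ?p]] by (fastforce simp: at_zero_eq_lookup)
    moreover have "collapse (Var d * ?p) = L_incl d * L_incl (Dr_of (at_form ?p))"
    proof (cases m rule: monomial_cases)
      case zero
      then show ?thesis
        using collapse_term_unit[of d ?c]
        by (simp add: Var_mult_single collapse_single at_form_single mult.commute del: One_nat_def)
    next
      case (unit e)
      have "collapse (Var d * ?p) = L_const ?c * (L_incl d * L_incl e)"
        using collapse_term_more[of d e 0 ?c] unfolding Var_mult_single collapse_single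
        by (simp add: unit collapse_mon_def L_const.hom_one del: One_nat_def)
      moreover have "at_form ?p = ?c * Dr_form e"
        unfolding unit by (simp add: at_form_single del: One_nat_def)
      ultimately show ?thesis
        by (simp only: L_incl_Dr_of_mult[OF Dr_form_in_I2] L_incl_Dr_of_form mult.left_commute)
    next
      case (more e f n)
      have "collapse (Var d * ?p) = L_const ?c * collapse_mon d e (unit_mon f + n)"
        using collapse_term_more[of d e "unit_mon f + n" ?c] unfolding Var_mult_single collapse_single
        by (simp add: more add.assoc del: One_nat_def)
      moreover have "at_form ?p = (?c * mon_eval Dr_form (unit_mon f + n)) * Dr_form e"
        unfolding more by (simp add: at_form_single mon_eval_add mult_ac del: One_nat_def)
      ultimately show ?thesis
        unfolding collapse_mon_def
        by (simp only: L_incl_Dr_of_mult[OF Dr_form_in_I2] L_incl_Dr_of_form L_const.hom_mult) (simp only: mult_ac)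
    qed
    ultimately show ?case
      by blast
  qed (simp add: I2_zero at_simps collapse_zero Dr_of_zero L_incl_zero)
  then show ?thesis
    by blast
qed

lemma collapse_small_loops:
  fixes p :: "('a::{idom, ring_char_0} Dr, 'a) mpol"
  assumes "p \<in> small_loops"
  shows "p \<in> linear_in_I2 \<and> collapse p = 0"
  using assms
proof (induction p rule: small_loops_induct)
  case (Const_mult a w)
  then show ?case
    by (simp add: collapse_Const_mult linear_in_I2_Const_mult loops_iff Dr_of_zero L_incl_zero)
next
  case (times u v)
  have "at_zero r \<in> I2" if "at_form r = 0" for r :: "('a Dr, 'a) mpol"
    using I2_diff[OF I2_zero at_form_minus_at_zero_in_I2[of r]] that by simp
  then have *: "lookup (u * r) 0 \<in> I2 \<and> at_form (u * r) = 0" for r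
    using times by (simp add: at_simps I2_mult mult.commute[of "at_zero u"] flip: at_zero_eq_lookup)
  show ?case
  proof (induction rule: mpol_sum_induct[of _ v])
    case zero
    show ?case
      by (simp add: linear_in_I2_zero collapse_zero)
  next
    case (add p q)
    then show ?case
      by (simp add: distrib_left linear_in_I2_add collapse_add)
  next
    case (monomial m)
    then have "m \<noteq> 0"
      using times by (auto simp: at_zero_eq_lookup in_keys_iff)
    then obtain d where "d \<in> keys m"
      using keys_eq_empty[of m] by blast
    then obtain n where m: "m = unit_mon d + n"
      by (rule monomial_split)
    \<comment> \<open>As \<open>v\<close> has no constant term, each of its monomials supplies a
      variable to pull out, and the remaining factor is still killed by
      \<open>at_form\<close>.\<close>
    have eq: "u * Poly_Mapping.single m c = Var d * (u * Poly_Mapping.single n c)" for c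
      unfolding m by (simp only: Var_mult_single mult.left_commute[of "Var d"])
    show ?case
      unfolding eq using *[of "Poly_Mapping.single n (lookup v m)"]
      by (simp add: linear_in_I2_Var_mult collapse_Var_mult Dr_of_zero L_incl_zero)
  qed
next
  case (add p q)
  then show ?case
    by (simp add: linear_in_I2_add collapse_add)
qed (simp add: linear_in_I2_zero collapse_zero)

lemma collapse_quadratic:
  fixes p :: "('a::{idom, ring_char_0} Dr, 'a) mpol"
  assumes "p \<in> quadratic"
  shows "p \<in> linear_in_I2 \<and> collapse p = abs_L2buds p"
  using assms
proof (induction p rule: quadratic_induct)
  case zero
  show ?case
    by (simp add: linear_in_I2_zero collapse_zero flip: zero_L2buds_def)
next
  case (monomial c d e)
  have eq: "Const c * (Var d * Var e) = Var d * (Const c * Var e)"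
    by (rule mult.left_commute)
  have "lookup (Const c * Var e :: ('a Dr, 'a) mpol) 0 = 0"
    by (simp add: at_simps flip: at_zero_eq_lookup)
  then have "Var d * (Const c * Var e) \<in> linear_in_I2 \<and>
      collapse (Var d * (Const c * Var e)) = L_const c * (L_incl d * L_incl e)"
    by (simp add: linear_in_I2_Var_mult collapse_Var_mult I2_zero at_simps L_incl_Dr_of_mult Dr_form_in_I2
      L_incl_Dr_of_form mult.left_commute[of "L_incl d"])
  then show ?case
    unfolding abs_L2buds_monomial by (metis eq)
next
  case (add p q)
  then show ?case
    by (simp add: linear_in_I2_add collapse_add abs_L2buds_add)
qed

lemma quadratic_small_loop_eq_0:
  fixes p :: "('a::{idom, ring_char_0} Dr, 'a) mpol"
  assumes "p \<in> quadratic" "p \<in> small_loops"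
  shows "abs_L2buds p = 0"
  using collapse_quadratic collapse_small_loops assms by metis

text \<open>A linear monomial with coefficient \<open>c\<close> in \<open>I2\<close> becomes
  quadratic because \<open>Const c - Var (Dr_of c)\<close> is killed by \<open>at_form\<close>. In a
  monomial of degree at least two, all but two variables may be evaluated at their forms.\<close>

lemma eq_quadratic_mod_small_loops:
  fixes t :: "('a Dr, 'a::comm_ring_1) mpol"
  assumes "at_zero t = 0" "t \<in> linear_in_I2"
  shows "\<exists>p\<in>quadratic. t - p \<in> small_loops"
proof (induction rule: mpol_sum_induct[of _ t])
  case zero
  show ?case
    by (intro bexI[of _ 0]) (simp_all add: small_loops_zero quadratic_zero)
next
  case (add s t)
  then obtain p q where "p \<in> quadratic" "q \<in> quadratic" "s - p \<in> small_loops" "t - q \<in> small_loops"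
    by blast
  then show ?case
    using small_loops_add[of "s - p" "t - q"]
    by (intro bexI[of _ "p + q"]) (simp_all add: quadratic_add algebra_simps)
next
  case (monomial m)
  let ?c = "lookup t m"
  show ?case
  proof (cases m rule: monomial_cases)
    case zero
    with assms(1) have "?c = 0"
      by (simp add: at_zero_eq_lookup)
    then have "Poly_Mapping.single m ?c - 0 \<in> small_loops"
      by (simp add: small_loops_zero)
    then show ?thesis
      using quadratic_zero by blast
  next
    case (unit d)
    then have c: "?c \<in> I2"
      using assms(2) by (simp add: linear_in_I2_def)
    have "(Const ?c - Var (Dr_of ?c)) * Var d \<in> small_loops"
      by (intro small_loops_times) (simp_all add: at_simps Dr_form_Dr_of c)
    moreover have "Var (Dr_of ?c) * Var d \<in> quadratic"
      using quadratic_monomial[of 1 "Dr_of ?c" d] by (simp add: Const_simps)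
    moreover have "Poly_Mapping.single m ?c = Const ?c * Var d"
      unfolding Const_mult_Var unit ..
    ultimately show ?thesis
      unfolding left_diff_distrib by (intro bexI) simp_all
  next
    case (more d e n)
    let ?r = "Poly_Mapping.single n ?c"
    have "(?r - Const (at_form ?r)) * (Var d * Var e) \<in> small_loops"
      by (intro small_loops_times) (simp_all add: at_simps)
    moreover have "Poly_Mapping.single m c = Poly_Mapping.single n c * (Var d * Var e)" for c :: 'a
      by (simp add: more Var_def mult_single add_ac del: One_nat_def)
    ultimately show ?thesis
      using quadratic_monomial[of "at_form ?r" d e] unfolding left_diff_distrib
      by (intro bexI) simp_all
  qed
qed


section \<open>Sections of the square of the bundle of invariant differentials\<close>

text \<open>The constants are a retract of the symmetric algebra: \<open>at_zero\<close> kills all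
  relators.\<close>

lemma inj_L_const: "L_const a = 0 \<Longrightarrow> a = 0"
proof -
  assume "L_const a = 0"
  then have "Const a \<in> ideal_span (sym_relators :: ('a Dr, 'a) mpol set)"
    by (simp add: L_const_def abs_L2buds_eq_0_iff)
  then have "at_zero (Const a) = 0"
    using eval_ideal_span_eq_0[OF unital_ring_hom_at_zero] sym_relator_in_loops
    by (metis loops_iff)
  then show "a = 0"
    by (simp add: at_simps)
qed

text \<open>In the image of a product \<open>d * e\<close> the two contributions to the coefficient
  of \<open>t\<close> are equal by \<open>Dr_form_swap\<close>, so it is twice an element whose form
  is the coefficient of \<open>t\<^sup>2\<close>.\<close>

lemma eta_R_quadratic:
  assumes "p \<in> quadratic"
  shows "\<exists>y. Dr_form y = at_form p \<and>
    eta_R (abs_L2buds p) = [:abs_L2buds p, 2 * L_incl y, L_const (at_form p):]"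
proof -
  interpret R: unital_ring_hom eta_R
    by (rule unital_ring_hom_eta_R)
  from assms show ?thesis
  proof (induction p rule: quadratic_induct)
    case zero
    have "abs_L2buds 0 = (0 :: 'a L2buds)"
      by (simp flip: zero_L2buds_def)
    moreover have "L_incl (0 :: 'a Dr) = 0"
      using L_incl_add[of 0 "0 :: 'a Dr"] by simp
    ultimately show ?case
      by (intro exI[of _ 0]) (simp add: at_simps R.hom_zero L_const.hom_zero)
  next
    case (monomial c d e)
    \<comment> \<open>Its form is \<open>c * Dr_form d * Dr_form e\<close>, the value of
      \<open>at_form\<close> on the monomial.\<close>
    let ?y = "Dr_scale (c * Dr_form d) e"
    have "L_const (Dr_form e) * L_incl d = L_const (Dr_form d) * L_incl e"
      using Dr_form_swap[of e d] by (simp flip: L_incl_scale)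
    then have swap: "L_incl d * L_const (Dr_form e) = L_incl e * L_const (Dr_form d)"
      by (simp add: mult.commute)
    have "eta_R (abs_L2buds (Const c * (Var d * Var e))) =
        [:L_const c * (L_incl d * L_incl e), 2 * L_incl ?y, L_const (c * (Dr_form d * Dr_form e)):]"
      unfolding abs_L2buds_monomial R.hom_mult eta_R_const eta_R_incl L_incl_scale L_const.hom_mult
      by (simp add: swap algebra_simps)
    then show ?case
      by (intro exI[of _ ?y]) (simp add: abs_L2buds_monomial at_simps Dr_form_scale mult_ac)
  next
    case (add p q)
    then obtain x y where
      "Dr_form x = at_form p" "eta_R (abs_L2buds p) = [:abs_L2buds p, 2 * L_incl x, L_const (at_form p):]"
      "Dr_form y = at_form q" "eta_R (abs_L2buds q) = [:abs_L2buds q, 2 * L_incl y, L_const (at_form q):]"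
      by blast
    then show ?case
      by (intro exI[of _ "x + y"])
        (simp add: Dr_form_add at_simps abs_L2buds_add R.hom_add L_const.hom_add L_incl_add distrib_left)
  qed
qed

text \<open>The coefficient of \<open>t\<^sup>2\<close> detects \<open>at_form p\<close>; when that
  vanishes, so does the coefficient of \<open>t\<close>, by injectivity of the form on
  \<open>Dr\<close>.\<close>

lemma eta_R_eq_eta_L_iff:
  fixes p :: "('a Dr, 'a::{idom, ring_char_0}) mpol"
  assumes "p \<in> quadratic"
  shows "eta_R (abs_L2buds p) - eta_L (abs_L2buds p) = 0 \<longleftrightarrow> at_form p = 0"
proof -
  obtain y where y: "Dr_form y = at_form p"
    "eta_R (abs_L2buds p) = [:abs_L2buds p, 2 * L_incl y, L_const (at_form p):]"
    using eta_R_quadratic[OF assms] by blast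
  show ?thesis
  proof
    assume "at_form p = 0"
    with y have "y = 0"
      by (metis Dr_form_zero inj_Dr_form inj_eq)
    with y \<open>at_form p = 0\<close> show "eta_R (abs_L2buds p) - eta_L (abs_L2buds p) = 0"
      by (simp add: eta_L_def L_incl_zero L_const.hom_zero)
  next
    assume "eta_R (abs_L2buds p) - eta_L (abs_L2buds p) = 0"
    then have "L_const (at_form p) = 0"
      by (simp add: y eta_L_def)
    then show "at_form p = 0"
      by (rule inj_L_const)
  qed
qed

lemma L_degree_4: "L_degree 4 = abs_L2buds ` quadratic"
proof -
  have "2 * n = 4 \<longleftrightarrow> n = 2" for n :: nat
    by auto
  then show ?thesis
    unfolding L_degree_def quadratic_def mon_degree_def by (simp only:)
qed

section \<open>Free modules and Kaehler relations\<close>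

lemma push_superset:
  assumes "finite S" "keys v \<subseteq> S"
  shows "push f v = (\<Sum>x\<in>S. Poly_Mapping.single (f x) (lookup v x))"
  unfolding push_def by (rule sum.mono_neutral_left) (use assms in \<open>auto simp: in_keys_iff\<close>)

lemma push_zero: "push f 0 = 0"
  by (simp add: push_def)

lemma push_single: "push f (Poly_Mapping.single x w) = Poly_Mapping.single (f x) w"
  by (simp add: push_superset[of "{x}"])

lemma push_add: "push f (u + v) = push f u + push f v"
proof -
  let ?S = "keys u \<union> keys v"
  have "push f (u + v) = (\<Sum>x\<in>?S. Poly_Mapping.single (f x) (lookup (u + v) x))"
    by (intro push_superset) (auto dest: keys_add[THEN subsetD])
  then show ?thesis
    by (simp add: push_superset[of ?S] lookup_add single_add sum.distrib)
qed

lemma push_diff: "push f (u - v) = push f u - push f v" for u v :: "'x \<Rightarrow>\<^sub>0 'w::ab_group_add"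
  using push_add[of f "u - v" v] by simp

lemma boundary_add: "boundary ds (u + v) = boundary ds u + boundary ds v"
  unfolding boundary_def sum.distrib[symmetric] by (rule sum.cong) (simp_all add: push_add)

lemma boundary_zero: "boundary ds 0 = 0"
  using boundary_add[of ds 0 0] by simp

lemma boundary_diff: "boundary ds (u - v) = boundary ds u - boundary ds v"
  using boundary_add[of ds "u - v" v] by simp

context unital_ring_hom
begin

abbreviation "scl \<equiv> kaehler_scale \<phi> (*)"

lemma lookup_kaehler_scale: "lookup (scl a v) x = \<phi> a * lookup v x"
  by (simp add: kaehler_scale_def lookup_coeffwise)

lemma kaehler_scale_single: "scl a (Poly_Mapping.single x w) = Poly_Mapping.single x (\<phi> a * w)"
  by (rule poly_mapping_eqI) (simp add: lookup_kaehler_scale lookup_single when_def)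

lemma module_kaehler_scale: "Modules.module (scl :: _ \<Rightarrow> ('p \<Rightarrow>\<^sub>0 'b) \<Rightarrow> _)"
  by unfold_locales
    (auto intro!: poly_mapping_eqI simp: lookup_kaehler_scale lookup_add hom_add hom_mult hom_one algebra_simps)

lemma push_kaehler_scale: "push f (scl a v) = scl a (push f v)"
proof -
  interpret Modules.module "scl :: _ \<Rightarrow> ('c \<Rightarrow>\<^sub>0 'b) \<Rightarrow> _" by (rule module_kaehler_scale)
  interpret n: Modules.module "scl :: _ \<Rightarrow> ('d \<Rightarrow>\<^sub>0 'b) \<Rightarrow> _" by (rule module_kaehler_scale)
  show ?thesis
    by (induction v rule: poly_mapping_additive_induct)
      (simp_all add: push_zero push_single push_add kaehler_scale_single scale_right_distrib n.scale_right_distrib)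
qed

abbreviation "kr \<equiv> kaehler_relations \<phi> (*)"

lemma kr_zero: "0 \<in> kr i \<epsilon>"
  and kr_add: "u \<in> kr i \<epsilon> \<Longrightarrow> v \<in> kr i \<epsilon> \<Longrightarrow> u + v \<in> kr i \<epsilon>"
  and kr_diff: "u \<in> kr i \<epsilon> \<Longrightarrow> v \<in> kr i \<epsilon> \<Longrightarrow> u - v \<in> kr i \<epsilon>"
  and kr_scale: "u \<in> kr i \<epsilon> \<Longrightarrow> scl a u \<in> kr i \<epsilon>"
  unfolding kaehler_relations_def Let_def
  by (rule module.span_zero[OF module_kaehler_scale] module.span_add[OF module_kaehler_scale]
      module.span_diff[OF module_kaehler_scale] module.span_scale[OF module_kaehler_scale]; assumption)+

lemma kr_plus: "Poly_Mapping.single (p + q) w - Poly_Mapping.single p w - Poly_Mapping.single q w \<in> kr i \<epsilon>"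
  and kr_times: "Poly_Mapping.single (p * q) w - Poly_Mapping.single q (\<epsilon> p * w)
    - Poly_Mapping.single p (\<epsilon> q * w) \<in> kr i \<epsilon>"
  and kr_const: "Poly_Mapping.single (i a) w \<in> kr i \<epsilon>"
  unfolding kaehler_relations_def Let_def
  by (rule module.span_base[OF module_kaehler_scale], blast)+

text \<open>The set of relators is closed under scalars, so \<open>kr\<close> is their additive
  span.\<close>

lemma kr_induct [consumes 1, case_names zero plus times const add]:
  assumes "v \<in> kr i \<epsilon>" and "P 0"
    and "\<And>p q w. P (Poly_Mapping.single (p + q) w - Poly_Mapping.single p w - Poly_Mapping.single q w)"
    and "\<And>p q w. P (Poly_Mapping.single (p * q) w - Poly_Mapping.single q (\<epsilon> p * w)
      - Poly_Mapping.single p (\<epsilon> q * w))"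
    and "\<And>a w. P (Poly_Mapping.single (i a) w)"
    and "\<And>u v. P u \<Longrightarrow> P v \<Longrightarrow> P (u + v)"
  shows "P v"
proof -
  interpret Modules.module "scl :: _ \<Rightarrow> ('c \<Rightarrow>\<^sub>0 'b) \<Rightarrow> _" by (rule module_kaehler_scale)
  from assms(1) show ?thesis
    unfolding kaehler_relations_def Let_def
  proof (induction v rule: span_induct_alt[consumes 1, case_names zero step])
    case zero
    show ?case by (rule assms(2))
  next
    case (step a u v)
    have "P (scl a u)"
      using step.hyps(1)
      by (elim UnE CollectE exE conjE; simp only: scale_right_diff_distrib kaehler_scale_single
          mult.left_commute[of "\<phi> a"] assms(3-5))
    with step show ?case
      using assms(6) by blast
  qed
qed

text \<open>Functoriality of Kaehler differentials for maps of augmented A-algebras.\<close>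

lemma push_kr:
  assumes f: "\<And>p q. f (p + q) = f p + f q" "\<And>p q. f (p * q) = f p * f q" "\<And>a. f (i a) = j a"
    and eps: "\<And>p. \<delta> (f p) = \<epsilon> p"
    and "v \<in> kr i \<epsilon>"
  shows "push f v \<in> kr j \<delta>"
  using assms(5)
proof (induction v rule: kr_induct)
  case (times p q w)
  show ?case
    using kr_times[of "f p" "f q" w \<delta> j] by (simp add: push_diff push_single f eps)
qed (simp_all add: push_diff push_single push_add push_zero f eps kr_zero kr_plus kr_const kr_add)

end


section \<open>The standard resolution\<close>

lemma mpol_map_simps:
  "mpol_map g (Const a) = Const a" "mpol_map g (Var x) = Var (g x)"
  "mpol_map g (p + q) = mpol_map g p + mpol_map g q" "mpol_map g (p * q) = mpol_map g p * mpol_map g q"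
  "mpol_map g (p - q) = mpol_map g p - mpol_map g q" "mpol_map g 0 = 0"
  unfolding mpol_map_def
  by (simp_all add: unital_ring_hom.mpol_eval_Const unital_ring_hom.mpol_eval_Var unital_ring_hom_Const
    unital_ring_hom.hom_add[OF unital_ring_hom.unital_ring_hom_mpol_eval[OF unital_ring_hom_Const]]
    unital_ring_hom.hom_mult[OF unital_ring_hom.unital_ring_hom_mpol_eval[OF unital_ring_hom_Const]]
    unital_ring_hom.hom_zero[OF unital_ring_hom.unital_ring_hom_mpol_eval[OF unital_ring_hom_Const]]
    unital_ring_hom.hom_minus[OF unital_ring_hom.unital_ring_hom_mpol_eval[OF unital_ring_hom_Const]])

lemma counit_Const_simps:
  "counit Const (Const a) = Const a" "counit Const (Var x) = x"
  "counit Const (p + q) = counit Const p + counit Const q"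
  "counit Const (p * q) = counit Const p * counit Const q"
  "counit Const (p - q) = counit Const p - counit Const q" "counit Const 0 = 0"
  unfolding counit_def
  by (simp_all add: unital_ring_hom.mpol_eval_Const unital_ring_hom.mpol_eval_Var unital_ring_hom_Const
    unital_ring_hom.hom_add[OF unital_ring_hom.unital_ring_hom_mpol_eval[OF unital_ring_hom_Const]]
    unital_ring_hom.hom_mult[OF unital_ring_hom.unital_ring_hom_mpol_eval[OF unital_ring_hom_Const]]
    unital_ring_hom.hom_zero[OF unital_ring_hom.unital_ring_hom_mpol_eval[OF unital_ring_hom_Const]]
    unital_ring_hom.hom_minus[OF unital_ring_hom.unital_ring_hom_mpol_eval[OF unital_ring_hom_Const]])

lemma counit_mod_I2_simps:
  "counit to_mod_I2 (Const a) = to_mod_I2 a" "counit to_mod_I2 (Var x) = x"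
  "counit to_mod_I2 (p + q) = counit to_mod_I2 p + counit to_mod_I2 q"
  "counit to_mod_I2 (p * q) = counit to_mod_I2 p * counit to_mod_I2 q"
  "counit to_mod_I2 (p - q) = counit to_mod_I2 p - counit to_mod_I2 q" "counit to_mod_I2 0 = 0"
  unfolding counit_def
  by (simp_all add: unital_ring_hom.mpol_eval_Const unital_ring_hom.mpol_eval_Var unital_ring_hom_to_mod_I2
    unital_ring_hom.hom_add[OF unital_ring_hom.unital_ring_hom_mpol_eval[OF unital_ring_hom_to_mod_I2]]
    unital_ring_hom.hom_mult[OF unital_ring_hom.unital_ring_hom_mpol_eval[OF unital_ring_hom_to_mod_I2]]
    unital_ring_hom.hom_zero[OF unital_ring_hom.unital_ring_hom_mpol_eval[OF unital_ring_hom_to_mod_I2]]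
    unital_ring_hom.hom_minus[OF unital_ring_hom.unital_ring_hom_mpol_eval[OF unital_ring_hom_to_mod_I2]])

lemmas face_simps = mpol_map_simps counit_Const_simps counit_mod_I2_simps

abbreviation face1_0 :: "('a::comm_ring_1 mod_I2, 'a) P1 \<Rightarrow> ('a mod_I2, 'a) P0"
  where "face1_0 \<equiv> counit Const"
abbreviation face1_1 :: "('a::comm_ring_1 mod_I2, 'a) P1 \<Rightarrow> ('a mod_I2, 'a) P0"
  where "face1_1 \<equiv> mpol_map (counit to_mod_I2)"
abbreviation face2_0 :: "('a::comm_ring_1 mod_I2, 'a) P2 \<Rightarrow> ('a mod_I2, 'a) P1"
  where "face2_0 \<equiv> counit Const"
abbreviation face2_1 :: "('a::comm_ring_1 mod_I2, 'a) P2 \<Rightarrow> ('a mod_I2, 'a) P1"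
  where "face2_1 \<equiv> mpol_map face1_0"
abbreviation face2_2 :: "('a::comm_ring_1 mod_I2, 'a) P2 \<Rightarrow> ('a mod_I2, 'a) P1"
  where "face2_2 \<equiv> mpol_map face1_1"
abbreviation face3_0 :: "('a::comm_ring_1 mod_I2, 'a) P3 \<Rightarrow> ('a mod_I2, 'a) P2"
  where "face3_0 \<equiv> counit Const"
abbreviation face3_1 :: "('a::comm_ring_1 mod_I2, 'a) P3 \<Rightarrow> ('a mod_I2, 'a) P2"
  where "face3_1 \<equiv> mpol_map face2_0"
abbreviation face3_2 :: "('a::comm_ring_1 mod_I2, 'a) P3 \<Rightarrow> ('a mod_I2, 'a) P2"
  where "face3_2 \<equiv> mpol_map face2_1"
abbreviation face3_3 :: "('a::comm_ring_1 mod_I2, 'a) P3 \<Rightarrow> ('a mod_I2, 'a) P2"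
  where "face3_3 \<equiv> mpol_map face2_2"

lemma augmentation1_eq: "augmentation1 to_mod_I2 p = counit to_mod_I2 (face1_0 p)"
  and augmentation2_eq: "augmentation2 to_mod_I2 P = counit to_mod_I2 (face1_0 (face2_0 P))"
  by (simp_all add: augmentation1_def augmentation2_def)

lemma augmentation_face1: "counit to_mod_I2 (face1_1 p) = counit to_mod_I2 (face1_0 p)"
  by (induction p rule: mpol_induct) (simp_all add: face_simps)

lemma face1_face2:
  "face1_0 (face2_1 P) = face1_0 (face2_0 P)"
  "face1_0 (face2_2 P) = face1_1 (face2_0 P)"
  "face1_1 (face2_2 P) = face1_1 (face2_1 P)"
  by (induction P rule: mpol_induct) (simp_all add: face_simps augmentation_face1)

lemma face2_face3:
  "face2_0 (face3_1 y) = face2_0 (face3_0 y)"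
  "face2_0 (face3_2 y) = face2_1 (face3_0 y)"
  "face2_0 (face3_3 y) = face2_2 (face3_0 y)"
  "face2_1 (face3_2 y) = face2_1 (face3_1 y)"
  "face2_1 (face3_3 y) = face2_2 (face3_1 y)"
  "face2_2 (face3_3 y) = face2_2 (face3_2 y)"
  by (induction y rule: mpol_induct) (simp_all add: face_simps face1_face2)

lemma boundary_faces2:
  "boundary (faces2 to_mod_I2) v = push face2_0 v - push face2_1 v + push face2_2 v"
  by (simp add: boundary_def faces2_def faces1_def faces0_def next_faces_def)

lemma boundary_faces3:
  "boundary (faces3 to_mod_I2) v = push face3_0 v - push face3_1 v + push face3_2 v - push face3_3 v"
  by (simp add: boundary_def faces3_def faces2_def faces1_def faces0_def next_faces_def)

interpretation mod_I2: unital_ring_hom "to_mod_I2 :: 'a::comm_ring_1 \<Rightarrow> 'a mod_I2"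
  by (rule unital_ring_hom_to_mod_I2)

abbreviation boundaries2 :: "(('a::comm_ring_1 mod_I2, 'a) P2 \<Rightarrow>\<^sub>0 'a mod_I2) set"
  where "boundaries2 \<equiv> AQ_boundaries2 to_mod_I2 (*)"

lemma boundaries2I:
  "n \<in> mod_I2.kr Const (augmentation2 to_mod_I2) \<Longrightarrow> n + boundary (faces3 to_mod_I2) y \<in> boundaries2"
  unfolding AQ_boundaries2_def by blast

lemma kr_subset_boundaries2: "n \<in> mod_I2.kr Const (augmentation2 to_mod_I2) \<Longrightarrow> n \<in> boundaries2"
  using boundaries2I[of n 0] by (simp add: boundary_zero)

lemma boundary_in_boundaries2: "boundary (faces3 to_mod_I2) y \<in> boundaries2"
  using boundaries2I[OF mod_I2.kr_zero, of y] by simp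

lemma boundaries2_zero: "0 \<in> boundaries2"
  by (rule kr_subset_boundaries2[OF mod_I2.kr_zero])

lemma boundaries2_add: "u \<in> boundaries2 \<Longrightarrow> v \<in> boundaries2 \<Longrightarrow> u + v \<in> boundaries2"
proof -
  assume "u \<in> boundaries2" "v \<in> boundaries2"
  then obtain m x n y where
    "u = m + boundary (faces3 to_mod_I2) x" "m \<in> mod_I2.kr Const (augmentation2 to_mod_I2)"
    "v = n + boundary (faces3 to_mod_I2) y" "n \<in> mod_I2.kr Const (augmentation2 to_mod_I2)"
    by (auto simp: AQ_boundaries2_def)
  then have "u + v = (m + n) + boundary (faces3 to_mod_I2) (x + y)"
      "m + n \<in> mod_I2.kr Const (augmentation2 to_mod_I2)"
    by (simp_all add: boundary_add mod_I2.kr_add)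
  then show ?thesis
    unfolding AQ_boundaries2_def by blast
qed

lemma boundaries2_scale: "u \<in> boundaries2 \<Longrightarrow> mod_I2.scl a u \<in> boundaries2"
proof -
  assume "u \<in> boundaries2"
  then obtain m x where "u = m + boundary (faces3 to_mod_I2) x"
    "m \<in> mod_I2.kr Const (augmentation2 to_mod_I2)"
    by (auto simp: AQ_boundaries2_def)
  moreover have "boundary (faces3 to_mod_I2) (mod_I2.scl a x) = mod_I2.scl a (boundary (faces3 to_mod_I2) x)"
    by (simp add: boundary_faces3 mod_I2.push_kaehler_scale
      module.scale_right_diff_distrib[OF mod_I2.module_kaehler_scale]
      module.scale_right_distrib[OF mod_I2.module_kaehler_scale])
  ultimately have "mod_I2.scl a u = mod_I2.scl a m + boundary (faces3 to_mod_I2) (mod_I2.scl a x)"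
      "mod_I2.scl a m \<in> mod_I2.kr Const (augmentation2 to_mod_I2)"
    by (simp_all add: mod_I2.kr_scale module.scale_right_distrib[OF mod_I2.module_kaehler_scale])
  then show ?thesis
    unfolding AQ_boundaries2_def by blast
qed

lemma boundaries2_uminus: "u \<in> boundaries2 \<Longrightarrow> - u \<in> boundaries2"
proof -
  assume "u \<in> boundaries2"
  moreover have "mod_I2.scl (- 1) u = - u"
    using module.scale_minus_left[OF mod_I2.module_kaehler_scale, of 1 u]
      module.scale_one[OF mod_I2.module_kaehler_scale, of u] by simp
  ultimately show ?thesis
    by (metis boundaries2_scale)
qed

lemma boundaries2_diff: "u \<in> boundaries2 \<Longrightarrow> v \<in> boundaries2 \<Longrightarrow> u - v \<in> boundaries2"
  using boundaries2_add[OF _ boundaries2_uminus] by fastforce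

section \<open>Calculus of 2-chains modulo boundaries\<close>

definition boundaries2_equiv ::
    "(('a::comm_ring_1 mod_I2, 'a) P2 \<Rightarrow>\<^sub>0 'a mod_I2) \<Rightarrow> (('a mod_I2, 'a) P2 \<Rightarrow>\<^sub>0 'a mod_I2) \<Rightarrow> bool"
  where "boundaries2_equiv u v \<longleftrightarrow> u - v \<in> boundaries2"

lemma equivp_boundaries2_equiv: "equivp boundaries2_equiv"
proof (rule equivpI)
  show "reflp boundaries2_equiv"
    by (rule reflpI) (simp add: boundaries2_equiv_def boundaries2_zero)
  show "symp boundaries2_equiv"
  proof (rule sympI)
    show "boundaries2_equiv v u" if "boundaries2_equiv u v" for u v
      using boundaries2_uminus[of "u - v"] that by (simp add: boundaries2_equiv_def)
  qed
  show "transp boundaries2_equiv"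
  proof (rule transpI)
    show "boundaries2_equiv u w" if "boundaries2_equiv u v" "boundaries2_equiv v w" for u v w
      using boundaries2_add[of "u - v" "v - w"] that by (simp add: boundaries2_equiv_def)
  qed
qed

\<comment> \<open>Passing to a quotient type turns congruences modulo boundaries into equations in
  an abelian group.\<close>
quotient_type (overloaded) 'a chain_class =
  "('a::comm_ring_1 mod_I2, 'a) P2 \<Rightarrow>\<^sub>0 'a mod_I2" / boundaries2_equiv
  by (rule equivp_boundaries2_equiv)

instantiation chain_class :: (comm_ring_1) ab_group_add
begin

lift_definition zero_chain_class :: "'a chain_class" is 0 .
lift_definition plus_chain_class :: "'a chain_class \<Rightarrow> 'a chain_class \<Rightarrow> 'a chain_class" is "(+)"
  unfolding boundaries2_equiv_def add_diff_add by (rule boundaries2_add)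
lift_definition minus_chain_class :: "'a chain_class \<Rightarrow> 'a chain_class \<Rightarrow> 'a chain_class" is "(-)"
proof -
  fix a b c d :: "('a mod_I2, 'a) P2 \<Rightarrow>\<^sub>0 'a mod_I2"
  assume "boundaries2_equiv a b" "boundaries2_equiv c d"
  then have "(a - b) - (c - d) \<in> boundaries2"
    unfolding boundaries2_equiv_def by (rule boundaries2_diff)
  then show "boundaries2_equiv (a - c) (b - d)"
    by (simp add: boundaries2_equiv_def algebra_simps)
qed
lift_definition uminus_chain_class :: "'a chain_class \<Rightarrow> 'a chain_class" is uminus
proof -
  fix a b :: "('a mod_I2, 'a) P2 \<Rightarrow>\<^sub>0 'a mod_I2"
  assume "boundaries2_equiv a b"
  then show "boundaries2_equiv (- a) (- b)"
    using boundaries2_uminus[of "a - b"] by (simp add: boundaries2_equiv_def)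
qed

instance
proof
  have "boundaries2_equiv x y" if "x = y" for x y :: "('a mod_I2, 'a) P2 \<Rightarrow>\<^sub>0 'a mod_I2"
    using that by (simp add: boundaries2_equiv_def boundaries2_zero)
  then show "a + b + c = a + (b + c)" "a + b = b + a" "0 + a = a" "- a + a = 0" "a - b = a + - b"
    for a b c :: "'a chain_class"
    by (transfer, simp add: algebra_simps)+
qed

end

definition chain :: "('a::comm_ring_1 mod_I2, 'a) P2 \<Rightarrow> 'a mod_I2 \<Rightarrow> 'a chain_class"
  where "chain P w = abs_chain_class (Poly_Mapping.single P w)"

lemma abs_chain_class_eq_0_iff: "abs_chain_class v = 0 \<longleftrightarrow> v \<in> boundaries2"
  by (simp add: zero_chain_class_def chain_class.abs_eq_iff boundaries2_equiv_def)

lemma abs_chain_class_add: "abs_chain_class (u + v) = abs_chain_class u + abs_chain_class v"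
  and abs_chain_class_diff: "abs_chain_class (u - v) = abs_chain_class u - abs_chain_class v"
  by (simp_all add: plus_chain_class.abs_eq minus_chain_class.abs_eq)

lemma chain_add_right: "chain P (v + w) = chain P v + chain P w"
  by (simp add: chain_def single_add abs_chain_class_add)

lemma chain_zero_right: "chain P 0 = 0"
  using chain_add_right[of P 0 0] by simp

lemma chain_plus: "chain (P + Q) w = chain P w + chain Q w"
  using kr_subset_boundaries2[OF mod_I2.kr_plus[of P Q w Const]]
  by (simp add: chain_def algebra_simps abs_chain_class_diff abs_chain_class_add
    flip: abs_chain_class_eq_0_iff)

lemma chain_times:
  "chain (P * Q) w = chain Q (augmentation2 to_mod_I2 P * w) + chain P (augmentation2 to_mod_I2 Q * w)"
  using kr_subset_boundaries2[OF mod_I2.kr_times[of P Q w "augmentation2 to_mod_I2" Const]]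
  by (simp add: chain_def algebra_simps abs_chain_class_diff abs_chain_class_add
    flip: abs_chain_class_eq_0_iff)

lemma chain_Const: "chain (Const a) w = 0"
  using kr_subset_boundaries2[OF mod_I2.kr_const[of Const a w]]
  by (simp add: chain_def abs_chain_class_eq_0_iff)

text \<open>The 3-chain on \<open>Var P\<close> has zeroth face \<open>P\<close>, and its other
  faces are the variables on the faces of \<open>P\<close>; its boundary gives the equation.\<close>

lemma chain_face:
  "chain P w = chain (Var (face2_0 P)) w - chain (Var (face2_1 P)) w + chain (Var (face2_2 P)) w"
  using boundary_in_boundaries2[of "Poly_Mapping.single (Var P) w"]
  by (simp add: boundary_faces3 push_single face_simps chain_def algebra_simps abs_chain_class_diff
    abs_chain_class_add flip: abs_chain_class_eq_0_iff)

section \<open>From loops to chains\<close>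

text \<open>A polynomial \<open>t\<close> on \<open>Dr\<close> is regarded as a path in the resolution from \<open>at_zero t\<close> to
  \<open>at_form t\<close>.\<close>

definition path_map :: "('a::comm_ring_1 Dr, 'a) mpol \<Rightarrow> ('a mod_I2, 'a) P1"
  where "path_map = mpol_eval Const (\<lambda>d. Var (Const (Dr_form d)) - Var (Const 0))"

lemma unital_ring_hom_path_map: "unital_ring_hom path_map"
  unfolding path_map_def by (rule unital_ring_hom.unital_ring_hom_mpol_eval[OF unital_ring_hom_Const])

lemma path_map_Const: "path_map (Const a) = Const a"
  and path_map_Var: "path_map (Var d) = Var (Const (Dr_form d)) - Var (Const 0)"
  by (simp_all add: path_map_def unital_ring_hom.mpol_eval_Const unital_ring_hom.mpol_eval_Var
    unital_ring_hom_Const)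

lemmas path_map_simps = path_map_Const path_map_Var
  unital_ring_hom.hom_add[OF unital_ring_hom_path_map] unital_ring_hom.hom_mult[OF unital_ring_hom_path_map]
  unital_ring_hom.hom_zero[OF unital_ring_hom_path_map] unital_ring_hom.hom_minus[OF unital_ring_hom_path_map]

lemma to_mod_I2_eq_iff: "to_mod_I2 a = to_mod_I2 b \<longleftrightarrow> a - b \<in> I2"
  by (simp add: mod_I2.abs_eq_iff I2_equiv_def)

lemma to_mod_I2_Dr_form: "to_mod_I2 (Dr_form d) = 0"
  by (simp add: to_mod_I2_eq_0_iff Dr_form_in_I2)

lemma to_mod_I2_at_form: "to_mod_I2 (at_form t) = to_mod_I2 (at_zero t)"
  by (simp add: to_mod_I2_eq_iff at_form_minus_at_zero_in_I2)

text \<open>The term \<open>Var (Const 0)\<close> subtracted in \<open>path_map\<close> is what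
  makes the second face vanish on a variable: there both terms become \<open>Var 0\<close>.\<close>

lemma face_path_map: "face1_0 (path_map t) = Const (at_form t)" "face1_1 (path_map t) = Const (at_zero t)"
  by (induction t rule: mpol_induct)
    (simp_all add: path_map_simps face_simps at_simps Const_simps to_mod_I2_Dr_form mod_I2.hom_zero)

lemma augmentation_path_map: "augmentation1 to_mod_I2 (path_map t) = to_mod_I2 (at_form t)"
  by (simp add: augmentation1_eq face_path_map face_simps)

lemma augmentation2_Var: "augmentation2 to_mod_I2 (Var p) = augmentation1 to_mod_I2 p"
  by (simp add: augmentation1_eq augmentation2_eq face_simps)

lemma chain_Var_Const: "chain (Var (Const a)) w = 0"
  using chain_face[of "Const a" w] by (simp add: chain_Const face_simps)

lemma chain_Var_zero: "chain (Var 0) w = 0"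
  using chain_Var_Const[of 0 w] by (simp add: Const_simps)

text \<open>This is \<open>chain_face\<close> at \<open>Var p + Var q\<close>, where
  \<open>chain\<close> itself is additive. The defect of additivity on variables thus depends only
  on the end points of \<open>p\<close> and \<open>q\<close>.\<close>

lemma chain_Var_plus:
  "chain (Var (p + q)) w = chain (Var p) w + chain (Var q) w
    + chain (Var (Var (face1_0 p) + Var (face1_0 q))) w - chain (Var (Var (face1_1 p) + Var (face1_1 q))) w"
  using chain_face[of "Var p + Var q" w] by (simp add: chain_plus face_simps algebra_simps)

lemma chain_Var_times:
  "chain (Var (p * q)) w = chain (Var q) (augmentation1 to_mod_I2 p * w)
    + chain (Var p) (augmentation1 to_mod_I2 q * w)
    + chain (Var (Var (face1_0 p) * Var (face1_0 q))) w - chain (Var (Var (face1_1 p) * Var (face1_1 q))) w"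
  using chain_face[of "Var p * Var q" w]
  by (simp add: chain_times augmentation2_Var face_simps algebra_simps)

text \<open>Adding the constant path 0 to \<open>Var u\<close> changes nothing, so the two
  correction terms agree, and the second sees only the class of \<open>u\<close> in A / I_2.\<close>

lemma chain_zero_plus:
  assumes "counit to_mod_I2 u = counit to_mod_I2 v"
  shows "chain (Var (Var 0 + Var u)) w = chain (Var (Var 0 + Var v)) w"
proof -
  have "chain (Var (Var 0 + Var u)) w = chain (Var (Var 0 + Var (Var (counit to_mod_I2 u)))) w" for u
    using chain_Var_plus[of "Const 0" "Var u" w]
    by (simp add: chain_Var_zero face_simps Const_simps)
  with assms show ?thesis
    by metis
qed

lemma chain_zero_times:
  assumes "counit to_mod_I2 u = counit to_mod_I2 v"
  shows "chain (Var (Var 0 * Var u)) w = chain (Var (Var 0 * Var v)) w"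
proof -
  have "chain (Var (Var 0 * Var u)) w = chain (Var (Var 0 * Var (Var (counit to_mod_I2 u)))) w" for u
    using chain_Var_times[of "Const 0" "Var u" w]
    by (simp add: face_simps Const_simps augmentation1_eq chain_zero_right chain_Var_zero)
  with assms show ?thesis
    by metis
qed

definition path_class :: "('a Dr, 'a) mpol \<Rightarrow> 'a mod_I2 \<Rightarrow> 'a::comm_ring_1 chain_class"
  where "path_class t w = chain (Var (path_map t)) w"

lemma path_class_plus:
  "path_class (t + t') w = path_class t w + path_class t' w
    + chain (Var (Var (Const (at_form t)) + Var (Const (at_form t')))) w
    - chain (Var (Var (Const (at_zero t)) + Var (Const (at_zero t')))) w"
  using chain_Var_plus[of "path_map t" "path_map t'" w]
  by (simp add: path_class_def path_map_simps face_path_map)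

lemma path_class_Const: "path_class (Const a) w = 0"
  by (simp add: path_class_def path_map_simps chain_Var_Const)

lemma path_class_zero: "path_class 0 w = 0"
  using path_class_Const[of 0 w] by (simp add: Const_simps)

text \<open>Both end points of a loop are 0, and those of \<open>t'\<close> agree modulo
  \<open>I2\<close>, so the correction terms cancel by \<open>chain_zero_plus\<close>.\<close>

lemma path_class_loop_plus:
  assumes "t \<in> loops"
  shows "path_class (t + t') w = path_class t w + path_class t' w"
  using assms chain_zero_plus[of "Const (at_form t')" "Const (at_zero t')" w]
  by (simp add: path_class_plus loops_iff face_simps Const_simps to_mod_I2_at_form)

text \<open>Both Leibniz terms vanish because \<open>u\<close> and \<open>v\<close> have
  augmentation 0 in A / I_2, and both correction terms reduce to the one for
  \<open>Var 0 * Var 0\<close>.\<close>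

lemma path_class_times:
  assumes "at_form u = 0" "at_zero v = 0"
  shows "path_class (u * v) w = 0"
proof -
  have v: "to_mod_I2 (at_form v) = 0" and u: "to_mod_I2 (at_zero u) = 0"
    using to_mod_I2_at_form[of u] to_mod_I2_at_form[of v] by (simp_all add: assms mod_I2.hom_zero)
  have "chain (Var (Var 0 * Var (Const (at_form v)))) w = chain (Var (Var 0 * Var 0)) w"
    by (rule chain_zero_times) (simp add: face_simps v)
  moreover have "chain (Var (Var (Const (at_zero u)) * Var 0)) w = chain (Var (Var 0 * Var 0)) w"
    unfolding mult.commute[of "Var (Const (at_zero u))"]
    by (rule chain_zero_times) (simp add: face_simps u)
  ultimately show ?thesis
    using chain_Var_times[of "path_map u" "path_map v" w]
    by (simp add: path_class_def path_map_simps face_path_map augmentation_path_map chain_zero_right Const_simps mod_I2.hom_zero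
      assms u v)
qed

lemma path_class_Const_times:
  assumes "t \<in> loops"
  shows "path_class (Const a * t) w = path_class t (to_mod_I2 a * w)"
  using assms chain_Var_Const[of a] chain_Var_times[of "Const a" "path_map t" w]
  by (simp add: path_class_def path_map_simps face_path_map loops_iff face_simps Const_simps augmentation1_eq)

lemma path_class_small_loops: "p \<in> small_loops \<Longrightarrow> path_class p w = 0"
proof (induction p rule: small_loops_induct)
  case (Const_mult a t)
  then have "to_mod_I2 a = 0"
    by (simp add: to_mod_I2_eq_0_iff)
  with Const_mult show ?case
    by (simp only: path_class_Const_times mult_zero_left) (simp add: path_class_def chain_zero_right)
qed (simp_all add: path_class_zero path_class_times path_class_loop_plus small_loops_subset_loops)

text \<open>The path \<open>s\<close> ends where \<open>r\<close> starts, and \<open>t\<close> joins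
  the outer vertices; the last polynomial is the loop around this triangle.\<close>

lemma path_class_triangle:
  assumes "at_zero t = at_zero s" "at_form s = at_zero r" "at_form t = at_form r"
  shows "path_class r w + path_class s w = path_class t w + path_class (r + s - t - Const (at_zero r)) w"
proof -
  let ?b = "at_zero r" and ?a = "at_zero s"
  let ?N = "\<lambda>a b. chain (Var (Var (Const a) + Var (Const b))) w"
  \<comment> \<open>Shifting \<open>s\<close> to end at 0 produces the same correction terms as
    adding the shifted path to \<open>r\<close>, up to the congruence \<open>N\<close>.\<close>
  have "path_class (Const ?b + (s - Const ?b)) w = path_class (s - Const ?b) w + ?N ?b 0 - ?N ?b (?a - ?b)"
    unfolding path_class_plus by (simp add: at_simps assms path_class_Const Const_simps)
  then have s: "path_class s w = path_class (s - Const ?b) w + ?N ?b 0 - ?N ?b (?a - ?b)"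
    by simp
  have N: "?N (at_form r) 0 = ?N ?b 0"
    using chain_zero_plus[of "Const (at_form r)" "Const ?b" w]
    by (simp add: face_simps to_mod_I2_at_form Const_simps add.commute[of "Var (Const _)"])
  have "path_class (r + (s - Const ?b)) w =
      path_class r w + path_class (s - Const ?b) w + ?N (at_form r) 0 - ?N ?b (?a - ?b)"
    unfolding path_class_plus by (simp add: at_simps assms Const_simps)
  then have "path_class r w + path_class s w = path_class (r + (s - Const ?b)) w"
    unfolding s N by (simp only: add_diff_eq add.assoc)
  also have "\<dots> = path_class ((r + s - t - Const ?b) + t) w"
    by (simp add: algebra_simps)
  also have "\<dots> = path_class (r + s - t - Const ?b) w + path_class t w"
    by (rule path_class_loop_plus) (simp add: loops_iff at_simps assms)
  finally show ?thesis
    by (simp only: add.commute)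
qed


section \<open>From chains to loops\<close>

lemma to_mod_I2_rep: "to_mod_I2 (rep_mod_I2 b) = b"
  by (rule Quotient3_abs_rep[OF Quotient3_mod_I2])

text \<open>The ring homomorphism freely extending the set-theoretic section of A to A / I_2; it
  plays the role of the vertex map.\<close>

definition sect :: "('a::comm_ring_1 mod_I2, 'a) P0 \<Rightarrow> 'a"
  where "sect = mpol_eval (\<lambda>a. a) rep_mod_I2"

lemma unital_ring_hom_sect: "unital_ring_hom sect"
  unfolding sect_def by (rule unital_ring_hom.unital_ring_hom_mpol_eval[OF unital_ring_hom_id])

lemma sect_Const: "sect (Const a) = a" and sect_Var: "sect (Var b) = rep_mod_I2 b"
  by (simp_all add: sect_def unital_ring_hom.mpol_eval_Const unital_ring_hom.mpol_eval_Var unital_ring_hom_id)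

lemmas sect_simps = sect_Const sect_Var
  unital_ring_hom.hom_add[OF unital_ring_hom_sect] unital_ring_hom.hom_mult[OF unital_ring_hom_sect]
  unital_ring_hom.hom_zero[OF unital_ring_hom_sect] unital_ring_hom.hom_minus[OF unital_ring_hom_sect]

lemma to_mod_I2_sect: "to_mod_I2 (sect p) = counit to_mod_I2 p"
  by (induction p rule: mpol_induct)
    (simp_all add: sect_simps face_simps mod_I2.hom_add mod_I2.hom_mult to_mod_I2_rep)

definition sect_gap :: "('a::comm_ring_1 mod_I2, 'a) P0 \<Rightarrow> 'a Dr"
  where "sect_gap p = Dr_of (sect p - rep_mod_I2 (counit to_mod_I2 p))"

lemma Dr_form_sect_gap: "Dr_form (sect_gap p) = sect p - rep_mod_I2 (counit to_mod_I2 p)"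
  unfolding sect_gap_def
  by (rule Dr_form_Dr_of) (simp add: to_mod_I2_sect to_mod_I2_rep flip: to_mod_I2_eq_iff)

text \<open>A variable \<open>p\<close> becomes the linear path from the representative of its class
  to \<open>sect p\<close>.\<close>

definition to_path :: "('a::comm_ring_1 mod_I2, 'a) P1 \<Rightarrow> ('a Dr, 'a) mpol"
  where "to_path = mpol_eval Const (\<lambda>p. Const (rep_mod_I2 (counit to_mod_I2 p)) + Var (sect_gap p))"

lemma unital_ring_hom_to_path: "unital_ring_hom to_path"
  unfolding to_path_def by (rule unital_ring_hom.unital_ring_hom_mpol_eval[OF unital_ring_hom_Const])

lemma to_path_Const: "to_path (Const a) = Const a"
  and to_path_Var: "to_path (Var p) = Const (rep_mod_I2 (counit to_mod_I2 p)) + Var (sect_gap p)"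
  by (simp_all add: to_path_def unital_ring_hom.mpol_eval_Const unital_ring_hom.mpol_eval_Var
    unital_ring_hom_Const)

lemmas to_path_simps = to_path_Const to_path_Var
  unital_ring_hom.hom_add[OF unital_ring_hom_to_path] unital_ring_hom.hom_mult[OF unital_ring_hom_to_path]
  unital_ring_hom.hom_zero[OF unital_ring_hom_to_path] unital_ring_hom.hom_minus[OF unital_ring_hom_to_path]

lemma at_to_path: "at_form (to_path p) = sect (face1_0 p)" "at_zero (to_path p) = sect (face1_1 p)"
  by (induction p rule: mpol_induct)
    (simp_all add: to_path_simps at_simps face_simps sect_simps Dr_form_sect_gap)

text \<open>The composite of \<open>to_path\<close> and \<open>path_map\<close> is homotopic to the identity; the homotopy consists
  of the maps \<open>lift_simplex\<close>, \<open>prism0\<close> and \<open>prism1\<close>.\<close>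

definition lift_simplex :: "('a::comm_ring_1 mod_I2, 'a) P0 \<Rightarrow> ('a mod_I2, 'a) P1"
  where "lift_simplex = mpol_map (\<lambda>b. Const (rep_mod_I2 b))"

definition prism0 :: "('a::comm_ring_1 mod_I2, 'a) P1 \<Rightarrow> ('a mod_I2, 'a) P2"
  where "prism0 = mpol_map (\<lambda>p. path_map (to_path (Var p)))"

definition prism1 :: "('a::comm_ring_1 mod_I2, 'a) P1 \<Rightarrow> ('a mod_I2, 'a) P2"
  where "prism1 = mpol_map lift_simplex"

lemma face_lift_simplex: "face1_0 (lift_simplex p) = Const (sect p)" "face1_1 (lift_simplex p) = p"
  by (induction p rule: mpol_induct)
    (simp_all add: lift_simplex_def face_simps sect_simps Const_simps to_mod_I2_rep)

text \<open>The prism over a 1-simplex is cut into two 2-simplices along a common middle face; its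
  remaining faces are \<open>p\<close>, the path replacing it, and the lifts of the two end
  points.\<close>

lemma face_prism0:
  "face2_0 (prism0 p) = path_map (to_path p)"
  "face2_2 (prism0 p) = lift_simplex (face1_1 p)"
  and face_prism1:
  "face2_0 (prism1 p) = lift_simplex (face1_0 p)"
  "face2_2 (prism1 p) = p"
  and face_prism: "face2_1 (prism0 p) = face2_1 (prism1 p)"
  by (induction p rule: mpol_induct)
    (simp_all add: prism0_def prism1_def lift_simplex_def[symmetric] face_simps face_lift_simplex face_path_map
      path_map_simps to_path_simps at_to_path at_simps sect_simps Dr_form_sect_gap Const_simps
      mod_I2.hom_minus to_mod_I2_sect to_mod_I2_rep,
     simp_all add: lift_simplex_def face_simps)

text \<open>The edges of a triangle are added with signs; the constant subtracted is the vertex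
  where the edge \<open>face2_2 P\<close> ends and \<open>face2_0 P\<close> starts, which makes the
  sum a loop.\<close>

definition loop_of :: "('a::comm_ring_1 mod_I2, 'a) P2 \<Rightarrow> ('a Dr, 'a) mpol"
  where "loop_of P = to_path (face2_0 P) - to_path (face2_1 P) + to_path (face2_2 P)
    - Const (sect (face1_1 (face2_0 P)))"

lemma loop_of_in_loops: "loop_of P \<in> loops"
  by (simp add: loop_of_def loops_iff at_simps at_to_path face1_face2)

text \<open>The homotopy formula. \<open>chain_face\<close> at the two halves of the prism makes the
  diagonal and the lifts cancel, and \<open>path_class_triangle\<close> gathers the three remaining
  paths into one loop.\<close>

lemma chain_Var_eq_loop:
  "chain (Var p) w =
    abs_chain_class (push prism1 (boundary (faces2 to_mod_I2) (Poly_Mapping.single (Var p) w)))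
    - abs_chain_class (push prism0 (boundary (faces2 to_mod_I2) (Poly_Mapping.single (Var p) w)))
    + path_class (loop_of (Var p)) w"
proof -
  have prism_Var: "prism1 (Var q) = Var (lift_simplex q)" "prism0 (Var q) = Var (path_map (to_path (Var q)))" for q
    by (simp_all add: prism1_def prism0_def face_simps)
  have 1: "abs_chain_class (push prism1 (boundary (faces2 to_mod_I2) (Poly_Mapping.single (Var p) w))) =
      chain (prism1 p) w - chain (Var (lift_simplex (face1_0 p))) w + chain (Var (lift_simplex (face1_1 p))) w"
    by (simp add: boundary_faces2 push_single push_diff push_add abs_chain_class_add abs_chain_class_diff
      face_simps prism_Var flip: chain_def)
  have 0: "abs_chain_class (push prism0 (boundary (faces2 to_mod_I2) (Poly_Mapping.single (Var p) w))) =
      chain (prism0 p) w - path_class (to_path (Var (face1_0 p))) w + path_class (to_path (Var (face1_1 p))) w"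
    by (simp add: boundary_faces2 push_single push_diff push_add abs_chain_class_add abs_chain_class_diff
      face_simps prism_Var path_class_def flip: chain_def)
  have "path_class (to_path p) w + path_class (to_path (Var (face1_1 p))) w =
      path_class (to_path (Var (face1_0 p))) w + path_class (loop_of (Var p)) w"
    using path_class_triangle[of "to_path (Var (face1_0 p))" "to_path (Var (face1_1 p))" "to_path p" w]
    by (simp add: at_to_path face_simps augmentation_face1 loop_of_def algebra_simps)
  then have Y: "path_class (loop_of (Var p)) w = path_class (to_path p) w +
      path_class (to_path (Var (face1_1 p))) w - path_class (to_path (Var (face1_0 p))) w"
    by (simp add: algebra_simps)
  have K0: "chain (prism0 p) w = path_class (to_path p) w - chain (Var (face2_1 (prism1 p))) w
      + chain (Var (lift_simplex (face1_1 p))) w"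
    using chain_face[of "prism0 p" w] by (simp add: face_prism0 face_prism path_class_def)
  have K1: "chain (prism1 p) w = chain (Var (lift_simplex (face1_0 p))) w
      - chain (Var (face2_1 (prism1 p))) w + chain (Var p) w"
    using chain_face[of "prism1 p" w] by (simp add: face_prism1)
  show ?thesis
    unfolding 0 1 Y K0 K1 by simp
qed

section \<open>Linear coefficients and the reduction of cycles to quadratic loops\<close>

lemma lookup_Const_unit_mon: "lookup (Const a) (unit_mon d) = 0"
proof -
  have "unit_mon d \<noteq> 0"
  proof
    assume "unit_mon d = 0"
    from arg_cong[OF this, of mon_degree] show False
      unfolding mon_degree_unit by (simp add: mon_degree_def)
  qed
  then show ?thesis
    by (simp add: Const_def lookup_single del: One_nat_def)
qed

text \<open>Taking the coefficient of a variable is a derivation relative to the constant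
  term.\<close>

lemma lookup_mult_unit_mon:
  fixes p q :: "('a::{idom, ring_char_0} Dr, 'a) mpol"
  shows "lookup (p * q) (unit_mon d) = lookup p 0 * lookup q (unit_mon d) + lookup p (unit_mon d) * lookup q 0"
proof (induction p arbitrary: q rule: mpol_induct)
  case (Const a)
  show ?case
    using at_zero_Const[of a]
    by (simp add: lookup_Const_mult at_zero_eq_lookup lookup_Const_unit_mon del: One_nat_def)
next
  case (Var e)
  have "lookup (Var e :: ('a Dr, 'a) mpol) (unit_mon d) = (if e = d then 1 else 0)"
    using lookup_Var_mult_unit[of e "1 :: ('a Dr, 'a) mpol" d]
    by (simp add: at_simps del: One_nat_def flip: at_zero_eq_lookup)
  then show ?case
    using at_zero_Var[of e]
    by (simp add: lookup_Var_mult_unit at_zero_eq_lookup del: One_nat_def)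
next
  case (mult p p')
  have "lookup (p * p' * q) (unit_mon d) =
      lookup p 0 * lookup (p' * q) (unit_mon d) + lookup p (unit_mon d) * lookup (p' * q) 0"
    unfolding mult.assoc by (rule mult.IH(1))
  moreover have "lookup (p' * q) 0 = lookup p' 0 * lookup q 0" "lookup (p * p') 0 = lookup p 0 * lookup p' 0"
    by (simp_all add: at_simps flip: at_zero_eq_lookup)
  ultimately show ?case
    unfolding mult.IH by (simp add: algebra_simps)
qed (simp add: lookup_add distrib_right)

text \<open>The functional induced by the derivation just described; by
  \<open>linear_part_kr\<close> it descends to the 1-chains, so it vanishes on the boundary of a
  cycle.\<close>

definition linear_part ::
    "'a::comm_ring_1 Dr \<Rightarrow> (('a mod_I2, 'a) P1 \<Rightarrow>\<^sub>0 'a mod_I2) \<Rightarrow> 'a mod_I2"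
  where "linear_part d u = (\<Sum>p\<in>keys u. lookup u p * to_mod_I2 (lookup (to_path p) (unit_mon d)))"

lemma linear_part_superset:
  assumes "finite S" "keys u \<subseteq> S"
  shows "linear_part d u = (\<Sum>p\<in>S. lookup u p * to_mod_I2 (lookup (to_path p) (unit_mon d)))"
  unfolding linear_part_def by (rule sum.mono_neutral_left) (use assms in \<open>auto simp: in_keys_iff\<close>)

lemma linear_part_add: "linear_part d (u + v) = linear_part d u + linear_part d v"
proof -
  let ?S = "keys u \<union> keys v"
  have "linear_part d (u + v) = (\<Sum>p\<in>?S. lookup (u + v) p * to_mod_I2 (lookup (to_path p) (unit_mon d)))"
    by (intro linear_part_superset) (auto dest: keys_add[THEN subsetD])
  then show ?thesis
    by (simp add: linear_part_superset[of ?S] lookup_add distrib_right sum.distrib)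
qed

lemma linear_part_zero: "linear_part d 0 = 0"
  by (simp add: linear_part_def)

lemma linear_part_diff: "linear_part d (u - v) = linear_part d u - linear_part d v"
  using linear_part_add[of d "u - v" v] by simp

lemma linear_part_single:
  "linear_part d (Poly_Mapping.single p w) = w * to_mod_I2 (lookup (to_path p) (unit_mon d))"
  by (simp add: linear_part_superset[of "{p}"])

lemma to_mod_I2_lookup_to_path: "to_mod_I2 (lookup (to_path p) 0) = augmentation1 to_mod_I2 p"
  by (simp add: at_to_path to_mod_I2_sect augmentation_face1 augmentation1_eq flip: at_zero_eq_lookup)

lemma linear_part_kr:
  fixes v :: "('a::{idom, ring_char_0} mod_I2, 'a) P1 \<Rightarrow>\<^sub>0 'a mod_I2"
  assumes "v \<in> mod_I2.kr Const (augmentation1 to_mod_I2)"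
  shows "linear_part d v = 0"
  using assms
proof (induction v rule: mod_I2.kr_induct)
  case (times p q w)
  show ?case
    by (simp add: linear_part_diff linear_part_add linear_part_single to_path_simps lookup_mult_unit_mon mod_I2.hom_add
      mod_I2.hom_mult to_mod_I2_lookup_to_path algebra_simps del: One_nat_def)
qed (simp_all add: linear_part_zero linear_part_diff linear_part_single linear_part_add to_path_simps lookup_add
  mod_I2.hom_add mod_I2.hom_zero lookup_Const_unit_mon algebra_simps del: One_nat_def)

lemma push_Var_eq_loop:
  fixes v :: "('a::{idom, ring_char_0} mod_I2, 'a) P1 \<Rightarrow>\<^sub>0 'a mod_I2"
  defines "bd \<equiv> boundary (faces2 to_mod_I2)"
  shows "\<exists>t\<in>loops. abs_chain_class (push Var v) =
      abs_chain_class (push prism1 (bd (push Var v))) - abs_chain_class (push prism0 (bd (push Var v)))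
      + path_class t 1 \<and>
    (\<forall>d. to_mod_I2 (lookup t (unit_mon d)) = linear_part d (bd (push Var v)))"
proof (induction v rule: poly_mapping_additive_induct)
  case zero
  show ?case
    by (intro bexI[of _ 0])
      (simp_all add: push_zero bd_def boundary_zero path_class_zero linear_part_zero mod_I2.hom_zero loops_zero
        flip: zero_chain_class_def)
next
  case (single p w)
  \<comment> \<open>The coefficient is absorbed into the loop by lifting it to A. The constant
    inside \<open>loop_of\<close> has no linear part, so the linear coefficients are those of the
    boundary.\<close>
  let ?t = "Const (rep_mod_I2 w) * loop_of (Var p)"
  have "path_class ?t 1 = path_class (loop_of (Var p)) w"
    by (simp add: path_class_Const_times[OF loop_of_in_loops] to_mod_I2_rep mult.commute[of w 1])
  moreover have "to_mod_I2 (lookup ?t (unit_mon d)) = linear_part d (bd (Poly_Mapping.single (Var p) w))" for d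
    by (simp add: lookup_Const_mult mod_I2.hom_mult to_mod_I2_rep bd_def boundary_faces2 push_single face_simps
      linear_part_add linear_part_diff linear_part_single loop_of_def lookup_add lookup_minus
      lookup_Const_unit_mon mod_I2.hom_add mod_I2.hom_minus mod_I2.hom_zero right_diff_distrib distrib_left
      del: One_nat_def)
  ultimately show ?case
    using chain_Var_eq_loop[of p w] unfolding push_single bd_def chain_def
    by (intro bexI[of _ ?t]) (simp_all add: loops_mult loop_of_in_loops)
next
  case (add u v)
  then obtain s t where s: "s \<in> loops"
      "abs_chain_class (push Var u) = abs_chain_class (push prism1 (bd (push Var u)))
        - abs_chain_class (push prism0 (bd (push Var u))) + path_class s 1"
      "\<And>d. to_mod_I2 (lookup s (unit_mon d)) = linear_part d (bd (push Var u))"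
    and t: "t \<in> loops"
      "abs_chain_class (push Var v) = abs_chain_class (push prism1 (bd (push Var v)))
        - abs_chain_class (push prism0 (bd (push Var v))) + path_class t 1"
      "\<And>d. to_mod_I2 (lookup t (unit_mon d)) = linear_part d (bd (push Var v))"
    by blast
  have "to_mod_I2 (lookup (s + t) (unit_mon d)) = linear_part d (bd (push Var (u + v)))" for d
    using s(3)[of d] t(3)[of d]
    by (simp only: lookup_add mod_I2.hom_add push_add bd_def boundary_add linear_part_add)
  moreover have "abs_chain_class (push Var (u + v)) = abs_chain_class (push prism1 (bd (push Var (u + v))))
        - abs_chain_class (push prism0 (bd (push Var (u + v)))) + path_class (s + t) 1"
    unfolding push_add bd_def boundary_add abs_chain_class_add path_class_loop_plus[OF s(1)]
    unfolding s(2)[unfolded bd_def] t(2)[unfolded bd_def] by (simp add: algebra_simps)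
  ultimately show ?case
    using loops_add[OF s(1) t(1)] by blast
qed

context unital_ring_hom
begin

text \<open>Differentials of a polynomial ring are generated by those of the variables, which is
  where the homotopy formula is available.\<close>

lemma ex_push_Var:
  fixes z :: "('x, 'a) mpol \<Rightarrow>\<^sub>0 'b"
  shows "\<exists>v. z - push Var v \<in> kr Const \<epsilon>"
proof (induction z rule: poly_mapping_additive_induct)
  case zero
  show ?case
    by (rule exI[of _ 0]) (simp add: push_zero kr_zero)
next
  case (single P w)
  show ?case
  proof (induction P arbitrary: w rule: mpol_induct)
    case (Const a)
    show ?case
      by (rule exI[of _ 0]) (simp add: push_zero kr_const)
  next
    case (Var x)
    show ?case
      by (rule exI[of _ "Poly_Mapping.single x w"]) (simp add: push_single kr_zero)
  next
    case (add p q)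
    obtain u v where "Poly_Mapping.single p w - push Var u \<in> kr Const \<epsilon>"
      "Poly_Mapping.single q w - push Var v \<in> kr Const \<epsilon>"
      using add by blast
    from kr_add[OF kr_plus[of p q w] kr_add[OF this]] show ?case
      by (intro exI[of _ "u + v"]) (simp add: push_add algebra_simps)
  next
    case (mult p q)
    obtain u v where "Poly_Mapping.single q (\<epsilon> p * w) - push Var u \<in> kr Const \<epsilon>"
      "Poly_Mapping.single p (\<epsilon> q * w) - push Var v \<in> kr Const \<epsilon>"
      using mult by blast
    from kr_add[OF kr_times[of p q w] kr_add[OF this]] show ?case
      by (intro exI[of _ "u + v"]) (simp add: push_add algebra_simps)
  qed
next
  case (add y z)
  then obtain u v where "y - push Var u \<in> kr Const \<epsilon>" "z - push Var v \<in> kr Const \<epsilon>"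
    by blast
  from kr_add[OF this] show ?case
    by (intro exI[of _ "u + v"]) (simp add: push_add algebra_simps)
qed

end

lemma boundary_faces2_kr:
  assumes "k \<in> mod_I2.kr Const (augmentation2 to_mod_I2)"
  shows "boundary (faces2 to_mod_I2) k \<in> mod_I2.kr Const (augmentation1 to_mod_I2)"
proof -
  have "push face2_0 k \<in> mod_I2.kr Const (augmentation1 to_mod_I2)"
    "push face2_1 k \<in> mod_I2.kr Const (augmentation1 to_mod_I2)"
    "push face2_2 k \<in> mod_I2.kr Const (augmentation1 to_mod_I2)"
    by (rule mod_I2.push_kr[OF _ _ _ _ assms];
      simp add: face_simps augmentation1_eq augmentation2_eq face1_face2 augmentation_face1)+
  then show ?thesis
    unfolding boundary_faces2 by (intro mod_I2.kr_add mod_I2.kr_diff)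
qed

text \<open>Both halves of the prism are maps of augmented A-algebras, so the homotopy is defined on
  differentials.\<close>

lemma push_prism_kr:
  assumes "k \<in> mod_I2.kr Const (augmentation1 to_mod_I2)"
  shows "push prism0 k \<in> boundaries2" "push prism1 k \<in> boundaries2"
proof -
  have "augmentation2 to_mod_I2 (prism0 p) = augmentation1 to_mod_I2 p"
    "augmentation2 to_mod_I2 (prism1 p) = augmentation1 to_mod_I2 p" for p :: "('a mod_I2, 'a) P1"
    by (simp_all add: augmentation1_eq augmentation2_eq face_prism0 face_prism1 face_path_map face_lift_simplex
      face_simps at_to_path to_mod_I2_sect)
  then show "push prism0 k \<in> boundaries2" "push prism1 k \<in> boundaries2"
    by (intro kr_subset_boundaries2 mod_I2.push_kr[OF _ _ _ _ assms];
      simp add: prism0_def prism1_def face_simps)+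
qed

abbreviation cycles2 :: "(('a::comm_ring_1 mod_I2, 'a) P2 \<Rightarrow>\<^sub>0 'a mod_I2) set"
  where "cycles2 \<equiv> AQ_cycles2 to_mod_I2 (*)"

lemma cycle_eq_quadratic_loop:
  fixes z :: "('a::{idom, ring_char_0} mod_I2, 'a) P2 \<Rightarrow>\<^sub>0 'a mod_I2"
  assumes "z \<in> cycles2"
  shows "\<exists>p\<in>quadratic. at_form p = 0 \<and> abs_chain_class z = path_class p 1"
proof -
  let ?bd = "boundary (faces2 to_mod_I2)"
  obtain v where v: "z - push Var v \<in> mod_I2.kr Const (augmentation2 to_mod_I2)"
    using mod_I2.ex_push_Var by blast
  have "?bd z \<in> mod_I2.kr Const (augmentation1 to_mod_I2)"
    using assms by (simp add: AQ_cycles2_def)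
  from mod_I2.kr_diff[OF this boundary_faces2_kr[OF v]]
  have bd: "?bd (push Var v) \<in> mod_I2.kr Const (augmentation1 to_mod_I2)"
    by (simp add: boundary_diff)
  \<comment> \<open>The boundary being a Kaehler relation, both prism terms and the linear part
    disappear from \<open>push_Var_eq_loop\<close>.\<close>
  obtain t where t: "t \<in> loops" "abs_chain_class (push Var v) = path_class t 1"
    "\<And>d. to_mod_I2 (lookup t (unit_mon d)) = 0"
    using push_Var_eq_loop[of v] push_prism_kr[OF bd] linear_part_kr[OF bd]
    by (auto simp: abs_chain_class_eq_0_iff[symmetric])
  have "t \<in> linear_in_I2"
    using t(3) by (simp add: linear_in_I2_def flip: to_mod_I2_eq_0_iff)
  then obtain p where p: "p \<in> quadratic" "t - p \<in> small_loops"
    using eq_quadratic_mod_small_loops t(1) by (metis loops_iff)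
  have "p \<in> loops"
    using loops_diff[OF t(1) small_loops_subset_loops[OF p(2)]] by simp
  moreover have "path_class t 1 = path_class (t - p) 1 + path_class p 1"
    using path_class_loop_plus[OF small_loops_subset_loops[OF p(2)], of p 1] by simp
  moreover have "abs_chain_class z = abs_chain_class (push Var v)"
    using kr_subset_boundaries2[OF v] by (simp add: abs_chain_class_diff flip: abs_chain_class_eq_0_iff)
  ultimately show ?thesis
    using p t(2) by (intro bexI[of _ p]) (simp_all add: path_class_small_loops loops_iff)
qed

lemma quadratic_at_zero: "p \<in> quadratic \<Longrightarrow> at_zero p = 0"
  by (induction p rule: quadratic_induct) (simp_all add: at_simps)

text \<open>The faces other than \<open>path_map p\<close> cancel, and the differential of
  \<open>path_map p\<close> vanishes because a quadratic polynomial is a sum of products of elements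
  of augmentation 0.\<close>

lemma quadratic_loop_is_cycle:
  assumes "p \<in> quadratic" "at_form p = 0"
  shows "Poly_Mapping.single (Var (path_map p)) 1 \<in> cycles2"
proof -
  have times: "Poly_Mapping.single (u * v) w \<in> mod_I2.kr Const (augmentation1 to_mod_I2)"
    if "augmentation1 to_mod_I2 u = 0" "augmentation1 to_mod_I2 v = 0"
    for u v :: "('a mod_I2, 'a) P1" and w
    using mod_I2.kr_times[of u v w "augmentation1 to_mod_I2" Const] that by simp
  have "Poly_Mapping.single (path_map p) w \<in> mod_I2.kr Const (augmentation1 to_mod_I2)" for w
    using assms(1)
  proof (induction p rule: quadratic_induct)
    case zero
    show ?case
      using mod_I2.kr_const[of Const 0] by (simp add: path_map_simps Const_simps)
  next
    case (monomial c d e)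
    have "augmentation1 to_mod_I2 (path_map (Const c * Var d)) = 0"
      "augmentation1 to_mod_I2 (path_map (Var e)) = 0"
      by (simp_all only: augmentation_path_map at_simps mod_I2.hom_mult to_mod_I2_Dr_form mult_zero_right)
    from times[OF this, of w] show ?case
      by (simp only: path_map_simps mult.assoc)
  next
    case (add p q)
    show ?case
      using mod_I2.kr_add[OF mod_I2.kr_plus[of "path_map p" "path_map q" w] mod_I2.kr_add[OF add]]
      by (simp add: path_map_simps)
  qed
  then show ?thesis
    by (simp add: AQ_cycles2_def boundary_faces2 push_single face_simps face_path_map assms quadratic_at_zero)
qed


section \<open>Small loops and boundaries\<close>

text \<open>Representatives are not additive, but changing one by an element of \<open>I2\<close>
  alters the sum by a small loop; the construction is meaningful modulo
  \<open>small_loops\<close>.\<close>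

definition loop_sum :: "(('a::comm_ring_1 mod_I2, 'a) P2 \<Rightarrow>\<^sub>0 'a mod_I2) \<Rightarrow> ('a Dr, 'a) mpol"
  where "loop_sum z = (\<Sum>P\<in>keys z. Const (rep_mod_I2 (lookup z P)) * loop_of P)"

lemma Const_loop_of_small: "to_mod_I2 a = 0 \<Longrightarrow> Const a * loop_of P \<in> small_loops"
  by (intro small_loops_Const_mult loop_of_in_loops) (simp add: to_mod_I2_eq_0_iff)

lemma small_loops_sum: "(\<And>x. x \<in> S \<Longrightarrow> f x \<in> small_loops) \<Longrightarrow> sum f S \<in> small_loops"
  by (induction S rule: infinite_finite_induct) (simp_all add: small_loops_zero small_loops_add)

text \<open>Indices outside the support may contribute since \<open>rep_mod_I2 0\<close> need not be
  0, but it lies in \<open>I2\<close>.\<close>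

lemma loop_sum_superset:
  assumes "finite S" "keys z \<subseteq> S"
  shows "(\<Sum>P\<in>S. Const (rep_mod_I2 (lookup z P)) * loop_of P) - loop_sum z \<in> small_loops"
proof -
  have "(\<Sum>P\<in>S. Const (rep_mod_I2 (lookup z P)) * loop_of P) - loop_sum z =
      (\<Sum>P\<in>S - keys z. Const (rep_mod_I2 (lookup z P)) * loop_of P)"
    unfolding loop_sum_def using assms by (simp add: sum_diff)
  also have "\<dots> \<in> small_loops"
    by (intro small_loops_sum Const_loop_of_small) (simp add: to_mod_I2_rep in_keys_iff)
  finally show ?thesis .
qed

lemma loop_sum_add: "loop_sum (u + v) - (loop_sum u + loop_sum v) \<in> small_loops"
proof -
  let ?S = "keys u \<union> keys v"
  let ?sum = "\<lambda>z. \<Sum>P\<in>?S. Const (rep_mod_I2 (lookup z P)) * loop_of P"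
  have uv: "?sum (u + v) - loop_sum (u + v) \<in> small_loops"
    by (rule loop_sum_superset) (use keys_add[of u v] in auto)
  have u: "?sum u - loop_sum u \<in> small_loops" and v: "?sum v - loop_sum v \<in> small_loops"
    by (rule loop_sum_superset; auto)+
  let ?c = "\<lambda>P. rep_mod_I2 (lookup (u + v) P) - rep_mod_I2 (lookup u P) - rep_mod_I2 (lookup v P)"
  have "?sum (u + v) - ?sum u - ?sum v = (\<Sum>P\<in>?S. Const (?c P) * loop_of P)"
    by (simp add: Const_simps left_diff_distrib sum_subtractf)
  also have "\<dots> \<in> small_loops"
    by (intro small_loops_sum Const_loop_of_small) (simp add: mod_I2.hom_minus to_mod_I2_rep lookup_add)
  finally have "?sum (u + v) - ?sum u - ?sum v \<in> small_loops" .
  from small_loops_add[OF small_loops_diff[OF this uv] small_loops_add[OF u v]] show ?thesis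
    by (simp add: algebra_simps)
qed

lemma loop_sum_in_small_loops_add:
  "loop_sum u \<in> small_loops \<Longrightarrow> loop_sum v \<in> small_loops \<Longrightarrow> loop_sum (u + v) \<in> small_loops"
  using small_loops_add[OF loop_sum_add[of u v] small_loops_add[of "loop_sum u" "loop_sum v"]] by simp

lemma loop_sum_zero: "loop_sum 0 = 0"
  by (simp add: loop_sum_def)

lemma loop_sum_single:
  assumes "to_mod_I2 a = w"
  shows "loop_sum (Poly_Mapping.single P w) - Const a * loop_of P \<in> small_loops"
proof -
  have "(\<Sum>Q\<in>{P}. Const (rep_mod_I2 (lookup (Poly_Mapping.single P w) Q)) * loop_of Q)
      - loop_sum (Poly_Mapping.single P w) \<in> small_loops"
    by (rule loop_sum_superset) auto
  then have 1: "Const (rep_mod_I2 w) * loop_of P - loop_sum (Poly_Mapping.single P w) \<in> small_loops"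
    by simp
  have 2: "Const (rep_mod_I2 w - a) * loop_of P \<in> small_loops"
    by (rule Const_loop_of_small) (simp add: mod_I2.hom_minus to_mod_I2_rep assms)
  from small_loops_diff[OF 2 1] show ?thesis
    by (simp add: Const_simps algebra_simps)
qed

lemma loop_sum_add_cong:
  "loop_sum u - s \<in> small_loops \<Longrightarrow> loop_sum v - t \<in> small_loops \<Longrightarrow> loop_sum (u + v) - (s + t) \<in> small_loops"
  using small_loops_add[OF loop_sum_add[of u v] small_loops_add[of "loop_sum u - s" "loop_sum v - t"]]
  by (simp add: algebra_simps)

lemma loop_sum_diff_cong:
  assumes "loop_sum u - s \<in> small_loops" "loop_sum v - t \<in> small_loops"
  shows "loop_sum (u - v) - (s - t) \<in> small_loops"
proof -
  have "loop_sum u - (loop_sum (u - v) + loop_sum v) \<in> small_loops"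
    using loop_sum_add[of "u - v" v] by simp
  from small_loops_diff[OF small_loops_diff[OF assms] this] show ?thesis
    by (simp add: algebra_simps)
qed

lemma loop_of_plus: "loop_of (P + Q) = loop_of P + loop_of Q"
  by (simp add: loop_of_def face_simps to_path_simps sect_simps Const_simps)

lemma loop_of_Const: "loop_of (Const a) = 0"
  by (simp add: loop_of_def face_simps to_path_simps sect_simps)

text \<open>Modulo small loops, \<open>loop_of\<close> is a derivation, which is the Leibniz
  relation needed in \<open>loop_sum_kr\<close>.\<close>

lemma loop_of_times:
  assumes "to_mod_I2 a = augmentation2 to_mod_I2 P" "to_mod_I2 b = augmentation2 to_mod_I2 Q"
  shows "loop_of (P * Q) - (Const a * loop_of Q + Const b * loop_of P) \<in> small_loops"
proof -
  let ?d0 = "\<lambda>P. to_path (face2_0 P)" and ?d1 = "\<lambda>P. to_path (face2_1 P)" and ?d2 = "\<lambda>P. to_path (face2_2 P)"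
  let ?v = "\<lambda>P. Const (sect (face1_1 (face2_0 P)))"
  let ?m = "?d0 P + ?d2 P - ?v P"
  have "loop_of (P * Q) = (?d0 P * ?d0 Q - ?d1 P * ?d1 Q + ?d2 P * ?d2 Q - ?v P * ?v Q)"
    by (simp add: loop_of_def face_simps to_path_simps sect_simps Const_simps)
  \<comment> \<open>Here \<open>?m P\<close> is the middle edge plus the loop. The two products
    subtracted are small: the edge \<open>?d2\<close> ends and \<open>?d0\<close> starts at the
    vertex \<open>?v\<close>.\<close>
  then have eq: "loop_of (P * Q) = ?m * loop_of Q + ?d1 Q * loop_of P
      - (?d2 P - ?v P) * (?d0 Q - ?v Q) - (?d2 Q - ?v Q) * (?d0 P - ?v P)"
    by (simp add: loop_of_def algebra_simps)
  have small: "(?d2 P - ?v P) * (?d0 Q - ?v Q) \<in> small_loops" for P Q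
    by (rule small_loops_times) (simp_all add: at_simps at_to_path face1_face2)
  have 1: "?m * loop_of Q - Const a * loop_of Q \<in> small_loops"
    by (intro mult_loop_cong loop_of_in_loops)
      (simp add: at_simps at_to_path face1_face2 to_mod_I2_sect assms augmentation2_eq flip: to_mod_I2_eq_iff)
  have 2: "?d1 Q * loop_of P - Const b * loop_of P \<in> small_loops"
    by (intro mult_loop_cong loop_of_in_loops)
      (simp add: at_simps at_to_path face1_face2 to_mod_I2_sect assms augmentation2_eq flip: to_mod_I2_eq_iff)
  have "loop_of (P * Q) - (Const a * loop_of Q + Const b * loop_of P) =
      (?m * loop_of Q - Const a * loop_of Q) + (?d1 Q * loop_of P - Const b * loop_of P)
      - (?d2 P - ?v P) * (?d0 Q - ?v Q) - (?d2 Q - ?v Q) * (?d0 P - ?v P)"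
    unfolding eq by simp
  also have "\<dots> \<in> small_loops"
    by (intro small_loops_diff[OF small_loops_diff] small_loops_add 1 2 small)
  finally show ?thesis .
qed

lemma loop_sum_kr:
  assumes "v \<in> mod_I2.kr Const (augmentation2 to_mod_I2)"
  shows "loop_sum v \<in> small_loops"
  using assms
proof (induction v rule: mod_I2.kr_induct)
  case zero
  show ?case
    by (simp add: loop_sum_zero small_loops_zero)
next
  case (plus P Q w)
  have "loop_sum (Poly_Mapping.single R w) - Const (rep_mod_I2 w) * loop_of R \<in> small_loops"
    for R :: "('a mod_I2, 'a) P2"
    by (rule loop_sum_single) (rule to_mod_I2_rep)
  from loop_sum_diff_cong[OF loop_sum_diff_cong[OF this[of "P + Q"] this[of P]] this[of Q]] show ?case
    by (simp add: loop_of_plus algebra_simps)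
next
  case (times P Q w)
  let ?a = "rep_mod_I2 (augmentation2 to_mod_I2 P)" and ?b = "rep_mod_I2 (augmentation2 to_mod_I2 Q)"
  let ?c = "rep_mod_I2 w"
  have "loop_sum (Poly_Mapping.single (P * Q) w) - Const ?c * loop_of (P * Q) \<in> small_loops"
    "loop_sum (Poly_Mapping.single Q (augmentation2 to_mod_I2 P * w)) - Const (?a * ?c) * loop_of Q \<in> small_loops"
    "loop_sum (Poly_Mapping.single P (augmentation2 to_mod_I2 Q * w)) - Const (?b * ?c) * loop_of P \<in> small_loops"
    by (rule loop_sum_single; simp add: to_mod_I2_rep mod_I2.hom_mult)+
  from small_loops_add[OF loop_sum_diff_cong[OF loop_sum_diff_cong[OF this(1,2)] this(3)]
    small_loops_mult[OF loop_of_times[of ?a P ?b Q, OF to_mod_I2_rep to_mod_I2_rep], of "Const ?c"]]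
  show ?case
    by (simp add: Const_simps algebra_simps)
next
  case (const a w)
  have "loop_sum (Poly_Mapping.single (Const a) w) - Const (rep_mod_I2 w) * loop_of (Const a) \<in> small_loops"
    by (rule loop_sum_single) (rule to_mod_I2_rep)
  then show ?case
    by (simp add: loop_of_Const)
next
  case (add u v)
  then show ?case
    by (rule loop_sum_in_small_loops_add)
qed

text \<open>By the simplicial identities the edges of a tetrahedron cancel in pairs, and so do the
  vertices subtracted.\<close>

lemma loop_of_face3: "loop_of (face3_0 y) - loop_of (face3_1 y) + loop_of (face3_2 y) - loop_of (face3_3 y) = 0"
  by (simp add: loop_of_def face2_face3 face1_face2 algebra_simps)

lemma loop_sum_boundary: "loop_sum (boundary (faces3 to_mod_I2) y) \<in> small_loops"
proof (induction y rule: poly_mapping_additive_induct)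
  case zero
  show ?case
    by (simp add: boundary_zero loop_sum_zero small_loops_zero)
next
  case (single y w)
  have *: "loop_sum (Poly_Mapping.single R w) - Const (rep_mod_I2 w) * loop_of R \<in> small_loops"
    for R :: "('a mod_I2, 'a) P2"
    by (rule loop_sum_single) (rule to_mod_I2_rep)
  have "loop_sum (boundary (faces3 to_mod_I2) (Poly_Mapping.single y w)) -
      Const (rep_mod_I2 w) * (loop_of (face3_0 y) - loop_of (face3_1 y) + loop_of (face3_2 y) - loop_of (face3_3 y))
      \<in> small_loops"
    unfolding boundary_faces3 push_single right_diff_distrib distrib_left
    by (intro loop_sum_diff_cong loop_sum_add_cong *)
  then show ?case
    by (simp add: loop_of_face3)
next
  case (add y z)
  then show ?case
    by (simp add: boundary_add loop_sum_in_small_loops_add)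
qed

lemma loop_sum_boundaries2:
  assumes "z \<in> boundaries2"
  shows "loop_sum z \<in> small_loops"
proof -
  obtain n y where "n \<in> mod_I2.kr Const (augmentation2 to_mod_I2)" "z = n + boundary (faces3 to_mod_I2) y"
    using assms unfolding AQ_boundaries2_def by blast
  with loop_sum_in_small_loops_add[OF loop_sum_kr loop_sum_boundary] show ?thesis
    by blast
qed

text \<open>For a variable the difference is a loop, in general not small; in a product it is
  multiplied by a path with form in \<open>I2\<close> and becomes small.\<close>

lemma to_path_path_map:
  assumes "p \<in> quadratic"
  shows "to_path (path_map p) - p \<in> small_loops"
  using assms
proof (induction p rule: quadratic_induct)
  case zero
  show ?case
    by (simp add: path_map_simps to_path_simps small_loops_zero)
next
  case (monomial c d e)
  let ?k = "\<lambda>d. to_path (path_map (Var d))"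
  have loop: "?k d - Var d \<in> loops" for d :: "'a Dr"
    by (simp add: loops_iff at_simps at_to_path face_path_map sect_simps)
  have "Const c * (?k e * (?k d - Var d) + Var d * (?k e - Var e)) \<in> small_loops"
    by (intro small_loops_mult small_loops_add mult_loop_small loop)
      (simp_all add: at_simps at_to_path face_path_map sect_simps Dr_form_in_I2)
  moreover have "to_path (path_map (Const c * (Var d * Var e))) = Const c * (?k d * ?k e)"
    by (simp only: path_map_Const to_path_Const unital_ring_hom.hom_mult[OF unital_ring_hom_path_map]
      unital_ring_hom.hom_mult[OF unital_ring_hom_to_path])
  ultimately show ?case
    by (simp add: algebra_simps)
next
  case (add p q)
  from small_loops_add[OF add] show ?case
    by (simp add: path_map_simps to_path_simps algebra_simps)
qed

text \<open>Applying \<open>loop_sum\<close> to the chain of \<open>p\<close> returns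
  \<open>p\<close> up to small loops, while boundaries go to small loops.\<close>

lemma quadratic_loop_small:
  fixes p :: "('a Dr, 'a::comm_ring_1) mpol"
  assumes "p \<in> quadratic" "at_form p = 0" "path_class p 1 = 0"
  shows "p \<in> small_loops"
proof -
  have "Poly_Mapping.single (Var (path_map p)) 1 \<in> boundaries2"
    using assms(3) by (simp add: path_class_def chain_def abs_chain_class_eq_0_iff)
  moreover have "loop_sum (Poly_Mapping.single (Var (path_map p)) 1) - Const 1 * loop_of (Var (path_map p))
      \<in> small_loops"
    by (rule loop_sum_single) (rule mod_I2.hom_one)
  ultimately have "loop_of (Var (path_map p)) \<in> small_loops"
    using small_loops_diff[OF loop_sum_boundaries2] by (fastforce simp: Const_simps)
  moreover have "loop_of (Var (path_map p)) = to_path (path_map p)"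
    by (simp add: loop_of_def face_simps face_path_map assms quadratic_at_zero sect_simps Const_simps)
  ultimately show ?thesis
    using small_loops_diff[OF _ to_path_path_map[OF assms(1)]] by fastforce
qed


section \<open>The isomorphism\<close>

lemma boundaries2_coset_eq_iff:
  "(+) u ` boundaries2 = (+) v ` boundaries2 \<longleftrightarrow> abs_chain_class u = abs_chain_class v"
proof -
  have "(+) u ` boundaries2 = (+) v ` boundaries2 \<longleftrightarrow> u - v \<in> boundaries2"
  proof
    assume "(+) u ` boundaries2 = (+) v ` boundaries2"
    moreover have "u + 0 \<in> (+) u ` boundaries2"
      using boundaries2_zero by blast
    ultimately obtain b where "u = v + b" "b \<in> boundaries2"
      by auto
    then show "u - v \<in> boundaries2"
      by simp
  next
    have sub: "(+) u ` boundaries2 \<subseteq> (+) v ` boundaries2" if "u - v \<in> boundaries2"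
      for u v :: "('a mod_I2, 'a) P2 \<Rightarrow>\<^sub>0 'a mod_I2"
    proof
      fix x assume "x \<in> (+) u ` boundaries2"
      then obtain b where "x = u + b" "b \<in> boundaries2"
        by blast
      with boundaries2_add[OF that, of b] show "x \<in> (+) v ` boundaries2"
        by (intro image_eqI[of _ _ "u - v + b"]) simp_all
    qed
    assume "u - v \<in> boundaries2"
    moreover from boundaries2_uminus[OF this] have "v - u \<in> boundaries2"
      by simp
    ultimately show "(+) u ` boundaries2 = (+) v ` boundaries2"
      using sub by blast
  qed
  then show ?thesis
    by (simp add: chain_class.abs_eq_iff boundaries2_equiv_def)
qed

lemma boundaries2_coset_add:
  "{x + y | x y. x \<in> (+) u ` boundaries2 \<and> y \<in> (+) v ` boundaries2} = (+) (u + v) ` boundaries2"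
proof (intro equalityI subsetI)
  fix x assume "x \<in> (+) (u + v) ` boundaries2"
  then obtain b where "x = (u + b) + (v + 0)" "b \<in> boundaries2"
    by (auto simp: algebra_simps)
  then show "x \<in> {x + y | x y. x \<in> (+) u ` boundaries2 \<and> y \<in> (+) v ` boundaries2}"
    using boundaries2_zero by blast
next
  fix x assume "x \<in> {x + y | x y. x \<in> (+) u ` boundaries2 \<and> y \<in> (+) v ` boundaries2}"
  then obtain b c where "x = (u + b) + (v + c)" "b \<in> boundaries2" "c \<in> boundaries2"
    by blast
  then show "x \<in> (+) (u + v) ` boundaries2"
    using boundaries2_add by (intro image_eqI[of _ _ "b + c"]) (simp_all add: algebra_simps)
qed

lemma boundaries2_coset_scale:
  "{mod_I2.scl r x + n | x n. x \<in> (+) u ` boundaries2 \<and> n \<in> boundaries2} = (+) (mod_I2.scl r u) ` boundaries2"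
proof (intro equalityI subsetI)
  fix x assume "x \<in> (+) (mod_I2.scl r u) ` boundaries2"
  then obtain b where "x = mod_I2.scl r (u + 0) + b" "b \<in> boundaries2"
    by auto
  then show "x \<in> {mod_I2.scl r x + n | x n. x \<in> (+) u ` boundaries2 \<and> n \<in> boundaries2}"
    using boundaries2_zero by blast
next
  fix x assume "x \<in> {mod_I2.scl r x + n | x n. x \<in> (+) u ` boundaries2 \<and> n \<in> boundaries2}"
  then obtain b n where "x = mod_I2.scl r (u + b) + n" "b \<in> boundaries2" "n \<in> boundaries2"
    by blast
  then show "x \<in> (+) (mod_I2.scl r u) ` boundaries2"
    using boundaries2_add[OF boundaries2_scale]
    by (intro image_eqI[of _ _ "mod_I2.scl r b + n"])
      (simp_all add: module.scale_right_distrib[OF mod_I2.module_kaehler_scale] add.assoc)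
qed

definition quadratic_rep :: "'a::comm_ring_1 L2buds \<Rightarrow> ('a Dr, 'a) mpol"
  where "quadratic_rep x = (SOME p. p \<in> quadratic \<and> abs_L2buds p = x)"

definition loop_coset :: "('a Dr, 'a::comm_ring_1) mpol \<Rightarrow> (('a mod_I2, 'a) P2 \<Rightarrow>\<^sub>0 'a mod_I2) set"
  where "loop_coset p = (+) (Poly_Mapping.single (Var (path_map p)) 1) ` boundaries2"

lemma loop_coset_eq_iff: "loop_coset p = (+) z ` boundaries2 \<longleftrightarrow> path_class p 1 = abs_chain_class z"
  by (simp add: loop_coset_def boundaries2_coset_eq_iff path_class_def chain_def)

text \<open>The sections are the kernel of the product map on the symmetric square.\<close>

lemma carrier_H0_omega_2:
  fixes x :: "'a::{idom, ring_char_0} L2buds"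
  shows "x \<in> carrier (H0_omega 2) \<longleftrightarrow> (\<exists>p\<in>quadratic. at_form p = 0 \<and> abs_L2buds p = x)"
proof -
  have "x \<in> carrier (H0_omega 2) \<longleftrightarrow> x \<in> abs_L2buds ` quadratic \<and> eta_R x - eta_L x = 0"
    by (simp add: H0_omega_def L_degree_4)
  then show ?thesis
    using eta_R_eq_eta_L_iff by auto
qed

context
  fixes x :: "'a::{idom, ring_char_0} L2buds"
  assumes x: "x \<in> carrier (H0_omega 2)"
begin

lemma quadratic_rep: "quadratic_rep x \<in> quadratic" "abs_L2buds (quadratic_rep x) = x"
  using x someI_ex[of "\<lambda>p. p \<in> quadratic \<and> abs_L2buds p = x"]
  unfolding carrier_H0_omega_2 quadratic_rep_def by blast+

lemma at_form_quadratic_rep: "at_form (quadratic_rep x) = 0"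
  using x eta_R_eq_eta_L_iff[OF quadratic_rep(1)] by (simp add: quadratic_rep(2) H0_omega_def)

lemma quadratic_rep_in_loops: "quadratic_rep x \<in> loops"
  by (simp add: loops_iff at_form_quadratic_rep quadratic_at_zero quadratic_rep)

lemma path_class_quadratic_rep:
  assumes "p \<in> quadratic" "abs_L2buds p = x"
  shows "path_class (quadratic_rep x) w = path_class p w"
proof -
  have "quadratic_rep x - p \<in> small_loops"
    by (rule quadratic_sym_relation_small)
      (simp_all add: quadratic_diff quadratic_rep assms abs_L2buds_diff)
  then have "path_class (quadratic_rep x - p) w = 0" "quadratic_rep x - p \<in> loops"
    by (simp_all add: path_class_small_loops small_loops_subset_loops)
  from path_class_loop_plus[OF this(2), of p w] this(1) show ?thesis
    by simp
qed

end

theorem corollary3p6: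
  assumes "noetherian_ring (ring_of_type_algebra :: 'a::{idom, ring_char_0} ring)"
  shows "isomorphic_modules (ring_of_type_algebra :: 'a ring)
    (H0_omega 2 :: ('a, 'a L2buds) module)
    (AQ_H2 (to_mod_I2 :: 'a \<Rightarrow> 'a mod_I2) ((*) :: 'a mod_I2 \<Rightarrow> 'a mod_I2 \<Rightarrow> 'a mod_I2))"
proof -
  let ?H = "H0_omega 2 :: ('a, 'a L2buds) module"
  let ?f = "\<lambda>x :: 'a L2buds. loop_coset (quadratic_rep x)"
  have add: "x \<oplus>\<^bsub>?H\<^esub> y = x + y" and smult: "a \<odot>\<^bsub>?H\<^esub> x = L_const a * x" for a x y
    by (simp_all add: H0_omega_def)
  have carrier_AQ: "carrier (AQ_H2 to_mod_I2 (*)) = (\<lambda>z. (+) z ` boundaries2) ` (cycles2 :: (_ \<Rightarrow>\<^sub>0 'a mod_I2) set)"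
    by (simp add: AQ_H2_def quotient_module_def)
  have closed_add: "x + y \<in> carrier ?H" if xy: "x \<in> carrier ?H" "y \<in> carrier ?H" for x y
  proof -
    obtain p q where "p \<in> quadratic" "at_form p = 0" "abs_L2buds p = x"
      "q \<in> quadratic" "at_form q = 0" "abs_L2buds q = y"
      using xy unfolding carrier_H0_omega_2 by blast
    then show ?thesis
      unfolding carrier_H0_omega_2
      by (intro bexI[of _ "p + q"]) (simp_all add: abs_L2buds_add at_simps quadratic_add)
  qed
  have abs_scale: "abs_L2buds (Const a * p) = L_const a * abs_L2buds p" for a :: 'a and p
    by (simp add: abs_L2buds_mult L_const_def)
  have closed_smult: "L_const a * x \<in> carrier ?H" if x: "x \<in> carrier ?H" for a x
  proof -
    obtain p where "p \<in> quadratic" "at_form p = 0" "abs_L2buds p = x"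
      using x unfolding carrier_H0_omega_2 by blast
    then show ?thesis
      unfolding carrier_H0_omega_2
      by (intro bexI[of _ "Const a * p"]) (simp_all add: abs_scale at_simps quadratic_Const_mult)
  qed
  have "inj_on ?f (carrier ?H)"
  proof (rule inj_onI)
    fix x y assume x: "x \<in> carrier ?H" and y: "y \<in> carrier ?H" and eq: "?f x = ?f y"
    let ?d = "quadratic_rep x - quadratic_rep y"
    have "path_class (quadratic_rep x) 1 = path_class (quadratic_rep y) 1"
      using eq loop_coset_eq_iff[of "quadratic_rep x" "Poly_Mapping.single (Var (path_map (quadratic_rep y))) 1"]
      by (simp add: loop_coset_def path_class_def chain_def)
    moreover have "?d \<in> loops"
      using x y by (intro loops_diff quadratic_rep_in_loops)
    ultimately have "path_class ?d 1 = 0"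
      using path_class_loop_plus[of ?d "quadratic_rep y" 1] by simp
    moreover have "?d \<in> quadratic"
      using x y by (intro quadratic_diff quadratic_rep)
    \<comment> \<open>The difference is a small loop by the retraction from chains, and
      \<open>collapse\<close> shows that a quadratic small loop is zero in the symmetric
      algebra.\<close>
    ultimately have "abs_L2buds ?d = 0"
      using quadratic_small_loop_eq_0 quadratic_loop_small \<open>?d \<in> loops\<close> by (metis loops_iff)
    then show "x = y"
      by (simp add: abs_L2buds_diff quadratic_rep x y)
  qed
  moreover have "?f ` carrier ?H = carrier (AQ_H2 to_mod_I2 (*))"
  proof (intro equalityI subsetI)
    fix U assume "U \<in> ?f ` carrier ?H"
    then obtain x where "x \<in> carrier ?H" "U = ?f x"
      by blast
    then show "U \<in> carrier (AQ_H2 to_mod_I2 (*))"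
      unfolding carrier_AQ loop_coset_def
      using quadratic_loop_is_cycle[OF quadratic_rep(1) at_form_quadratic_rep] by blast
  next
    fix U assume "U \<in> carrier (AQ_H2 to_mod_I2 ((*) :: 'a mod_I2 \<Rightarrow> _))"
    then obtain z where z: "z \<in> cycles2" "U = (+) z ` boundaries2"
      unfolding carrier_AQ by blast
    obtain p where p: "p \<in> quadratic" "at_form p = 0" "abs_chain_class z = path_class p 1"
      using cycle_eq_quadratic_loop[OF z(1)] by blast
    then have "abs_L2buds p \<in> carrier ?H"
      unfolding carrier_H0_omega_2 by blast
    moreover from this have "?f (abs_L2buds p) = U"
      unfolding z loop_coset_eq_iff p(3) using p(1) by (intro path_class_quadratic_rep) simp_all
    ultimately show "U \<in> ?f ` carrier ?H"
      by blast
  qed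
  ultimately have "bij_betw ?f (carrier ?H) (carrier (AQ_H2 to_mod_I2 (*)))"
    by (rule bij_betw_imageI)
  moreover have "?f (x + y) = ?f x \<oplus>\<^bsub>AQ_H2 to_mod_I2 (*)\<^esub> ?f y"
    if x: "x \<in> carrier ?H" and y: "y \<in> carrier ?H" for x y
  proof -
    have "path_class (quadratic_rep (x + y)) 1 = path_class (quadratic_rep x + quadratic_rep y) 1"
      using x y by (intro path_class_quadratic_rep closed_add quadratic_add quadratic_rep)
        (simp_all add: abs_L2buds_add quadratic_rep)
    also have "\<dots> = path_class (quadratic_rep x) 1 + path_class (quadratic_rep y) 1"
      using x by (intro path_class_loop_plus quadratic_rep_in_loops)
    finally have "?f (x + y) = (+) (Poly_Mapping.single (Var (path_map (quadratic_rep x))) 1 +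
        Poly_Mapping.single (Var (path_map (quadratic_rep y))) 1) ` boundaries2"
      unfolding loop_coset_eq_iff abs_chain_class_add by (simp add: path_class_def chain_def)
    then show ?thesis
      by (simp add: AQ_H2_def quotient_module_def loop_coset_def boundaries2_coset_add)
  qed
  moreover have "?f (L_const a * x) = a \<odot>\<^bsub>AQ_H2 to_mod_I2 (*)\<^esub> ?f x"
    if x: "x \<in> carrier ?H" for a x
  proof -
    have "path_class (quadratic_rep (L_const a * x)) 1 = path_class (Const a * quadratic_rep x) 1"
      using x by (intro path_class_quadratic_rep closed_smult quadratic_Const_mult quadratic_rep)
        (simp_all add: abs_scale quadratic_rep)
    \<comment> \<open>The scalar moves from the loop to the coefficient of the chain, where it acts
      through A / I_2.\<close>
    also have "\<dots> = path_class (quadratic_rep x) (to_mod_I2 a * 1)"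
      using x by (intro path_class_Const_times quadratic_rep_in_loops)
    finally have "?f (L_const a * x) =
        (+) (mod_I2.scl a (Poly_Mapping.single (Var (path_map (quadratic_rep x))) 1)) ` boundaries2"
      unfolding loop_coset_eq_iff by (simp add: path_class_def chain_def mod_I2.kaehler_scale_single)
    then show ?thesis
      by (simp add: AQ_H2_def quotient_module_def loop_coset_def boundaries2_coset_scale)
  qed
  ultimately show ?thesis
    unfolding isomorphic_modules_def add smult by blast
qed

end
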